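(* Let $R$ be a Noetherian commutative ring with countable spectrum. Then all almost cotorsion $R$-modules are cotorsion.
   Context: "Countable" means at most countable; the spectrum of $R$ is the set of its prime ideals. An $R$-module $C$ is almost cotorsion if $\operatorname{Ext}^1_R(S^{-1}R,C)=0$ for all (at most) countable multiplicative subsets $S\subset R$. An $R$-module $C$ is cotorsion (in the sense of Enochs) if $\operatorname{Ext}^1_R(F,C)=0$ for all flat $R$-modules $F$. *)

theory Defs
  imports "HOL-Algebra.Algebra" "HOL-Library.Countable_Set"
begin

text \<open>
  The record type of modules extends that of rings. The ring-only fields (multiplication and unit)
  play no role in the locale \<^locale>\<open>module\<close> and are left \<^const>\<open>undefined\<close> below, except
  for localizations.
\<close>

section \<open>Homomorphisms, quotients and free modules\<close>

text \<open>Homomorphisms are extensional functions, so that equality of functions is equality of maps.\<close>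

definition mod_hom ::
  "('a, 'r) ring_scheme \<Rightarrow> ('a, 'b) module \<Rightarrow> ('a, 'c) module \<Rightarrow> ('b \<Rightarrow> 'c) set"
  where "mod_hom R M N =
    {f \<in> carrier M \<rightarrow>\<^sub>E carrier N.
      (\<forall>x \<in> carrier M. \<forall>y \<in> carrier M. f (x \<oplus>\<^bsub>M\<^esub> y) = f x \<oplus>\<^bsub>N\<^esub> f y) \<and>
      (\<forall>a \<in> carrier R. \<forall>x \<in> carrier M. f (a \<odot>\<^bsub>M\<^esub> x) = a \<odot>\<^bsub>N\<^esub> f x)}"

definition Hom ::
  "('a, 'r) ring_scheme \<Rightarrow> ('a, 'b) module \<Rightarrow> ('a, 'c) module \<Rightarrow> ('a, 'b \<Rightarrow> 'c) module"
  where "Hom R M N =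
    \<lparr>carrier = mod_hom R M N, monoid.mult = undefined, one = undefined,
     ring.zero = (\<lambda>x \<in> carrier M. \<zero>\<^bsub>N\<^esub>),
     ring.add = (\<lambda>f g. \<lambda>x \<in> carrier M. f x \<oplus>\<^bsub>N\<^esub> g x),
     smult = (\<lambda>a f. \<lambda>x \<in> carrier M. a \<odot>\<^bsub>N\<^esub> f x)\<rparr>"

definition module_kernel :: "('a, 'b) module \<Rightarrow> ('a, 'c) module \<Rightarrow> ('b \<Rightarrow> 'c) \<Rightarrow> 'b set"
  where "module_kernel M N f = {x \<in> carrier M. f x = \<zero>\<^bsub>N\<^esub>}"

definition submodule_generated ::
  "('a, 'r) ring_scheme \<Rightarrow> ('a, 'b) module \<Rightarrow> 'b set \<Rightarrow> 'b set"
  where "submodule_generated R M B = \<Inter> {H. submodule H R M \<and> B \<subseteq> H}"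

definition quotient_module :: "('a, 'b) module \<Rightarrow> 'b set \<Rightarrow> ('a, 'b set) module"
  where "quotient_module M H =
    \<lparr>carrier = a_rcosets\<^bsub>M\<^esub> H, monoid.mult = undefined, one = undefined, ring.zero = H,
     ring.add = set_add M,
     smult = (\<lambda>a T. \<Union>x \<in> T. H +>\<^bsub>M\<^esub> (a \<odot>\<^bsub>M\<^esub> x))\<rparr>"

text \<open>The free module on a set \<open>B\<close>: finitely supported functions from \<open>B\<close> to \<open>R\<close>, extended by zero.\<close>

definition free_module :: "('a, 'r) ring_scheme \<Rightarrow> 'x set \<Rightarrow> ('a, 'x \<Rightarrow> 'a) module"
  where "free_module R B =
    \<lparr>carrier = {\<phi>. (\<forall>x \<in> B. \<phi> x \<in> carrier R) \<and> (\<forall>x. x \<notin> B \<longrightarrow> \<phi> x = \<zero>\<^bsub>R\<^esub>) \<and>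
                  finite {x. \<phi> x \<noteq> \<zero>\<^bsub>R\<^esub>}},
     monoid.mult = undefined, one = undefined,
     ring.zero = (\<lambda>x. \<zero>\<^bsub>R\<^esub>),
     ring.add = (\<lambda>\<phi> \<psi> x. \<phi> x \<oplus>\<^bsub>R\<^esub> \<psi> x),
     smult = (\<lambda>a \<phi> x. a \<otimes>\<^bsub>R\<^esub> \<phi> x)\<rparr>"

definition basis_vector :: "('a, 'r) ring_scheme \<Rightarrow> 'x \<Rightarrow> 'x \<Rightarrow> 'a"
  where "basis_vector R x = (\<lambda>y. if y = x then \<one>\<^bsub>R\<^esub> else \<zero>\<^bsub>R\<^esub>)"

text \<open>
  The linear extension to the free module on \<open>B\<close> of a map \<open>g\<close> from \<open>B\<close> to \<open>M\<close>. The sum runs over the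
  support because a \<^const>\<open>finsum\<close> over an infinite set is a dummy value.
\<close>

definition linear_extension ::
  "('a, 'r) ring_scheme \<Rightarrow> 'x set \<Rightarrow> ('a, 'b) module \<Rightarrow> ('x \<Rightarrow> 'b) \<Rightarrow> ('x \<Rightarrow> 'a) \<Rightarrow> 'b"
  where "linear_extension R B M g =
    (\<lambda>\<phi> \<in> carrier (free_module R B). \<Oplus>\<^bsub>M\<^esub>x \<in> {x. \<phi> x \<noteq> \<zero>\<^bsub>R\<^esub>}. \<phi> x \<odot>\<^bsub>M\<^esub> g x)"


section \<open>The first Ext group\<close>

text \<open>
  The beginning of the canonical free resolution of \<open>M\<close>: the term in degree 0 is free on all elements
  of \<open>M\<close>, and each further term is free on all elements of the preceding kernel.
\<close>

definition res0 :: "('a, 'r) ring_scheme \<Rightarrow> ('a, 'b) module \<Rightarrow> ('a, 'b \<Rightarrow> 'a) module"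
  where "res0 R M = free_module R (carrier M)"

definition syzygy1 :: "('a, 'r) ring_scheme \<Rightarrow> ('a, 'b) module \<Rightarrow> ('b \<Rightarrow> 'a) set"
  where "syzygy1 R M = module_kernel (res0 R M) M (linear_extension R (carrier M) M (\<lambda>x. x))"

definition res1 :: "('a, 'r) ring_scheme \<Rightarrow> ('a, 'b) module \<Rightarrow> ('a, ('b \<Rightarrow> 'a) \<Rightarrow> 'a) module"
  where "res1 R M = free_module R (syzygy1 R M)"

definition diff1 :: "('a, 'r) ring_scheme \<Rightarrow> ('a, 'b) module \<Rightarrow> (('b \<Rightarrow> 'a) \<Rightarrow> 'a) \<Rightarrow> 'b \<Rightarrow> 'a"
  where "diff1 R M = linear_extension R (syzygy1 R M) (res0 R M) (\<lambda>x. x)"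

definition syzygy2 :: "('a, 'r) ring_scheme \<Rightarrow> ('a, 'b) module \<Rightarrow> (('b \<Rightarrow> 'a) \<Rightarrow> 'a) set"
  where "syzygy2 R M = module_kernel (res1 R M) (res0 R M) (diff1 R M)"

definition res2 ::
  "('a, 'r) ring_scheme \<Rightarrow> ('a, 'b) module \<Rightarrow> ('a, (('b \<Rightarrow> 'a) \<Rightarrow> 'a) \<Rightarrow> 'a) module"
  where "res2 R M = free_module R (syzygy2 R M)"

definition diff2 ::
  "('a, 'r) ring_scheme \<Rightarrow> ('a, 'b) module \<Rightarrow> ((('b \<Rightarrow> 'a) \<Rightarrow> 'a) \<Rightarrow> 'a) \<Rightarrow> ('b \<Rightarrow> 'a) \<Rightarrow> 'a"
  where "diff2 R M = linear_extension R (syzygy2 R M) (res1 R M) (\<lambda>x. x)"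

definition Ext1_cocycles ::
  "('a, 'r) ring_scheme \<Rightarrow> ('a, 'b) module \<Rightarrow> ('a, 'c) module \<Rightarrow> ((('b \<Rightarrow> 'a) \<Rightarrow> 'a) \<Rightarrow> 'c) set"
  where "Ext1_cocycles R M N =
    module_kernel (Hom R (res1 R M) N) (Hom R (res2 R M) N)
      (\<lambda>f. compose (carrier (res2 R M)) f (diff2 R M))"

definition Ext1_coboundaries ::
  "('a, 'r) ring_scheme \<Rightarrow> ('a, 'b) module \<Rightarrow> ('a, 'c) module \<Rightarrow> ((('b \<Rightarrow> 'a) \<Rightarrow> 'a) \<Rightarrow> 'c) set"
  where "Ext1_coboundaries R M N =
    (\<lambda>f. compose (carrier (res1 R M)) f (diff1 R M)) ` carrier (Hom R (res0 R M) N)"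

text \<open>The cohomology in degree 1 of \<open>Hom(P, N)\<close>, where \<open>P\<close> is the canonical free resolution of \<open>M\<close>.\<close>

definition Ext1 ::
  "('a, 'r) ring_scheme \<Rightarrow> ('a, 'b) module \<Rightarrow> ('a, 'c) module \<Rightarrow>
    ('a, ((('b \<Rightarrow> 'a) \<Rightarrow> 'a) \<Rightarrow> 'c) set) module"
  where "Ext1 R M N =
    quotient_module ((Hom R (res1 R M) N)\<lparr>carrier := Ext1_cocycles R M N\<rparr>)
      (Ext1_coboundaries R M N)"

definition zero_module :: "('a, 'b) module \<Rightarrow> bool"
  where "zero_module M \<longleftrightarrow> carrier M = {\<zero>\<^bsub>M\<^esub>}"


section \<open>Tensor products and flat modules\<close>

definition tensor_relations ::
  "('a, 'r) ring_scheme \<Rightarrow> ('a, 'b) module \<Rightarrow> ('a, 'c) module \<Rightarrow> ('b \<times> 'c \<Rightarrow> 'a) set"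
  where "tensor_relations R M N =
    (let P = free_module R (carrier M \<times> carrier N); e = basis_vector R in
     submodule_generated R P
      ({e (x \<oplus>\<^bsub>M\<^esub> x', y) \<ominus>\<^bsub>P\<^esub> (e (x, y) \<oplus>\<^bsub>P\<^esub> e (x', y)) | x x' y.
          x \<in> carrier M \<and> x' \<in> carrier M \<and> y \<in> carrier N} \<union>
       {e (x, y \<oplus>\<^bsub>N\<^esub> y') \<ominus>\<^bsub>P\<^esub> (e (x, y) \<oplus>\<^bsub>P\<^esub> e (x, y')) | x y y'.
          x \<in> carrier M \<and> y \<in> carrier N \<and> y' \<in> carrier N} \<union>
       {e (a \<odot>\<^bsub>M\<^esub> x, y) \<ominus>\<^bsub>P\<^esub> (a \<odot>\<^bsub>P\<^esub> e (x, y)) | a x y.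
          a \<in> carrier R \<and> x \<in> carrier M \<and> y \<in> carrier N} \<union>
       {e (x, a \<odot>\<^bsub>N\<^esub> y) \<ominus>\<^bsub>P\<^esub> (a \<odot>\<^bsub>P\<^esub> e (x, y)) | a x y.
          a \<in> carrier R \<and> x \<in> carrier M \<and> y \<in> carrier N}))"

definition tensor ::
  "('a, 'r) ring_scheme \<Rightarrow> ('a, 'b) module \<Rightarrow> ('a, 'c) module \<Rightarrow> ('a, ('b \<times> 'c \<Rightarrow> 'a) set) module"
  where "tensor R M N =
    quotient_module (free_module R (carrier M \<times> carrier N)) (tensor_relations R M N)"

text \<open>
  \<open>tensor_map R L M N f\<close> is the map from the tensor product of \<open>L\<close> and \<open>N\<close> to that of \<open>M\<close> and \<open>N\<close>
  induced by \<open>f\<close> and the identity of \<open>N\<close>. All cosets in the union are equal.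
\<close>

definition tensor_map ::
  "('a, 'r) ring_scheme \<Rightarrow> ('a, 'b) module \<Rightarrow> ('a, 'c) module \<Rightarrow> ('a, 'd) module \<Rightarrow> ('b \<Rightarrow> 'c) \<Rightarrow>
    ('b \<times> 'd \<Rightarrow> 'a) set \<Rightarrow> ('c \<times> 'd \<Rightarrow> 'a) set"
  where "tensor_map R L M N f =
    (\<lambda>T \<in> carrier (tensor R L N). \<Union>\<phi> \<in> T.
      tensor_relations R M N +>\<^bsub>free_module R (carrier M \<times> carrier N)\<^esub>
        linear_extension R (carrier L \<times> carrier N) (free_module R (carrier M \<times> carrier N))
          (\<lambda>(x, y). basis_vector R (f x, y)) \<phi>)"

definition exact_at ::
  "('a, 'b) module \<Rightarrow> ('b \<Rightarrow> 'c) \<Rightarrow> ('a, 'c) module \<Rightarrow> ('c \<Rightarrow> 'd) \<Rightarrow> ('a, 'd) module \<Rightarrow> bool"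
  where "exact_at L f M g N \<longleftrightarrow> f ` carrier L = module_kernel M N g"

text \<open>
  Flatness: tensoring preserves exact sequences. HOL cannot quantify over all types of elements, so
  the test modules live in the type \<open>nat \<Rightarrow> 'a\<close>. This is no restriction: up to isomorphism it contains
  every finitely generated \<open>R\<close>-module and all submodules and quotients of these (a quotient is
  carried by a set of representatives), in particular the inclusions of ideals into \<open>R\<close>, and these
  already detect flatness.
\<close>

definition flat_module :: "('a, 'r) ring_scheme \<Rightarrow> ('a, 'f) module \<Rightarrow> bool"
  where "flat_module R F \<longleftrightarrow> module R F \<and>
    (\<forall>(L :: ('a, nat \<Rightarrow> 'a) module) (M :: ('a, nat \<Rightarrow> 'a) module) (N :: ('a, nat \<Rightarrow> 'a) module) f g.
      module R L \<and> module R M \<and> module R N \<and> f \<in> mod_hom R L M \<and> g \<in> mod_hom R M N \<and>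
      exact_at L f M g N \<longrightarrow>
      exact_at (tensor R L F) (tensor_map R L M F f) (tensor R M F) (tensor_map R M N F g)
        (tensor R N F))"


section \<open>Localization\<close>

definition fraction_rel ::
  "('a, 'r) ring_scheme \<Rightarrow> 'a set \<Rightarrow> (('a \<times> 'a) \<times> ('a \<times> 'a)) set"
  where "fraction_rel R S =
    {((r, s), (r', s')). r \<in> carrier R \<and> s \<in> S \<and> r' \<in> carrier R \<and> s' \<in> S \<and>
      (\<exists>t \<in> S. t \<otimes>\<^bsub>R\<^esub> (s' \<otimes>\<^bsub>R\<^esub> r) = t \<otimes>\<^bsub>R\<^esub> (s \<otimes>\<^bsub>R\<^esub> r'))}"

text \<open>The ring of fractions of \<open>R\<close> with denominators in \<open>S\<close>, as an \<open>R\<close>-algebra. Zero divisors, and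
  even zero, are allowed in \<open>S\<close>.\<close>

definition localization :: "('a, 'r) ring_scheme \<Rightarrow> 'a set \<Rightarrow> ('a, ('a \<times> 'a) set) module"
  where "localization R S =
    (let frac = (\<lambda>r s. fraction_rel R S `` {(r, s)}) in
     \<lparr>carrier = (carrier R \<times> S) // fraction_rel R S,
      monoid.mult = (\<lambda>T U. \<Union>(r, s) \<in> T. \<Union>(r', s') \<in> U. frac (r \<otimes>\<^bsub>R\<^esub> r') (s \<otimes>\<^bsub>R\<^esub> s')),
      one = frac \<one>\<^bsub>R\<^esub> \<one>\<^bsub>R\<^esub>,
      ring.zero = frac \<zero>\<^bsub>R\<^esub> \<one>\<^bsub>R\<^esub>,
      ring.add = (\<lambda>T U. \<Union>(r, s) \<in> T. \<Union>(r', s') \<in> U.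
        frac ((s' \<otimes>\<^bsub>R\<^esub> r) \<oplus>\<^bsub>R\<^esub> (s \<otimes>\<^bsub>R\<^esub> r')) (s \<otimes>\<^bsub>R\<^esub> s')),
      smult = (\<lambda>a T. \<Union>(r, s) \<in> T. frac (a \<otimes>\<^bsub>R\<^esub> r) s)\<rparr>)"


section \<open>Cotorsion and almost cotorsion modules\<close>

text \<open>In the library a \<^const>\<open>submonoid\<close> of \<open>R\<close> is a subset containing 1 and closed under
  the multiplication of \<open>R\<close>, that is, a multiplicative subset.\<close>

definition almost_cotorsion :: "('a, 'r) ring_scheme \<Rightarrow> ('a, 'c) module \<Rightarrow> bool"
  where "almost_cotorsion R C \<longleftrightarrow> module R C \<and>
    (\<forall>S. submonoid S R \<and> countable S \<longrightarrow> zero_module (Ext1 R (localization R S) C))"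

text \<open>The type argument is the type of elements of the flat modules \<open>F\<close>; the notion in the literature
  is obtained by letting it be an arbitrary type.\<close>

definition cotorsion :: "'f itself \<Rightarrow> ('a, 'r) ring_scheme \<Rightarrow> ('a, 'c) module \<Rightarrow> bool"
  where "cotorsion _ R C \<longleftrightarrow> module R C \<and>
    (\<forall>F :: ('a, 'f) module. flat_module R F \<longrightarrow> zero_module (Ext1 R F C))"

definition spectrum :: "('a, 'r) ring_scheme \<Rightarrow> 'a set set"
  where "spectrum R = {P. primeideal P R}"

end

theory Submission
  imports Defs
begin

text \<open>
  Write a flat module as \<open>F = P/K\<close> with \<open>P\<close> free. The group \<open>Ext1 R F C\<close> vanishes iff every linear map
  from \<open>K\<close> to \<open>C\<close> extends to \<open>P\<close> (\<open>Ext1_zero_iff\<close>), and the proof constructs such extensions.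

  Both hypotheses are first brought into an elementary form. Flatness of \<open>F\<close> is used only through
  Villamayor's criterion: for every finite subset of \<open>K\<close> there is a linear map from \<open>P\<close> to \<open>K\<close> that fixes
  it (\<open>flat_retracts\<close>). For the module \<open>C\<close>, note that inverting a countable set of elements produces the
  colimit of a sequence of multiplications \<open>s\<^sub>n\<close> on \<open>R\<close>, so that the vanishing of Ext says that all
  systems \<open>x\<^sub>n - s\<^sub>n x\<^sub>n\<^sub>+\<^sub>1 = d\<^sub>n\<close> are solvable in \<open>C\<close> (\<open>almost_cotorsion_telescoping\<close>). A module with this
  property is called telescoping here. Quotients of telescoping modules are obviously telescoping, and
  so is the reduced power of any module at all, the module of sequences modulo those that are
  eventually zero (\<open>power_telescoping\<close>).

  The claim is that for telescoping \<open>D\<close> all maps from \<open>K\<close> to \<open>D\<close> extend to \<open>P\<close>. It is proved by Noetherian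
  induction on the annihilator \<open>p\<close> of \<open>D\<close>. If \<open>a b\<close> lies in \<open>p\<close> but \<open>a\<close> and \<open>b\<close> do not, then \<open>a D\<close> and
  \<open>D/a D\<close> are telescoping with larger annihilators, and \<open>D\<close> is an extension of one by the other. So let
  \<open>p\<close> be prime. Since the spectrum is countable, there is a sequence of elements outside \<open>p\<close> that
  meets every prime ideal strictly above \<open>p\<close>, and products \<open>s\<^sub>n\<close> of its terms such that every element
  outside \<open>p\<close> divides some \<open>s\<^sub>0 \<cdots> s\<^sub>m\<close> modulo \<open>p\<close> (\<open>meeting_sequence\<close>). The limit of \<open>D\<close> along the
  multiplications \<open>s\<^sub>n\<close> is therefore a vector space over the residue field of \<open>p\<close>, and a map from \<open>K\<close> into it extends to \<open>P\<close>
  (\<open>compatible_family_extends\<close>). A map \<open>f\<close> from \<open>K\<close> to \<open>D\<close> lifts to the limit, up to maps that extend to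
  \<open>P\<close>, if one can repeatedly write \<open>f = s f' + g\<close>, where \<open>s\<close> is outside \<open>p\<close> and \<open>g\<close> extends to \<open>P\<close>; the
  maps \<open>g\<close> that accumulate are absorbed because \<open>D\<close> is telescoping (\<open>extensible_prime\<close>).

  This leaves the surjectivity of multiplication by \<open>s\<close> on \<open>Ext1 R F D\<close>. As \<open>D/s D\<close> has a larger
  annihilator, \<open>f\<close> may be assumed to take values in \<open>s D\<close>, and has to be lifted along the
  multiplication from \<open>D\<close> to \<open>s D\<close>. The obstruction lies in \<open>Ext\<^sup>2 (F, D[s])\<close>, where \<open>D[s]\<close> need not be
  telescoping. It is removed by embedding \<open>D[s]\<close> into a reduced power of the pullback of \<open>f\<close> and the
  multiplication, taken modulo the ideal generated by \<open>p\<close> and \<open>s\<close>: the cokernel is telescoping with a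
  larger annihilator, so the induction hypothesis applies to it (\<open>division_lift\<close>).

  The induction changes \<open>D\<close>, so all modules that occur in it must be found in one type. They are
  represented as subquotients of a single ambient module that is large enough to encode reduced powers
  of its own submodules paired with \<open>P\<close>.
\<close>

lemma (in abelian_group) a_inv_zero: "\<ominus> \<zero> = \<zero>"
  using minus_equality[of \<zero> \<zero>] by simp

text \<open>With these rules the method \<open>algebra\<close> decides identities between linear combinations in a
  module over a commutative ring, given that the atoms lie in the carriers.\<close>

lemmas (in module) module_simprules
  [algebra module "ring.zero R" "ring.add R" "a_inv R" "a_minus R" "monoid.one R" "monoid.mult R"
    "ring.zero M" "ring.add M" "a_inv M" "a_minus M" "smult M"] =
  M.a_closed M.zero_closed M.a_inv_closed M.minus_closed smult_closed
  M.a_assoc M.l_zero M.l_neg M.a_comm M.minus_eq M.r_zero M.r_neg M.r_neg2 M.r_neg1 M.minus_add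
  M.minus_minus M.a_inv_zero M.a_lcomm
  smult_r_distr smult_l_distr smult_assoc1[symmetric] smult_l_minus smult_r_minus smult_l_null
  smult_r_null smult_one
  R.a_closed R.zero_closed R.a_inv_closed R.minus_closed R.m_closed R.one_closed
  R.a_assoc R.l_zero R.l_neg R.a_comm R.m_assoc R.l_one R.l_distr R.m_comm R.minus_eq
  R.r_zero R.r_neg R.r_neg2 R.r_neg1 R.minus_add R.minus_minus R.minus_zero
  R.a_lcomm R.m_lcomm R.r_distr R.l_null R.r_null R.l_minus R.r_minus

section \<open>Linear maps and free modules\<close>

definition linear :: "('a, 'r) ring_scheme \<Rightarrow> ('a, 'b) module \<Rightarrow> ('a, 'c) module \<Rightarrow> ('b \<Rightarrow> 'c) \<Rightarrow> bool"
  where "linear R M N f \<longleftrightarrow> f \<in> carrier M \<rightarrow> carrier N \<and>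
    (\<forall>x \<in> carrier M. \<forall>y \<in> carrier M. f (x \<oplus>\<^bsub>M\<^esub> y) = f x \<oplus>\<^bsub>N\<^esub> f y) \<and>
    (\<forall>a \<in> carrier R. \<forall>x \<in> carrier M. f (a \<odot>\<^bsub>M\<^esub> x) = a \<odot>\<^bsub>N\<^esub> f x)"

lemma mod_hom_iff: "f \<in> mod_hom R M N \<longleftrightarrow> linear R M N f \<and> f \<in> extensional (carrier M)"
  by (auto simp: mod_hom_def linear_def PiE_def)

lemma linearI:
  assumes "\<And>x. x \<in> carrier M \<Longrightarrow> f x \<in> carrier N"
    and "\<And>x y. x \<in> carrier M \<Longrightarrow> y \<in> carrier M \<Longrightarrow> f (x \<oplus>\<^bsub>M\<^esub> y) = f x \<oplus>\<^bsub>N\<^esub> f y"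
    and "\<And>a x. a \<in> carrier R \<Longrightarrow> x \<in> carrier M \<Longrightarrow> f (a \<odot>\<^bsub>M\<^esub> x) = a \<odot>\<^bsub>N\<^esub> f x"
  shows "linear R M N f"
  using assms by (auto simp: linear_def)

lemma linear_closed: "linear R M N f \<Longrightarrow> x \<in> carrier M \<Longrightarrow> f x \<in> carrier N"
  and linear_add: "linear R M N f \<Longrightarrow> x \<in> carrier M \<Longrightarrow> y \<in> carrier M \<Longrightarrow> f (x \<oplus>\<^bsub>M\<^esub> y) = f x \<oplus>\<^bsub>N\<^esub> f y"
  and linear_smult: "linear R M N f \<Longrightarrow> a \<in> carrier R \<Longrightarrow> x \<in> carrier M \<Longrightarrow> f (a \<odot>\<^bsub>M\<^esub> x) = a \<odot>\<^bsub>N\<^esub> f x"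
  by (auto simp: linear_def)

lemma linear_zero:
  assumes "module R M" "module R N" "linear R M N f"
  shows "f \<zero>\<^bsub>M\<^esub> = \<zero>\<^bsub>N\<^esub>"
proof -
  interpret M: module R M by fact
  interpret N: module R N by fact
  have "f (\<zero>\<^bsub>R\<^esub> \<odot>\<^bsub>M\<^esub> \<zero>\<^bsub>M\<^esub>) = \<zero>\<^bsub>R\<^esub> \<odot>\<^bsub>N\<^esub> f \<zero>\<^bsub>M\<^esub>"
    using assms(3) by (intro linear_smult) auto
  then show ?thesis using linear_closed[OF assms(3)] by simp
qed

lemma linear_minus:
  assumes "module R M" "module R N" "linear R M N f" "x \<in> carrier M"
  shows "f (\<ominus>\<^bsub>M\<^esub> x) = \<ominus>\<^bsub>N\<^esub> f x"
proof -
  interpret M: module R M by fact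
  interpret N: module R N by fact
  have fx: "f x \<in> carrier N" using linear_closed assms by metis
  have "f ((\<ominus>\<^bsub>R\<^esub> \<one>\<^bsub>R\<^esub>) \<odot>\<^bsub>M\<^esub> x) = (\<ominus>\<^bsub>R\<^esub> \<one>\<^bsub>R\<^esub>) \<odot>\<^bsub>N\<^esub> f x"
    using assms by (intro linear_smult) auto
  then show ?thesis using fx assms(4) by (simp add: M.smult_l_minus N.smult_l_minus)
qed

lemma linear_diff:
  assumes "module R M" "module R N" "linear R M N f" "x \<in> carrier M" "y \<in> carrier M"
  shows "f (x \<ominus>\<^bsub>M\<^esub> y) = f x \<ominus>\<^bsub>N\<^esub> f y"
proof -
  interpret M: module R M by fact
  interpret N: module R N by fact
  show ?thesis using assms linear_add[OF assms(3)] linear_minus[OF assms(1,2,3)]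
    by (simp add: M.minus_eq N.minus_eq)
qed

lemma linear_comp: "linear R M N f \<Longrightarrow> linear R N L g \<Longrightarrow> linear R M L (\<lambda>x. g (f x))"
  by (auto simp: linear_def Pi_iff)

context module begin

lemma diff_zero_iff:
  assumes "x \<in> carrier M" "y \<in> carrier M"
  shows "x \<ominus>\<^bsub>M\<^esub> y = \<zero>\<^bsub>M\<^esub> \<longleftrightarrow> x = y"
proof
  assume "x \<ominus>\<^bsub>M\<^esub> y = \<zero>\<^bsub>M\<^esub>"
  moreover have "x = (x \<ominus>\<^bsub>M\<^esub> y) \<oplus>\<^bsub>M\<^esub> y" using assms by algebra
  ultimately show "x = y" using assms by simp
qed (use assms in \<open>simp add: M.minus_eq M.r_neg\<close>)

lemma submodule_mem:
  assumes "submodule H R M"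
  shows "x \<in> H \<Longrightarrow> x \<in> carrier M" "\<zero>\<^bsub>M\<^esub> \<in> H" "x \<in> H \<Longrightarrow> y \<in> H \<Longrightarrow> x \<oplus>\<^bsub>M\<^esub> y \<in> H"
    "x \<in> H \<Longrightarrow> \<ominus>\<^bsub>M\<^esub> x \<in> H" "x \<in> H \<Longrightarrow> y \<in> H \<Longrightarrow> x \<ominus>\<^bsub>M\<^esub> y \<in> H"
    "a \<in> carrier R \<Longrightarrow> x \<in> H \<Longrightarrow> a \<odot>\<^bsub>M\<^esub> x \<in> H"
  using submoduleE[OF assms] subgroup.one_closed[OF submodule.axioms(1)[OF assms]]
  by (auto simp: M.minus_eq)

lemma submodule_subset: "submodule H R M \<Longrightarrow> H \<subseteq> carrier M"
  by (rule submoduleE)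

lemma submodule_of_scalar_closed:
  assumes "H \<subseteq> carrier M" "\<zero>\<^bsub>M\<^esub> \<in> H" "\<And>x y. x \<in> H \<Longrightarrow> y \<in> H \<Longrightarrow> x \<oplus>\<^bsub>M\<^esub> y \<in> H"
    "\<And>a x. a \<in> carrier R \<Longrightarrow> x \<in> H \<Longrightarrow> a \<odot>\<^bsub>M\<^esub> x \<in> H"
  shows "submodule H R M"
proof (rule submoduleI)
  fix a assume a: "a \<in> H"
  then have "\<ominus>\<^bsub>M\<^esub> a = (\<ominus>\<^bsub>R\<^esub> \<one>\<^bsub>R\<^esub>) \<odot>\<^bsub>M\<^esub> a" using assms(1) by (simp add: smult_l_minus subset_iff)
  then show "\<ominus>\<^bsub>M\<^esub> a \<in> H" using assms(4)[of "\<ominus>\<^bsub>R\<^esub> \<one>\<^bsub>R\<^esub>" a] a by simp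
qed (use assms in auto)

lemma submodule_finsum:
  assumes "submodule H R M" "\<And>i. i \<in> A \<Longrightarrow> f i \<in> H"
  shows "(\<Oplus>\<^bsub>M\<^esub>i \<in> A. f i) \<in> H"
  using assms(2)
proof (induct A rule: infinite_finite_induct)
  case (insert x F)
  have "f \<in> F \<rightarrow> carrier M" "f x \<in> carrier M" using insert submodule_subset[OF assms(1)] by auto
  then show ?case using insert submodule_mem[OF assms(1)] by simp
qed (use submodule_mem[OF assms(1)] in \<open>auto simp: M.finsum_infinite\<close>)

end

lemma submodule_vimage:
  assumes "module R M" "module R N" "linear R M N f" "submodule H R N"
  shows "submodule {x \<in> carrier M. f x \<in> H} R M"
proof -
  interpret M: module R M by fact
  interpret N: module R N by fact
  show ?thesis
    using N.submodule_mem[OF assms(4)]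
    by (intro M.submodule_of_scalar_closed)
       (auto simp: linear_zero[OF assms(1,2,3)] linear_add[OF assms(3)] linear_smult[OF assms(3)])
qed

lemma submodule_zero: "module R M \<Longrightarrow> submodule {\<zero>\<^bsub>M\<^esub>} R M"
proof -
  assume "module R M" then interpret module R M .
  show ?thesis by (rule submodule_of_scalar_closed) auto
qed

lemma linear_add_maps:
  assumes M: "module R M" and f: "linear R N M f" and g: "linear R N M g"
  shows "linear R N M (\<lambda>x. f x \<oplus>\<^bsub>M\<^esub> g x)"
proof -
  interpret M: module R M by (rule M)
  note c = linear_closed[OF f] linear_closed[OF g]
  note l = linear_add[OF f] linear_add[OF g] linear_smult[OF f] linear_smult[OF g]
  show ?thesis
  proof (rule linearI)
    fix x y assume "x \<in> carrier N" "y \<in> carrier N"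
    with c[of x] c[of y] show "f (x \<oplus>\<^bsub>N\<^esub> y) \<oplus>\<^bsub>M\<^esub> g (x \<oplus>\<^bsub>N\<^esub> y) = (f x \<oplus>\<^bsub>M\<^esub> g x) \<oplus>\<^bsub>M\<^esub> (f y \<oplus>\<^bsub>M\<^esub> g y)"
      unfolding l(1,2)[OF \<open>x \<in> _\<close> \<open>y \<in> _\<close>] by algebra
  qed (auto simp: c l M.smult_r_distr)
qed

lemma linear_scale:
  assumes M: "module R M" and f: "linear R N M f" and a: "a \<in> carrier R"
  shows "linear R N M (\<lambda>x. a \<odot>\<^bsub>M\<^esub> f x)"
proof -
  interpret M: module R M by (rule M)
  note c = linear_closed[OF f]
  show ?thesis
  proof (rule linearI)
    fix b x assume "b \<in> carrier R" "x \<in> carrier N"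
    with c[of x] a show "a \<odot>\<^bsub>M\<^esub> f (b \<odot>\<^bsub>N\<^esub> x) = b \<odot>\<^bsub>M\<^esub> (a \<odot>\<^bsub>M\<^esub> f x)"
      unfolding linear_smult[OF f \<open>b \<in> _\<close> \<open>x \<in> _\<close>] by algebra
  qed (auto simp: a c linear_add[OF f] M.smult_r_distr)
qed

lemma linear_diff_maps:
  assumes M: "module R M" and f: "linear R N M f" and g: "linear R N M g"
  shows "linear R N M (\<lambda>x. f x \<ominus>\<^bsub>M\<^esub> g x)"
proof -
  interpret M: module R M by (rule M)
  note c = linear_closed[OF f] linear_closed[OF g]
  note l = linear_add[OF f] linear_add[OF g] linear_smult[OF f] linear_smult[OF g]
  show ?thesis
  proof (rule linearI)
    fix x y assume "x \<in> carrier N" "y \<in> carrier N"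
    with c[of x] c[of y] show "f (x \<oplus>\<^bsub>N\<^esub> y) \<ominus>\<^bsub>M\<^esub> g (x \<oplus>\<^bsub>N\<^esub> y) = (f x \<ominus>\<^bsub>M\<^esub> g x) \<oplus>\<^bsub>M\<^esub> (f y \<ominus>\<^bsub>M\<^esub> g y)"
      unfolding l(1,2)[OF \<open>x \<in> _\<close> \<open>y \<in> _\<close>] by algebra
  qed (auto simp: c l M.smult_r_distr M.smult_r_minus M.minus_eq)
qed

lemma linear_zero_map: "module R M \<Longrightarrow> linear R N M (\<lambda>x. \<zero>\<^bsub>M\<^esub>)"
proof -
  assume "module R M" then interpret M: module R M .
  show ?thesis by (rule linearI) auto
qed

lemma free_module_sel:
  "carrier (free_module R B) = {\<phi>. (\<forall>x \<in> B. \<phi> x \<in> carrier R) \<and> (\<forall>x. x \<notin> B \<longrightarrow> \<phi> x = \<zero>\<^bsub>R\<^esub>) \<and>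
                  finite {x. \<phi> x \<noteq> \<zero>\<^bsub>R\<^esub>}}"
  "\<zero>\<^bsub>free_module R B\<^esub> = (\<lambda>x. \<zero>\<^bsub>R\<^esub>)"
  "\<phi> \<oplus>\<^bsub>free_module R B\<^esub> \<psi> = (\<lambda>x. \<phi> x \<oplus>\<^bsub>R\<^esub> \<psi> x)"
  "a \<odot>\<^bsub>free_module R B\<^esub> \<phi> = (\<lambda>x. a \<otimes>\<^bsub>R\<^esub> \<phi> x)"
  by (simp_all add: free_module_def)

context cring begin

lemma free_module_coord:
  "\<phi> \<in> carrier (free_module R B) \<Longrightarrow> \<phi> x \<in> carrier R"
  "\<phi> \<in> carrier (free_module R B) \<Longrightarrow> finite {x. \<phi> x \<noteq> \<zero>}"
  "\<phi> \<in> carrier (free_module R B) \<Longrightarrow> {x. \<phi> x \<noteq> \<zero>} \<subseteq> B"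
  by (cases "x \<in> B"; auto simp: free_module_sel)+

lemma free_module_module: "module R (free_module R B)"
proof (intro moduleI abelian_groupI)
  fix \<phi> assume p: "\<phi> \<in> carrier (free_module R B)"
  have "(\<lambda>x. \<ominus> \<phi> x) \<in> carrier (free_module R B)"
    using p by (auto simp: free_module_sel elim!: rev_finite_subset)
  then show "\<exists>y\<in>carrier (free_module R B). y \<oplus>\<^bsub>free_module R B\<^esub> \<phi> = \<zero>\<^bsub>free_module R B\<^esub>"
    using free_module_coord(1)[OF p] by (intro bexI[of _ "\<lambda>x. \<ominus> \<phi> x"]) (auto simp: free_module_sel(2,3) l_neg)
next
  fix \<phi> \<psi> assume p: "\<phi> \<in> carrier (free_module R B)" "\<psi> \<in> carrier (free_module R B)"
  have "finite {x. \<phi> x \<oplus> \<psi> x \<noteq> \<zero>}"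
    by (rule finite_subset[of _ "{x. \<phi> x \<noteq> \<zero>} \<union> {x. \<psi> x \<noteq> \<zero>}"])
       (use free_module_coord[OF p(1)] free_module_coord[OF p(2)] in auto)
  then show "\<phi> \<oplus>\<^bsub>free_module R B\<^esub> \<psi> \<in> carrier (free_module R B)"
    using p by (auto simp: free_module_sel)
next
  fix a \<phi> assume p: "a \<in> carrier R" "\<phi> \<in> carrier (free_module R B)"
  have "finite {x. a \<otimes> \<phi> x \<noteq> \<zero>}"
    by (rule finite_subset[of _ "{x. \<phi> x \<noteq> \<zero>}"])
       (use free_module_coord[OF p(2)] p in auto)
  then show "a \<odot>\<^bsub>free_module R B\<^esub> \<phi> \<in> carrier (free_module R B)"
    using p by (auto simp: free_module_sel)
next
  show "\<zero>\<^bsub>free_module R B\<^esub> \<in> carrier (free_module R B)" by (simp add: free_module_sel)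
qed (auto simp: free_module_sel(2-4) fun_eq_iff l_distr r_distr m_assoc a_ac free_module_coord(1) is_cring)

lemma basis_vector_closed: "x \<in> B \<Longrightarrow> basis_vector R x \<in> carrier (free_module R B)"
proof -
  assume "x \<in> B"
  have "finite {y. basis_vector R x y \<noteq> \<zero>}"
    by (rule finite_subset[of _ "{x}"]) (auto simp: basis_vector_def)
  with \<open>x \<in> B\<close> show ?thesis by (auto simp: free_module_sel basis_vector_def)
qed

text \<open>An element is the sum of finitely many multiples of basis vectors, so induction on the size of its
  support applies. Equality of linear maps on a free module, and containment of their images, are
  checked on the basis in this way.\<close>

lemma free_module_subset:
  assumes H: "submodule H R (free_module R B)" and bas: "\<And>x. x \<in> B \<Longrightarrow> basis_vector R x \<in> H"
  shows "carrier (free_module R B) \<subseteq> H"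
proof -
  interpret F: module R "free_module R B" by (rule free_module_module)
  have "\<phi> \<in> H" if "finite A" "\<phi> \<in> carrier (free_module R B)" "{x. \<phi> x \<noteq> \<zero>} \<subseteq> A" for A \<phi>
    using that
  proof (induct A arbitrary: \<phi>)
    case empty
    then have "\<phi> = \<zero>\<^bsub>free_module R B\<^esub>" by (auto simp: free_module_sel fun_eq_iff)
    then show ?case using F.submodule_mem[OF H] by simp
  next
    case (insert a A)
    define \<psi> where "\<psi> = \<phi>(a := \<zero>)"
    have psi: "\<psi> \<in> carrier (free_module R B)"
      using insert(4) unfolding \<psi>_def by (auto simp: free_module_sel elim!: rev_finite_subset)
    have "\<psi> \<in> H" by (rule insert(3)[OF psi]) (use insert(5) in \<open>auto simp: \<psi>_def\<close>)
    show ?case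
    proof (cases "\<phi> a = \<zero>")
      case True
      then have "\<phi> = \<psi>" by (auto simp: \<psi>_def)
      then show ?thesis using \<open>\<psi> \<in> H\<close> by simp
    next
      case False
      then have "a \<in> B" using free_module_coord[OF insert(4)] by auto
      have "\<phi> = \<phi> a \<odot>\<^bsub>free_module R B\<^esub> basis_vector R a \<oplus>\<^bsub>free_module R B\<^esub> \<psi>"
        using free_module_coord(1)[OF insert(4)]
        by (auto simp: \<psi>_def free_module_sel basis_vector_def fun_eq_iff)
      then show ?thesis
        using \<open>\<psi> \<in> H\<close> bas[OF \<open>a \<in> B\<close>] free_module_coord(1)[OF insert(4)] F.submodule_mem[OF H] by metis
    qed
  qed
  then show ?thesis using free_module_coord(2) by blast
qed

lemma linear_into_submodule:
  assumes "module R M" "linear R (free_module R B) M f" "submodule H R M"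
    "\<And>x. x \<in> B \<Longrightarrow> f (basis_vector R x) \<in> H" "\<phi> \<in> carrier (free_module R B)"
  shows "f \<phi> \<in> H"
proof -
  have "carrier (free_module R B) \<subseteq> {x \<in> carrier (free_module R B). f x \<in> H}"
    using assms by (intro free_module_subset submodule_vimage[OF free_module_module])
      (auto simp: basis_vector_closed)
  then show ?thesis using assms(5) by auto
qed

lemma linear_eq_on_basis:
  assumes M: "module R M" and f: "linear R (free_module R B) M f" and g: "linear R (free_module R B) M g"
    and eq: "\<And>x. x \<in> B \<Longrightarrow> f (basis_vector R x) = g (basis_vector R x)" and p: "\<phi> \<in> carrier (free_module R B)"
  shows "f \<phi> = g \<phi>"
proof -
  interpret M: module R M by (rule M)
  have "f \<phi> \<ominus>\<^bsub>M\<^esub> g \<phi> \<in> {\<zero>\<^bsub>M\<^esub>}"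
    using eq linear_closed[OF f basis_vector_closed] linear_closed[OF g basis_vector_closed]
    by (intro linear_into_submodule[OF M linear_diff_maps[OF M f g] submodule_zero[OF M] _ p])
       (auto simp: M.minus_eq M.r_neg)
  then show ?thesis using linear_closed[OF f p] linear_closed[OF g p] by (simp add: M.diff_zero_iff)
qed

lemma linear_extension_eq:
  assumes M: "module R M" and g: "g \<in> B \<rightarrow> carrier M" and p: "\<phi> \<in> carrier (free_module R B)"
    and A: "finite A" "{x. \<phi> x \<noteq> \<zero>} \<subseteq> A" "A \<subseteq> B"
  shows "linear_extension R B M g \<phi> = (\<Oplus>\<^bsub>M\<^esub>x \<in> A. \<phi> x \<odot>\<^bsub>M\<^esub> g x)"
proof -
  interpret M: module R M by (rule M)
  show ?thesis
    unfolding linear_extension_def using p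
    apply simp
    apply (rule M.add.finprod_mono_neutral_cong_left[OF A(1,2)])
    using g A free_module_coord(1)[OF p] by (auto simp: Pi_iff subset_iff)
qed

lemma linear_extension_linear:
  assumes M: "module R M" and g: "g \<in> B \<rightarrow> carrier M"
  shows "linear R (free_module R B) M (linear_extension R B M g)"
proof -
  interpret M: module R M by (rule M)
  interpret F: module R "free_module R B" by (rule free_module_module)
  note sup = free_module_coord(2,3)
  note eq = linear_extension_eq[OF M g]
  show ?thesis
  proof (rule linearI)
    fix \<phi> assume p: "\<phi> \<in> carrier (free_module R B)"
    show "linear_extension R B M g \<phi> \<in> carrier M"
      using p g sup[OF p] free_module_coord(1)[OF p]
      by (subst eq[OF p sup(1)[OF p]]) (auto intro!: M.finsum_closed)
  next
    fix \<phi> \<psi> assume p: "\<phi> \<in> carrier (free_module R B)" "\<psi> \<in> carrier (free_module R B)"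
    define A where "A = {x. \<phi> x \<noteq> \<zero>} \<union> {x. \<psi> x \<noteq> \<zero>}"
    have A: "finite A" "A \<subseteq> B" using sup[OF p(1)] sup[OF p(2)] by (auto simp: A_def)
    have c: "x \<in> A \<Longrightarrow> \<phi> x \<in> carrier R \<and> \<psi> x \<in> carrier R \<and> g x \<in> carrier M" for x
      using free_module_coord(1)[OF p(1)] free_module_coord(1)[OF p(2)] g A by auto
    have "linear_extension R B M g (\<phi> \<oplus>\<^bsub>free_module R B\<^esub> \<psi>) = (\<Oplus>\<^bsub>M\<^esub>x \<in> A. (\<phi> x \<oplus> \<psi> x) \<odot>\<^bsub>M\<^esub> g x)"
      using p A by (subst eq[OF _ A(1)]) (use F.a_closed[OF p] in \<open>auto simp: A_def free_module_sel(3)\<close>)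
    also have "\<dots> = (\<Oplus>\<^bsub>M\<^esub>x \<in> A. \<phi> x \<odot>\<^bsub>M\<^esub> g x \<oplus>\<^bsub>M\<^esub> \<psi> x \<odot>\<^bsub>M\<^esub> g x)"
      using c by (intro M.finsum_cong') (auto simp: M.smult_l_distr)
    also have "\<dots> = (\<Oplus>\<^bsub>M\<^esub>x \<in> A. \<phi> x \<odot>\<^bsub>M\<^esub> g x) \<oplus>\<^bsub>M\<^esub> (\<Oplus>\<^bsub>M\<^esub>x \<in> A. \<psi> x \<odot>\<^bsub>M\<^esub> g x)"
      using c by (intro M.finsum_addf) auto
    also have "\<dots> = linear_extension R B M g \<phi> \<oplus>\<^bsub>M\<^esub> linear_extension R B M g \<psi>"
      using A by (subst (1 2) eq[OF _ A(1)]) (auto simp: A_def p)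
    finally show "linear_extension R B M g (\<phi> \<oplus>\<^bsub>free_module R B\<^esub> \<psi>) =
      linear_extension R B M g \<phi> \<oplus>\<^bsub>M\<^esub> linear_extension R B M g \<psi>" .
  next
    fix a \<phi> assume a: "a \<in> carrier R" and p: "\<phi> \<in> carrier (free_module R B)"
    define A where "A = {x. \<phi> x \<noteq> \<zero>}"
    have A: "finite A" "A \<subseteq> B" using sup[OF p] by (auto simp: A_def)
    have c: "x \<in> A \<Longrightarrow> \<phi> x \<in> carrier R \<and> g x \<in> carrier M" for x
      using free_module_coord(1)[OF p] g A by auto
    have "linear_extension R B M g (a \<odot>\<^bsub>free_module R B\<^esub> \<phi>) = (\<Oplus>\<^bsub>M\<^esub>x \<in> A. (a \<otimes> \<phi> x) \<odot>\<^bsub>M\<^esub> g x)"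
      using p a A by (subst eq[OF F.smult_closed[OF a p] A(1)]) (auto simp: A_def free_module_sel(4))
    also have "\<dots> = (\<Oplus>\<^bsub>M\<^esub>x \<in> A. a \<odot>\<^bsub>M\<^esub> (\<phi> x \<odot>\<^bsub>M\<^esub> g x))"
      using c a by (intro M.finsum_cong') (auto simp: M.smult_assoc1)
    also have "\<dots> = a \<odot>\<^bsub>M\<^esub> (\<Oplus>\<^bsub>M\<^esub>x \<in> A. \<phi> x \<odot>\<^bsub>M\<^esub> g x)"
      using c by (intro M.finsum_smult_ldistr[symmetric]) (auto simp: A a)
    also have "\<dots> = a \<odot>\<^bsub>M\<^esub> linear_extension R B M g \<phi>"
      using A by (subst eq[OF p A(1)]) (auto simp: A_def)
    finally show "linear_extension R B M g (a \<odot>\<^bsub>free_module R B\<^esub> \<phi>) = a \<odot>\<^bsub>M\<^esub> linear_extension R B M g \<phi>" .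
  qed
qed

lemma linear_extension_basis:
  assumes M: "module R M" and g: "g \<in> B \<rightarrow> carrier M" and x: "x \<in> B"
  shows "linear_extension R B M g (basis_vector R x) = g x"
proof -
  interpret M: module R M by (rule M)
  have "linear_extension R B M g (basis_vector R x) = (\<Oplus>\<^bsub>M\<^esub>y \<in> {x}. basis_vector R x y \<odot>\<^bsub>M\<^esub> g y)"
    using x by (intro linear_extension_eq[OF M g basis_vector_closed[OF x]]) (auto simp: basis_vector_def)
  also have "\<dots> = g x" using x g by (auto simp: basis_vector_def Pi_iff)
  finally show ?thesis .
qed

end

section \<open>Extending maps from the first syzygy\<close>

definition presentation :: "('a, 'r) ring_scheme \<Rightarrow> ('a, 'b) module \<Rightarrow> ('b \<Rightarrow> 'a) \<Rightarrow> 'b"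
  where "presentation R M = linear_extension R (carrier M) M (\<lambda>x. x)"

lemma presentation_props:
  assumes M: "module R M"
  shows "module R (res0 R M)" "linear R (res0 R M) M (presentation R M)"
    "\<And>x. x \<in> carrier M \<Longrightarrow> basis_vector R x \<in> carrier (res0 R M)"
    "\<And>x. x \<in> carrier M \<Longrightarrow> presentation R M (basis_vector R x) = x"
    "submodule (syzygy1 R M) R (res0 R M)"
    "\<And>k. k \<in> syzygy1 R M \<longleftrightarrow> k \<in> carrier (res0 R M) \<and> presentation R M k = \<zero>\<^bsub>M\<^esub>"
proof -
  interpret M: module R M by (rule M)
  show P: "module R (res0 R M)" unfolding res0_def by (rule M.free_module_module)
  show l: "linear R (res0 R M) M (presentation R M)"
    unfolding presentation_def res0_def by (rule M.linear_extension_linear[OF M]) auto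
  show "\<And>x. x \<in> carrier M \<Longrightarrow> basis_vector R x \<in> carrier (res0 R M)"
    unfolding res0_def by (rule M.basis_vector_closed)
  show "\<And>x. x \<in> carrier M \<Longrightarrow> presentation R M (basis_vector R x) = x"
    unfolding presentation_def by (rule M.linear_extension_basis[OF M]) auto
  show k: "k \<in> syzygy1 R M \<longleftrightarrow> k \<in> carrier (res0 R M) \<and> presentation R M k = \<zero>\<^bsub>M\<^esub>" for k
    by (simp add: syzygy1_def module_kernel_def presentation_def)
  show "submodule (syzygy1 R M) R (res0 R M)"
    using submodule_vimage[OF P M l submodule_zero[OF M]] k
    by (metis (no_types, lifting) Collect_cong Collect_mem_eq singleton_iff)
qed

text \<open>A 1-cocycle vanishes on the second syzygy, so it factors through the differential onto the first
  syzygy \<open>K\<close>; thus cocycles are the linear maps on \<open>K\<close>. The coboundaries are those that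
  extend to the free module \<open>res0\<close>.\<close>

lemma Ext1_zero_iff:
  fixes R :: "('a, 'r) ring_scheme" and M :: "('a, 'b) module" and N :: "('a, 'c) module"
  assumes M: "module R M" and N: "module R N"
  shows "zero_module (Ext1 R M N) \<longleftrightarrow>
    (\<forall>f. linear R ((res0 R M)\<lparr>carrier := syzygy1 R M\<rparr>) N f \<longrightarrow>
      (\<exists>g. linear R (res0 R M) N g \<and> (\<forall>k \<in> syzygy1 R M. g k = f k)))"
proof -
  interpret M: module R M by (rule M)
  interpret N: module R N by (rule N)
  note pres = presentation_props[OF M]
  note K = pres(5)
  interpret P0: module R "res0 R M" by (rule pres(1))
  interpret P1: module R "res1 R M" unfolding res1_def by (rule M.free_module_module)
  interpret P2: module R "res2 R M" unfolding res2_def by (rule M.free_module_module)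
  note K_mem = P0.submodule_mem[OF K]
  have d1: "linear R (res1 R M) (res0 R M) (diff1 R M)"
    unfolding diff1_def res1_def using K_mem(1)
    by (intro M.linear_extension_linear[OF P0.module_axioms]) auto
  have d1_basis: "diff1 R M (basis_vector R k) = k" if "k \<in> syzygy1 R M" for k
    unfolding diff1_def using K_mem(1) that
    by (intro M.linear_extension_basis[OF P0.module_axioms]) auto
  have basis1: "basis_vector R k \<in> carrier (res1 R M)" if "k \<in> syzygy1 R M" for k
    using M.basis_vector_closed that by (simp add: res1_def)
  have d1_K: "diff1 R M \<phi> \<in> syzygy1 R M" if "\<phi> \<in> carrier (res1 R M)" for \<phi>
    using M.linear_into_submodule[OF P0.module_axioms d1[unfolded res1_def] K] d1_basis that
    by (simp add: res1_def)
  have K2: "submodule (syzygy2 R M) R (res1 R M)"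
    using submodule_vimage[OF P1.module_axioms P0.module_axioms d1 submodule_zero[OF P0.module_axioms]]
    by (simp add: syzygy2_def module_kernel_def)
  note K2_mem = P1.submodule_mem[OF K2]
  have d2: "linear R (res2 R M) (res1 R M) (diff2 R M)"
    unfolding diff2_def res2_def using K2_mem(1)
    by (intro M.linear_extension_linear[OF P1.module_axioms]) auto
  have d2_basis: "diff2 R M (basis_vector R k) = k" if "k \<in> syzygy2 R M" for k
    unfolding diff2_def using K2_mem(1) that
    by (intro M.linear_extension_basis[OF P1.module_axioms]) auto
  have basis2: "basis_vector R k \<in> carrier (res2 R M)" if "k \<in> syzygy2 R M" for k
    using M.basis_vector_closed that by (simp add: res2_def)
  have d2_K2: "diff2 R M \<phi> \<in> syzygy2 R M" if "\<phi> \<in> carrier (res2 R M)" for \<phi>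
    using M.linear_into_submodule[OF P1.module_axioms d2[unfolded res2_def] K2] d2_basis that
    by (simp add: res2_def)
  define \<delta> where "\<delta> = (\<lambda>g. compose (carrier (res1 R M)) g (diff1 R M) :: (('b \<Rightarrow> 'a) \<Rightarrow> 'a) \<Rightarrow> 'c)"
  have cob: "c \<in> Ext1_coboundaries R M N \<longleftrightarrow> (\<exists>g. linear R (res0 R M) N g \<and> c = \<delta> g)" for c
  proof
    assume "c \<in> Ext1_coboundaries R M N"
    then show "\<exists>g. linear R (res0 R M) N g \<and> c = \<delta> g"
      by (auto simp: Ext1_coboundaries_def Hom_def mod_hom_iff \<delta>_def)
  next
    assume "\<exists>g. linear R (res0 R M) N g \<and> c = \<delta> g"
    then obtain g where g: "linear R (res0 R M) N g" "c = \<delta> g" by blast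
    have "restrict g (carrier (res0 R M)) \<in> carrier (Hom R (res0 R M) N)"
      using g(1) by (auto simp: Hom_def mod_hom_iff linear_def)
    moreover have "c = \<delta> (restrict g (carrier (res0 R M)))"
      using linear_closed[OF d1] by (auto simp: g(2) \<delta>_def compose_def fun_eq_iff)
    ultimately show "c \<in> Ext1_coboundaries R M N"
      unfolding Ext1_coboundaries_def \<delta>_def by blast
  qed
  have coc: "c \<in> Ext1_cocycles R M N \<longleftrightarrow>
      linear R (res1 R M) N c \<and> c \<in> extensional (carrier (res1 R M)) \<and> (\<forall>x \<in> syzygy2 R M. c x = \<zero>\<^bsub>N\<^esub>)" for c
  proof -
    have "compose (carrier (res2 R M)) c (diff2 R M) = (\<lambda>x\<in>carrier (res2 R M). \<zero>\<^bsub>N\<^esub>) \<longleftrightarrow>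
        (\<forall>x \<in> carrier (res2 R M). c (diff2 R M x) = \<zero>\<^bsub>N\<^esub>)"
      by (auto simp: compose_def fun_eq_iff)
    also have "\<dots> \<longleftrightarrow> (\<forall>x \<in> syzygy2 R M. c x = \<zero>\<^bsub>N\<^esub>)"
      using d2_K2 d2_basis basis2 by metis
    finally show ?thesis
      by (auto simp: Ext1_cocycles_def module_kernel_def Hom_def mod_hom_iff)
  qed
  have delta_lin: "linear R (res1 R M) N (\<delta> g)" if g: "linear R (res0 R M) N g" for g
    unfolding \<delta>_def compose_def using linear_comp[OF d1 g] by (auto simp: linear_def)
  have delta_coc: "\<delta> g \<in> Ext1_cocycles R M N" if g: "linear R (res0 R M) N g" for g
  proof -
    have "\<delta> g x = \<zero>\<^bsub>N\<^esub>" if "x \<in> syzygy2 R M" for x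
      using that linear_zero[OF P0.module_axioms N g]
      by (simp add: \<delta>_def compose_def syzygy2_def module_kernel_def)
    moreover have "\<delta> g \<in> extensional (carrier (res1 R M))" by (simp add: \<delta>_def)
    ultimately show ?thesis unfolding coc using delta_lin[OF g] by blast
  qed
  let ?A = "\<lambda>c c'. \<lambda>x\<in>carrier (res1 R M). c x \<oplus>\<^bsub>N\<^esub> c' x"
  have coset: "carrier (Ext1 R M N) = (\<Union>c \<in> Ext1_cocycles R M N. {(\<lambda>b. ?A b c) ` Ext1_coboundaries R M N})"
    unfolding Ext1_def quotient_module_def A_RCOSETS_def' a_r_coset_def' Hom_def by (simp add: UNION_singleton_eq_range)
  have zero: "zero_module (Ext1 R M N) \<longleftrightarrow>
      carrier (Ext1 R M N) = {Ext1_coboundaries R M N}"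
    by (simp add: zero_module_def Ext1_def quotient_module_def)
  have A0: "?A (\<delta> (\<lambda>x. \<zero>\<^bsub>N\<^esub>)) c = c" if "c \<in> Ext1_cocycles R M N" for c
  proof -
    have "linear R (res1 R M) N c" "c \<in> extensional (carrier (res1 R M))" using that by (auto simp: coc)
    then show ?thesis
      using linear_closed[OF d1] linear_closed by (fastforce simp: \<delta>_def compose_def fun_eq_iff extensional_def)
  qed
  have lin0: "linear R (res0 R M) N (\<lambda>x. \<zero>\<^bsub>N\<^esub>)"
    by (rule linearI) auto
  have zero': "zero_module (Ext1 R M N) \<longleftrightarrow> Ext1_cocycles R M N \<subseteq> Ext1_coboundaries R M N"
  proof
    assume z: "zero_module (Ext1 R M N)"
    show "Ext1_cocycles R M N \<subseteq> Ext1_coboundaries R M N"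
    proof
      fix c assume c: "c \<in> Ext1_cocycles R M N"
      have "(\<lambda>b. ?A b c) ` Ext1_coboundaries R M N \<in> carrier (Ext1 R M N)"
        unfolding coset by (rule UN_I[OF c]) (rule singletonI)
      then have "(\<lambda>b. ?A b c) ` Ext1_coboundaries R M N = Ext1_coboundaries R M N"
        using z unfolding zero by (simp only: singleton_iff)
      moreover have "c \<in> (\<lambda>b. ?A b c) ` Ext1_coboundaries R M N"
        using A0[OF c] lin0 unfolding cob by (intro image_eqI[of _ _ "\<delta> (\<lambda>x. \<zero>\<^bsub>N\<^esub>)"]) (simp, simp add: cob, blast)
      ultimately show "c \<in> Ext1_coboundaries R M N" by (simp only:)
    qed
  next
    assume s: "Ext1_cocycles R M N \<subseteq> Ext1_coboundaries R M N"
    have "(\<lambda>b. ?A b c) ` Ext1_coboundaries R M N = Ext1_coboundaries R M N"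
      if "c \<in> Ext1_cocycles R M N" for c
    proof -
      obtain h where h: "linear R (res0 R M) N h" "c = \<delta> h" using s \<open>c \<in> _\<close> cob by blast
      have add: "?A (\<delta> g) c = \<delta> (\<lambda>x. g x \<oplus>\<^bsub>N\<^esub> h x)" for g
        by (auto simp: h(2) \<delta>_def compose_def fun_eq_iff)
      show ?thesis
      proof (intro equalityI subsetI)
        fix x assume "x \<in> (\<lambda>b. ?A b c) ` Ext1_coboundaries R M N"
        then obtain b where b: "x = ?A b c" "b \<in> Ext1_coboundaries R M N" by (rule imageE)
        from b(2) obtain g where g: "linear R (res0 R M) N g" "b = \<delta> g" unfolding cob by (elim exE conjE)
        show "x \<in> Ext1_coboundaries R M N"
          unfolding cob b(1) g(2) add
          by (intro exI conjI) (rule linear_add_maps[OF N g(1) h(1)], rule refl)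
      next
        fix x assume "x \<in> Ext1_coboundaries R M N"
        then obtain g where g: "linear R (res0 R M) N g" "x = \<delta> g" unfolding cob by (elim exE conjE)
        have e: "(g y \<ominus>\<^bsub>N\<^esub> h y) \<oplus>\<^bsub>N\<^esub> h y = g y" if "y \<in> carrier (res0 R M)" for y
          using linear_closed[OF g(1) that] linear_closed[OF h(1) that] by algebra
        have "x = ?A (\<delta> (\<lambda>x. g x \<ominus>\<^bsub>N\<^esub> h x)) c"
          unfolding add g(2) using e linear_closed[OF d1] by (auto simp: \<delta>_def compose_def fun_eq_iff)
        moreover have "\<delta> (\<lambda>x. g x \<ominus>\<^bsub>N\<^esub> h x) \<in> Ext1_coboundaries R M N"
          unfolding cob
          by (intro exI conjI) (rule linear_diff_maps[OF N g(1) h(1)], rule refl)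
        ultimately show "x \<in> (\<lambda>b. ?A b c) ` Ext1_coboundaries R M N" by (rule image_eqI)
      qed
    qed
    moreover have "\<delta> (\<lambda>x. \<zero>\<^bsub>N\<^esub>) \<in> Ext1_cocycles R M N" by (rule delta_coc[OF lin0])
    ultimately show "zero_module (Ext1 R M N)" unfolding zero coset by force
  qed
  let ?K = "(res0 R M)\<lparr>carrier := syzygy1 R M\<rparr>"
  show ?thesis unfolding zero'
  proof (intro iffI allI impI)
    fix f assume s: "Ext1_cocycles R M N \<subseteq> Ext1_coboundaries R M N" and f: "linear R ?K N f"
    have d1': "linear R (res1 R M) ?K (diff1 R M)"
      using d1 d1_K by (auto simp: linear_def)
    have "(\<lambda>x \<in> carrier (res1 R M). f (diff1 R M x)) \<in> Ext1_cocycles R M N"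
      unfolding coc using linear_comp[OF d1' f]
        linear_zero[OF submodule.submodule_is_module[OF K P0.module_axioms] N f]
      by (simp add: linear_def syzygy2_def module_kernel_def Pi_iff)
    then obtain g where g: "linear R (res0 R M) N g" "(\<lambda>x \<in> carrier (res1 R M). f (diff1 R M x)) = \<delta> g"
      using s cob by blast
    have "g k = f k" if k: "k \<in> syzygy1 R M" for k
      using fun_cong[OF g(2), of "basis_vector R k"] basis1[OF k] by (simp add: \<delta>_def compose_def d1_basis[OF k])
    then show "\<exists>g. linear R (res0 R M) N g \<and> (\<forall>k \<in> syzygy1 R M. g k = f k)" using g(1) by blast
  next
    assume ext: "\<forall>f. linear R ?K N f \<longrightarrow> (\<exists>g. linear R (res0 R M) N g \<and> (\<forall>k \<in> syzygy1 R M. g k = f k))"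
    show "Ext1_cocycles R M N \<subseteq> Ext1_coboundaries R M N"
    proof
      fix c assume "c \<in> Ext1_cocycles R M N"
      then have c: "linear R (res1 R M) N c" "c \<in> extensional (carrier (res1 R M))"
        "\<And>x. x \<in> syzygy2 R M \<Longrightarrow> c x = \<zero>\<^bsub>N\<^esub>" unfolding coc by auto
      have c_eq: "c x = c y" if "x \<in> carrier (res1 R M)" "y \<in> carrier (res1 R M)" "diff1 R M x = diff1 R M y" for x y
      proof -
        have "x \<ominus>\<^bsub>res1 R M\<^esub> y \<in> syzygy2 R M"
          using that linear_diff[OF P1.module_axioms P0.module_axioms d1 that(1,2)] linear_closed[OF d1]
          by (auto simp: syzygy2_def module_kernel_def P0.diff_zero_iff)
        from c(3)[OF this] have "c x \<ominus>\<^bsub>N\<^esub> c y = \<zero>\<^bsub>N\<^esub>"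
          using linear_diff[OF P1.module_axioms N c(1) that(1,2)] by simp
        then show ?thesis
          using linear_closed[OF c(1)] that(1,2) by (simp add: N.diff_zero_iff)
      qed
      have "linear R ?K N (\<lambda>k. c (basis_vector R k))"
      proof (rule linearI)
        fix x y assume "x \<in> carrier ?K" "y \<in> carrier ?K"
        then have xy: "x \<in> syzygy1 R M" "y \<in> syzygy1 R M" by auto
        have "c (basis_vector R (x \<oplus>\<^bsub>res0 R M\<^esub> y)) = c (basis_vector R x \<oplus>\<^bsub>res1 R M\<^esub> basis_vector R y)"
          using xy basis1 K_mem by (intro c_eq) (auto simp: linear_add[OF d1] d1_basis)
        then show "c (basis_vector R (x \<oplus>\<^bsub>?K\<^esub> y)) = c (basis_vector R x) \<oplus>\<^bsub>N\<^esub> c (basis_vector R y)"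
          using linear_add[OF c(1)] basis1 xy by simp
      next
        fix a x assume "a \<in> carrier R" "x \<in> carrier ?K"
        then have xy: "x \<in> syzygy1 R M" "a \<in> carrier R" by auto
        have "c (basis_vector R (a \<odot>\<^bsub>res0 R M\<^esub> x)) = c (a \<odot>\<^bsub>res1 R M\<^esub> basis_vector R x)"
          using xy basis1 K_mem by (intro c_eq) (auto simp: linear_smult[OF d1] d1_basis)
        then show "c (basis_vector R (a \<odot>\<^bsub>?K\<^esub> x)) = a \<odot>\<^bsub>N\<^esub> c (basis_vector R x)"
          using linear_smult[OF c(1)] basis1 xy by simp
      qed (use linear_closed[OF c(1)] basis1 in auto)
      then obtain g where g: "linear R (res0 R M) N g" "\<And>k. k \<in> syzygy1 R M \<Longrightarrow> g k = c (basis_vector R k)"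
        using ext by blast
      have "c x = \<delta> g x" for x
      proof (cases "x \<in> carrier (res1 R M)")
        case True
        have "c x = c (basis_vector R (diff1 R M x))"
          using True d1_K basis1 by (intro c_eq) (auto simp: d1_basis)
        then show ?thesis using True g(2)[OF d1_K[OF True]] by (simp add: \<delta>_def compose_def)
      next
        case False
        then show ?thesis using c(2) by (auto simp: \<delta>_def compose_def extensional_def)
      qed
      then show "c \<in> Ext1_coboundaries R M N" unfolding cob using g(1) by blast
    qed
  qed
qed

section \<open>Flatness: endomorphisms of the free module fixing finitely many syzygies\<close>

lemma submodule_generated_props:
  assumes M: "module R M" and "B \<subseteq> carrier M"
  shows "submodule (submodule_generated R M B) R M" "B \<subseteq> submodule_generated R M B"
proof -
  interpret module R M by (rule M)
  show "B \<subseteq> submodule_generated R M B" by (auto simp: submodule_generated_def)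
  have "carrier M \<in> {H. submodule H R M \<and> B \<subseteq> H}" using carrier_is_submodule assms by simp
  then have "submodule_generated R M B \<subseteq> carrier M" unfolding submodule_generated_def by blast
  then show "submodule (submodule_generated R M B) R M"
    by (rule submodule_of_scalar_closed) (auto simp: submodule_generated_def submodule_mem)
qed

lemma linear_finsum:
  assumes M: "module R M" and N: "module R N" and f: "\<And>i. i \<in> A \<Longrightarrow> linear R N M (f i)"
  shows "linear R N M (\<lambda>x. \<Oplus>\<^bsub>M\<^esub>i \<in> A. f i x)"
proof -
  interpret M: module R M by (rule M)
  show ?thesis using f
  proof (induct A rule: infinite_finite_induct)
    case (insert a A)
    have "linear R N M (\<lambda>x. f a x \<oplus>\<^bsub>M\<^esub> (\<Oplus>\<^bsub>M\<^esub>i \<in> A. f i x))"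
      using insert by (intro linear_add_maps[OF M]) auto
    moreover have "(\<Oplus>\<^bsub>M\<^esub>i \<in> insert a A. f i x) = f a x \<oplus>\<^bsub>M\<^esub> (\<Oplus>\<^bsub>M\<^esub>i \<in> A. f i x)" if "x \<in> carrier N" for x
      using insert linear_closed[OF insert(4) that] by (intro M.finsum_insert) auto
    ultimately show ?case using module.axioms(1)[OF N]
      by (auto simp: linear_def abelian_monoid.a_closed abelian_group.axioms(1) module.axioms(2)[OF N] module.smult_closed[OF N])
  qed (auto simp: M.finsum_infinite linear_def)
qed

text \<open>The universal property of the tensor product, relative to a submodule: the preimage of \<open>H\<close> is a
  submodule, so it suffices that it contains the generating relations.\<close>

lemma tensor_relations_into:
  fixes R :: "('a, 'r) ring_scheme" and M :: "('a, 'b) module" and N :: "('a, 'c) module"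
  defines "P \<equiv> free_module R (carrier M \<times> carrier N)"
  assumes M: "module R M" and N: "module R N" and Q: "module R Q" and f: "linear R P Q f" and H: "submodule H R Q"
    and b: "\<And>x x' y. x \<in> carrier M \<Longrightarrow> x' \<in> carrier M \<Longrightarrow> y \<in> carrier N \<Longrightarrow>
        f (basis_vector R (x \<oplus>\<^bsub>M\<^esub> x', y)) \<ominus>\<^bsub>Q\<^esub> (f (basis_vector R (x, y)) \<oplus>\<^bsub>Q\<^esub> f (basis_vector R (x', y))) \<in> H"
      "\<And>x y y'. x \<in> carrier M \<Longrightarrow> y \<in> carrier N \<Longrightarrow> y' \<in> carrier N \<Longrightarrow>
        f (basis_vector R (x, y \<oplus>\<^bsub>N\<^esub> y')) \<ominus>\<^bsub>Q\<^esub> (f (basis_vector R (x, y)) \<oplus>\<^bsub>Q\<^esub> f (basis_vector R (x, y'))) \<in> H"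
      "\<And>a x y. a \<in> carrier R \<Longrightarrow> x \<in> carrier M \<Longrightarrow> y \<in> carrier N \<Longrightarrow>
        f (basis_vector R (a \<odot>\<^bsub>M\<^esub> x, y)) \<ominus>\<^bsub>Q\<^esub> a \<odot>\<^bsub>Q\<^esub> f (basis_vector R (x, y)) \<in> H"
      "\<And>a x y. a \<in> carrier R \<Longrightarrow> x \<in> carrier M \<Longrightarrow> y \<in> carrier N \<Longrightarrow>
        f (basis_vector R (x, a \<odot>\<^bsub>N\<^esub> y)) \<ominus>\<^bsub>Q\<^esub> a \<odot>\<^bsub>Q\<^esub> f (basis_vector R (x, y)) \<in> H"
    and r: "\<rho> \<in> tensor_relations R M N"
  shows "f \<rho> \<in> H"
proof -
  interpret M: module R M by (rule M)
  interpret N: module R N by (rule N)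
  interpret Q: module R Q by (rule Q)
  interpret P: module R P unfolding P_def by (rule M.free_module_module)
  have e: "basis_vector R (x, y) \<in> carrier P" if "x \<in> carrier M" "y \<in> carrier N" for x y
    using that by (auto simp: P_def M.basis_vector_closed)
  have "submodule {\<phi> \<in> carrier P. f \<phi> \<in> H} R P"
    by (rule submodule_vimage[OF P.module_axioms Q f H])
  moreover have "tensor_relations R M N \<subseteq> U" if "submodule U R P" "\<And>\<phi>. \<phi> \<in> carrier P \<Longrightarrow> f \<phi> \<in> H \<Longrightarrow> \<phi> \<in> U" for U
    unfolding tensor_relations_def Let_def submodule_generated_def P_def[symmetric]
    by (rule Inter_lower)
       (auto intro!: that simp: e linear_diff[OF P.module_axioms Q f] linear_add[OF f] linear_smult[OF f] b)
  ultimately show ?thesis using r by fastforce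
qed

lemma tensor_relations_submodule:
  fixes R :: "('a, 'r) ring_scheme" and M :: "('a, 'b) module" and N :: "('a, 'c) module"
  defines "P \<equiv> free_module R (carrier M \<times> carrier N)"
  assumes M: "module R M" and N: "module R N"
  shows "submodule (tensor_relations R M N) R P"
    "\<And>x y y'. x \<in> carrier M \<Longrightarrow> y \<in> carrier N \<Longrightarrow> y' \<in> carrier N \<Longrightarrow>
        basis_vector R (x, y \<oplus>\<^bsub>N\<^esub> y') \<ominus>\<^bsub>P\<^esub> (basis_vector R (x, y) \<oplus>\<^bsub>P\<^esub> basis_vector R (x, y')) \<in> tensor_relations R M N"
    "\<And>x x' y. x \<in> carrier M \<Longrightarrow> x' \<in> carrier M \<Longrightarrow> y \<in> carrier N \<Longrightarrow>
        basis_vector R (x \<oplus>\<^bsub>M\<^esub> x', y) \<ominus>\<^bsub>P\<^esub> (basis_vector R (x, y) \<oplus>\<^bsub>P\<^esub> basis_vector R (x', y)) \<in> tensor_relations R M N"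
    "\<And>a x y. a \<in> carrier R \<Longrightarrow> x \<in> carrier M \<Longrightarrow> y \<in> carrier N \<Longrightarrow>
        basis_vector R (a \<odot>\<^bsub>M\<^esub> x, y) \<ominus>\<^bsub>P\<^esub> a \<odot>\<^bsub>P\<^esub> basis_vector R (x, y) \<in> tensor_relations R M N"
    "\<And>a x y. a \<in> carrier R \<Longrightarrow> x \<in> carrier M \<Longrightarrow> y \<in> carrier N \<Longrightarrow>
        basis_vector R (x, a \<odot>\<^bsub>N\<^esub> y) \<ominus>\<^bsub>P\<^esub> a \<odot>\<^bsub>P\<^esub> basis_vector R (x, y) \<in> tensor_relations R M N"
proof -
  interpret M: module R M by (rule M)
  interpret N: module R N by (rule N)
  interpret P: module R P unfolding P_def by (rule M.free_module_module)
  have e: "basis_vector R (x, y) \<in> carrier P" if "x \<in> carrier M" "y \<in> carrier N" for x y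
    using that by (auto simp: P_def M.basis_vector_closed)
  note gen = submodule_generated_props[OF P.module_axioms]
  note unf = tensor_relations_def Let_def P_def[symmetric]
  show "submodule (tensor_relations R M N) R P"
    unfolding unf by (rule gen(1)) (auto simp: e)
  show "basis_vector R (x, y \<oplus>\<^bsub>N\<^esub> y') \<ominus>\<^bsub>P\<^esub> (basis_vector R (x, y) \<oplus>\<^bsub>P\<^esub> basis_vector R (x, y')) \<in> tensor_relations R M N"
    if "x \<in> carrier M" "y \<in> carrier N" "y' \<in> carrier N" for x y y'
    unfolding unf by (rule subsetD[OF gen(2)], force simp: e, use that in blast)
  show "basis_vector R (x \<oplus>\<^bsub>M\<^esub> x', y) \<ominus>\<^bsub>P\<^esub> (basis_vector R (x, y) \<oplus>\<^bsub>P\<^esub> basis_vector R (x', y)) \<in> tensor_relations R M N"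
    if "x \<in> carrier M" "x' \<in> carrier M" "y \<in> carrier N" for x x' y
    unfolding unf by (rule subsetD[OF gen(2)], force simp: e, use that in blast)
  show "basis_vector R (a \<odot>\<^bsub>M\<^esub> x, y) \<ominus>\<^bsub>P\<^esub> a \<odot>\<^bsub>P\<^esub> basis_vector R (x, y) \<in> tensor_relations R M N"
    if "a \<in> carrier R" "x \<in> carrier M" "y \<in> carrier N" for a x y
    unfolding unf by (rule subsetD[OF gen(2)], force simp: e, use that in blast)
  show "basis_vector R (x, a \<odot>\<^bsub>N\<^esub> y) \<ominus>\<^bsub>P\<^esub> a \<odot>\<^bsub>P\<^esub> basis_vector R (x, y) \<in> tensor_relations R M N"
    if "a \<in> carrier R" "x \<in> carrier M" "y \<in> carrier N" for a x y
    unfolding unf by (rule subsetD[OF gen(2)], force simp: e, use that in blast)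
qed

lemma (in module) coset_of_submodule:
  assumes H: "submodule H R M"
  shows "z \<in> H \<Longrightarrow> H +>\<^bsub>M\<^esub> z = H" "z \<in> carrier M \<Longrightarrow> z \<in> H +>\<^bsub>M\<^esub> z"
proof -
  note mem = submodule_mem[OF H]
  show "H +>\<^bsub>M\<^esub> z = H" if z: "z \<in> H"
  proof -
    have "x \<in> (\<Union>h\<in>H. {h \<oplus>\<^bsub>M\<^esub> z})" if "x \<in> H" for x
    proof
      show "x \<ominus>\<^bsub>M\<^esub> z \<in> H" by (rule mem(5)[OF that z])
      show "x \<in> {x \<ominus>\<^bsub>M\<^esub> z \<oplus>\<^bsub>M\<^esub> z}" using mem(1)[OF that] mem(1)[OF z] by (intro singletonI[THEN back_subst[of "\<lambda>y. x \<in> {y}"]]) algebra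
    qed
    moreover have "(\<Union>h\<in>H. {h \<oplus>\<^bsub>M\<^esub> z}) \<subseteq> H" using mem(3) z by auto
    ultimately show ?thesis unfolding a_r_coset_def' by auto
  qed
  show "z \<in> H +>\<^bsub>M\<^esub> z" if "z \<in> carrier M"
    unfolding a_r_coset_def' using mem(2) that by (intro UN_I[of "\<zero>\<^bsub>M\<^esub>"]) auto
qed

lemma linear_map_finsum:
  assumes M: "module R M" and N: "module R N" and f: "linear R M N f" and v: "v \<in> A \<rightarrow> carrier M"
  shows "f (\<Oplus>\<^bsub>M\<^esub>i \<in> A. v i) = (\<Oplus>\<^bsub>N\<^esub>i \<in> A. f (v i))"
proof -
  interpret M: module R M by (rule M)
  interpret N: module R N by (rule N)
  show ?thesis using v
  proof (induct A rule: infinite_finite_induct)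
    case (insert a A)
    then have c: "v a \<in> carrier M" "v \<in> A \<rightarrow> carrier M" "(\<lambda>i. f (v i)) \<in> A \<rightarrow> carrier N" "f (v a) \<in> carrier N"
      using linear_closed[OF f] by auto
    then have "f (v a \<oplus>\<^bsub>M\<^esub> (\<Oplus>\<^bsub>M\<^esub>i \<in> A. v i)) = f (v a) \<oplus>\<^bsub>N\<^esub> (\<Oplus>\<^bsub>N\<^esub>i \<in> A. f (v i))"
      using insert(3) by (subst linear_add[OF f]) auto
    with c insert show ?case by simp
  qed (auto simp: linear_zero[OF M N f] M.finsum_infinite N.finsum_infinite)
qed

text \<open>
  The equational criterion for flatness, for one equation: a relation between elements of \<open>F\<close> is induced
  by relations in the ring, so it lifts to the free module \<open>P = res0 R F\<close>. The relation is a linear form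
  on \<open>R\<^sup>r\<close> with kernel \<open>L\<close>, and the given solution is an element of \<open>R\<^sup>r \<otimes> F\<close> which this form
  annihilates. By flatness it comes from \<open>L \<otimes> F\<close>, that is, it is a combination of solutions in the ring
  with coefficients in \<open>F\<close>. Replacing these coefficients by the corresponding basis vectors gives the lift.
\<close>

lemma flat_equational:
  fixes R :: "('a, 'r) ring_scheme" and F :: "('a, 'f) module" and r :: nat
  assumes flat: "flat_module R F" and a: "a \<in> {..<r} \<rightarrow> carrier R" and x: "x \<in> {..<r} \<rightarrow> carrier F"
    and rel: "(\<Oplus>\<^bsub>F\<^esub>l\<in>{..<r}. a l \<odot>\<^bsub>F\<^esub> x l) = \<zero>\<^bsub>F\<^esub>"
  shows "\<exists>w. w \<in> {..<r} \<rightarrow> carrier (res0 R F) \<and> (\<forall>l<r. presentation R F (w l) = x l) \<and>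
    (\<Oplus>\<^bsub>res0 R F\<^esub>l\<in>{..<r}. a l \<odot>\<^bsub>res0 R F\<^esub> w l) = \<zero>\<^bsub>res0 R F\<^esub>"
proof -
  have F: "module R F" using flat by (simp add: flat_module_def)
  interpret F: module R F by (rule F)
  note pres = presentation_props[OF F]
  interpret P: module R "res0 R F" by (rule pres)
  define M where "M = (free_module R {..<r} :: ('a, nat \<Rightarrow> 'a) module)"
  define N where "N = (free_module R {0} :: ('a, nat \<Rightarrow> 'a) module)"
  interpret M: module R M unfolding M_def by (rule F.free_module_module)
  interpret N: module R N unfolding N_def by (rule F.free_module_module)
  define u where "u = (basis_vector R (0::nat))"
  have u: "u \<in> carrier N" unfolding u_def N_def by (rule F.basis_vector_closed) simp
  \<comment> \<open>The linear form, which becomes a map from \<open>M\<close> to the free module \<open>N\<close> of rank one with basis \<open>u\<close>.\<close>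
  define \<chi> where "\<chi> c = (\<Oplus>\<^bsub>R\<^esub>l\<in>{..<r}. c l \<otimes>\<^bsub>R\<^esub> a l)" for c
  have Mc: "c l \<in> carrier R" if "c \<in> carrier M" for c l
    using that unfolding M_def by (rule F.free_module_coord)
  have chi_closed: "\<chi> c \<in> carrier R" if "c \<in> carrier M" for c
    unfolding \<chi>_def using Mc[OF that] a by (intro F.R.finsum_closed) auto
  have chi_add: "\<chi> (c \<oplus>\<^bsub>M\<^esub> d) = \<chi> c \<oplus>\<^bsub>R\<^esub> \<chi> d" if "c \<in> carrier M" "d \<in> carrier M" for c d
  proof -
    have "\<chi> (c \<oplus>\<^bsub>M\<^esub> d) = (\<Oplus>\<^bsub>R\<^esub>l\<in>{..<r}. c l \<otimes>\<^bsub>R\<^esub> a l \<oplus>\<^bsub>R\<^esub> d l \<otimes>\<^bsub>R\<^esub> a l)"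
      unfolding \<chi>_def using Mc[OF that(1)] Mc[OF that(2)] a
      by (intro F.R.finsum_cong') (auto simp: M_def free_module_sel(3) F.l_distr Pi_iff)
    also have "\<dots> = \<chi> c \<oplus>\<^bsub>R\<^esub> \<chi> d"
      unfolding \<chi>_def using Mc[OF that(1)] Mc[OF that(2)] a by (intro F.R.finsum_addf) auto
    finally show ?thesis .
  qed
  have chi_smult: "\<chi> (b \<odot>\<^bsub>M\<^esub> c) = b \<otimes>\<^bsub>R\<^esub> \<chi> c" if "b \<in> carrier R" "c \<in> carrier M" for b c
  proof -
    have "\<chi> (b \<odot>\<^bsub>M\<^esub> c) = (\<Oplus>\<^bsub>R\<^esub>l\<in>{..<r}. b \<otimes>\<^bsub>R\<^esub> (c l \<otimes>\<^bsub>R\<^esub> a l))"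
      unfolding \<chi>_def using Mc[OF that(2)] that(1) a
      by (intro F.R.finsum_cong') (auto simp: M_def free_module_sel(4) F.m_assoc Pi_iff)
    also have "\<dots> = b \<otimes>\<^bsub>R\<^esub> \<chi> c"
      unfolding \<chi>_def using Mc[OF that(2)] a by (intro F.finsum_rdistr[symmetric]) (auto simp: that)
    finally show ?thesis .
  qed
  have chi_basis: "\<chi> (basis_vector R l) = a l" if "l < r" for l
  proof -
    have "\<chi> (basis_vector R l) = (\<Oplus>\<^bsub>R\<^esub>j\<in>{..<r}. if l = j then a j else \<zero>\<^bsub>R\<^esub>)"
      unfolding \<chi>_def using a by (intro F.R.finsum_cong') (auto simp: basis_vector_def Pi_iff)
    also have "\<dots> = a l" using that a by (intro F.R.finsum_singleton) auto
    finally show ?thesis .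
  qed
  define g where "g = (\<lambda>c \<in> carrier M. \<chi> c \<odot>\<^bsub>N\<^esub> u)"
  have g: "linear R M N g"
    by (rule linearI) (auto simp: g_def chi_closed chi_add chi_smult u N.smult_l_distr N.smult_assoc1)
  have g_hom: "g \<in> mod_hom R M N" using g by (auto simp: mod_hom_iff g_def)
  have g_basis: "g (basis_vector R l) = a l \<odot>\<^bsub>N\<^esub> u" if "l < r" for l
    using that F.basis_vector_closed[of l "{..<r}"] by (simp add: g_def chi_basis M_def)
  have Ls: "submodule (module_kernel M N g) R M"
    using submodule_vimage[OF M.module_axioms N.module_axioms g submodule_zero[OF N.module_axioms]]
    by (simp add: module_kernel_def)
  define L where "L = M\<lparr>carrier := module_kernel M N g\<rparr>"
  have L: "module R L" unfolding L_def by (rule submodule.submodule_is_module[OF Ls M.module_axioms])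
  interpret L: module R L by (rule L)
  have L_carrier: "carrier L = module_kernel M N g" by (simp add: L_def)
  have L_sub: "c \<in> carrier M" if "c \<in> carrier L" for c using that by (simp add: L_def module_kernel_def)
  define f where "f = (\<lambda>c \<in> carrier L. c)"
  have f: "f \<in> mod_hom R L M" "linear R L M f"
  proof -
    show "linear R L M f"
      by (rule linearI) (use L.a_closed L.smult_closed in \<open>auto simp: f_def L_sub\<close>, auto simp: L_def)
    then show "f \<in> mod_hom R L M" by (auto simp: mod_hom_iff f_def)
  qed
  have ex: "exact_at L f M g N" by (simp add: exact_at_def f_def L_carrier)
  have ex_tensor: "exact_at (tensor R L F) (tensor_map R L M F f) (tensor R M F) (tensor_map R M N F g) (tensor R N F)"
    using flat[unfolded flat_module_def, THEN conjunct2, rule_format, of L M N f g] L M.module_axioms N.module_axioms f g_hom ex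
    by blast
  define TL where "TL = free_module R (carrier L \<times> carrier F)"
  define TM where "TM = free_module R (carrier M \<times> carrier F)"
  define TN where "TN = free_module R (carrier N \<times> carrier F)"
  interpret TL: module R TL unfolding TL_def by (rule F.free_module_module)
  interpret TM: module R TM unfolding TM_def by (rule F.free_module_module)
  interpret TN: module R TN unfolding TN_def by (rule F.free_module_module)
  have eM: "basis_vector R (c, y) \<in> carrier TM" if "c \<in> carrier M" "y \<in> carrier F" for c y
    unfolding TM_def using that by (intro F.basis_vector_closed) auto
  have eN: "basis_vector R (c, y) \<in> carrier TN" if "c \<in> carrier N" "y \<in> carrier F" for c y
    unfolding TN_def using that by (intro F.basis_vector_closed) auto
  define rM where "rM = tensor_relations R M F"
  define rN where "rN = tensor_relations R N F"
  note rMs = tensor_relations_submodule[OF M.module_axioms F, folded rM_def TM_def]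
  note rNs = tensor_relations_submodule[OF N.module_axioms F, folded rN_def TN_def]
  have eml: "basis_vector R l \<in> carrier M" if "l < r" for l
    unfolding M_def using that by (intro F.basis_vector_closed) auto
  have xl: "x l \<in> carrier F" "a l \<in> carrier R" if "l < r" for l using x a that by auto
  define \<omega> where "\<omega> = (\<Oplus>\<^bsub>TM\<^esub>l\<in>{..<r}. basis_vector R (basis_vector R l, x l))"
  have om: "\<omega> \<in> carrier TM" unfolding \<omega>_def using eM eml xl by (intro TM.finsum_closed) auto
  have g_closed: "g c \<in> carrier N" if "c \<in> carrier M" for c by (rule linear_closed[OF g that])
  have F_partial: "(\<Oplus>\<^bsub>F\<^esub>l\<in>{..<n}. a l \<odot>\<^bsub>F\<^esub> x l) \<in> carrier F" if "n \<le> r" for n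
    using xl that by (intro F.finsum_closed) auto
  have N_partial: "(\<Oplus>\<^bsub>TN\<^esub>l\<in>{..<n}. basis_vector R (a l \<odot>\<^bsub>N\<^esub> u, x l)) \<in> carrier TN" if "n \<le> r" for n
    using xl that eN u by (intro TN.finsum_closed) auto
  \<comment> \<open>The image of \<open>\<omega>\<close> in \<open>N \<otimes> F\<close> is \<open>u\<close> tensored with the left side of the relation.\<close>
  have partial: "(\<Oplus>\<^bsub>TN\<^esub>l\<in>{..<n}. basis_vector R (a l \<odot>\<^bsub>N\<^esub> u, x l)) \<ominus>\<^bsub>TN\<^esub>
      basis_vector R (u, \<Oplus>\<^bsub>F\<^esub>l\<in>{..<n}. a l \<odot>\<^bsub>F\<^esub> x l) \<in> rN" if "n \<le> r" for n
    using that
  proof (induct n)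
    case 0
    have "basis_vector R (u, \<zero>\<^bsub>F\<^esub>) \<ominus>\<^bsub>TN\<^esub> (basis_vector R (u, \<zero>\<^bsub>F\<^esub>) \<oplus>\<^bsub>TN\<^esub> basis_vector R (u, \<zero>\<^bsub>F\<^esub>)) \<in> rN"
      using rNs(2)[of u "\<zero>\<^bsub>F\<^esub>" "\<zero>\<^bsub>F\<^esub>"] u by simp
    moreover have "b \<ominus>\<^bsub>TN\<^esub> (b \<oplus>\<^bsub>TN\<^esub> b) = \<zero>\<^bsub>TN\<^esub> \<ominus>\<^bsub>TN\<^esub> b" if "b \<in> carrier TN" for b
      using that by algebra
    ultimately show ?case using eN[OF u F.zero_closed] by simp
  next
    case (Suc n)
    define b where "b = a n" define y where "y = x n"
    define s where "s = (\<Oplus>\<^bsub>F\<^esub>l\<in>{..<n}. a l \<odot>\<^bsub>F\<^esub> x l)"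
    define T where "T = (\<Oplus>\<^bsub>TN\<^esub>l\<in>{..<n}. basis_vector R (a l \<odot>\<^bsub>N\<^esub> u, x l))"
    have c: "b \<in> carrier R" "y \<in> carrier F" "s \<in> carrier F" "T \<in> carrier TN"
      using xl[of n] Suc(2) F_partial[of n] N_partial[of n] by (auto simp: b_def y_def s_def T_def)
    have s1: "(\<Oplus>\<^bsub>F\<^esub>l\<in>{..<Suc n}. a l \<odot>\<^bsub>F\<^esub> x l) = b \<odot>\<^bsub>F\<^esub> y \<oplus>\<^bsub>F\<^esub> s"
      unfolding lessThan_Suc b_def y_def s_def using xl Suc(2) by (intro F.finsum_insert) auto
    have t1: "(\<Oplus>\<^bsub>TN\<^esub>l\<in>{..<Suc n}. basis_vector R (a l \<odot>\<^bsub>N\<^esub> u, x l)) = basis_vector R (b \<odot>\<^bsub>N\<^esub> u, y) \<oplus>\<^bsub>TN\<^esub> T"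
      unfolding lessThan_Suc b_def y_def T_def using xl Suc(2) eN u by (intro TN.finsum_insert) auto
    define e1 where "e1 = basis_vector R (b \<odot>\<^bsub>N\<^esub> u, y)"
    define e2 where "e2 = b \<odot>\<^bsub>TN\<^esub> basis_vector R (u, y)"
    define e3 where "e3 = basis_vector R (u, b \<odot>\<^bsub>F\<^esub> y)"
    define e4 where "e4 = basis_vector R (u, s)"
    define e5 where "e5 = basis_vector R (u, b \<odot>\<^bsub>F\<^esub> y \<oplus>\<^bsub>F\<^esub> s)"
    have ec: "e1 \<in> carrier TN" "e2 \<in> carrier TN" "e3 \<in> carrier TN" "e4 \<in> carrier TN" "e5 \<in> carrier TN"
      unfolding e1_def e2_def e3_def e4_def e5_def using c u eN by auto
    have m: "T \<ominus>\<^bsub>TN\<^esub> e4 \<in> rN" "e1 \<ominus>\<^bsub>TN\<^esub> e2 \<in> rN" "e3 \<ominus>\<^bsub>TN\<^esub> e2 \<in> rN" "e5 \<ominus>\<^bsub>TN\<^esub> (e3 \<oplus>\<^bsub>TN\<^esub> e4) \<in> rN"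
      using Suc rNs(4)[OF c(1) u c(2)] rNs(5)[OF c(1) u c(2)] rNs(2)[OF u F.smult_closed[OF c(1,2)] c(3)]
      unfolding T_def e1_def e2_def e3_def e4_def e5_def s_def by auto
    have "(T \<ominus>\<^bsub>TN\<^esub> e4) \<oplus>\<^bsub>TN\<^esub> (e1 \<ominus>\<^bsub>TN\<^esub> e2) \<ominus>\<^bsub>TN\<^esub> (e3 \<ominus>\<^bsub>TN\<^esub> e2) \<ominus>\<^bsub>TN\<^esub> (e5 \<ominus>\<^bsub>TN\<^esub> (e3 \<oplus>\<^bsub>TN\<^esub> e4)) \<in> rN"
      using m TN.submodule_mem[OF rNs(1)] by simp
    moreover have "(T \<ominus>\<^bsub>TN\<^esub> e4) \<oplus>\<^bsub>TN\<^esub> (e1 \<ominus>\<^bsub>TN\<^esub> e2) \<ominus>\<^bsub>TN\<^esub> (e3 \<ominus>\<^bsub>TN\<^esub> e2) \<ominus>\<^bsub>TN\<^esub> (e5 \<ominus>\<^bsub>TN\<^esub> (e3 \<oplus>\<^bsub>TN\<^esub> e4))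
      = (e1 \<oplus>\<^bsub>TN\<^esub> T) \<ominus>\<^bsub>TN\<^esub> e5"
      using ec c(4) by algebra
    ultimately show ?case unfolding s1 t1 e1_def e5_def by simp
  qed
  define fm where "fm = linear_extension R (carrier M \<times> carrier F) TN (\<lambda>(c, y). basis_vector R (g c, y))"
  have fm: "linear R TM TN fm"
    unfolding fm_def TM_def using eN g_closed by (intro F.linear_extension_linear[OF TN.module_axioms]) auto
  have fm_basis: "fm (basis_vector R (c, y)) = basis_vector R (g c, y)" if "c \<in> carrier M" "y \<in> carrier F" for c y
    unfolding fm_def using eN g_closed that by (subst F.linear_extension_basis[OF TN.module_axioms]) auto
  have fm_rel: "fm \<rho> \<in> rN" if "\<rho> \<in> rM" for \<rho>
    by (rule tensor_relations_into[OF M.module_axioms F TN.module_axioms fm[unfolded TM_def] rNs(1) _ _ _ _ that[unfolded rM_def]])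
       (auto simp: fm_basis linear_add[OF g] linear_smult[OF g] g_closed intro!: rNs(2-5))
  have fm_om: "fm \<omega> \<in> rN"
  proof -
    have "fm \<omega> = (\<Oplus>\<^bsub>TN\<^esub>l\<in>{..<r}. fm (basis_vector R (basis_vector R l, x l)))"
      unfolding \<omega>_def using eM eml xl by (intro linear_map_finsum[OF TM.module_axioms TN.module_axioms fm]) auto
    also have "\<dots> = (\<Oplus>\<^bsub>TN\<^esub>l\<in>{..<r}. basis_vector R (a l \<odot>\<^bsub>N\<^esub> u, x l))"
      using eml xl eN u by (intro TN.finsum_cong') (auto simp: fm_basis g_basis)
    finally have eq: "fm \<omega> = (\<Oplus>\<^bsub>TN\<^esub>l\<in>{..<r}. basis_vector R (a l \<odot>\<^bsub>N\<^esub> u, x l))" .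
    define b where "b = basis_vector R (u, \<zero>\<^bsub>F\<^esub>)"
    have b: "b \<in> carrier TN" unfolding b_def by (rule eN[OF u F.zero_closed])
    have "\<zero>\<^bsub>TN\<^esub> \<ominus>\<^bsub>TN\<^esub> b \<in> rN" using partial[of 0] by (simp add: b_def)
    moreover have "fm \<omega> \<ominus>\<^bsub>TN\<^esub> b \<in> rN" using partial[of r] unfolding eq rel b_def by simp
    ultimately have "(fm \<omega> \<ominus>\<^bsub>TN\<^esub> b) \<ominus>\<^bsub>TN\<^esub> (\<zero>\<^bsub>TN\<^esub> \<ominus>\<^bsub>TN\<^esub> b) \<in> rN" using TN.submodule_mem(5)[OF rNs(1)] by blast
    moreover have "(w \<ominus>\<^bsub>TN\<^esub> b) \<ominus>\<^bsub>TN\<^esub> (\<zero>\<^bsub>TN\<^esub> \<ominus>\<^bsub>TN\<^esub> b) = w" if "w \<in> carrier TN" for w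
      using that b by algebra
    ultimately show ?thesis using linear_closed[OF fm om] by simp
  qed
  define \<Omega> where "\<Omega> = rM +>\<^bsub>TM\<^esub> \<omega>"
  have Om: "\<Omega> \<in> carrier (tensor R M F)"
    using om by (auto simp: tensor_def quotient_module_def A_RCOSETS_def' \<Omega>_def rM_def TM_def)
  have om_Om: "\<omega> \<in> \<Omega>" unfolding \<Omega>_def by (rule TM.coset_of_submodule(2)[OF rMs(1) om])
  have "tensor_map R M N F g \<Omega> = (\<Union>\<phi>\<in>\<Omega>. rN +>\<^bsub>TN\<^esub> fm \<phi>)"
    unfolding tensor_map_def using Om by (simp add: fm_def rN_def TN_def)
  also have "\<dots> = (\<Union>\<phi>\<in>\<Omega>. rN)"
  proof (rule SUP_cong[OF refl])
    fix \<phi> assume "\<phi> \<in> \<Omega>"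
    then obtain \<rho> where r: "\<rho> \<in> rM" "\<phi> = \<rho> \<oplus>\<^bsub>TM\<^esub> \<omega>" by (auto simp: \<Omega>_def a_r_coset_def')
    have "fm \<phi> \<in> rN"
      unfolding r(2) using linear_add[OF fm TM.submodule_mem(1)[OF rMs(1) r(1)] om] fm_rel[OF r(1)] fm_om TN.submodule_mem(3)[OF rNs(1)]
      by simp
    then show "rN +>\<^bsub>TN\<^esub> fm \<phi> = rN" by (rule TN.coset_of_submodule(1)[OF rNs(1)])
  qed
  also have "\<dots> = rN" using om_Om by auto
  finally have "\<Omega> \<in> module_kernel (tensor R M F) (tensor R N F) (tensor_map R M N F g)"
    using Om by (simp add: module_kernel_def) (simp add: tensor_def quotient_module_def rN_def)
  then obtain T where T: "T \<in> carrier (tensor R L F)" "tensor_map R L M F f T = \<Omega>"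
    using ex_tensor unfolding exact_at_def by (metis (no_types, lifting) imageE)
  define fl where "fl = linear_extension R (carrier L \<times> carrier F) TM (\<lambda>(c, y). basis_vector R (f c, y))"
  have fl: "linear R TL TM fl"
    unfolding fl_def TL_def using eM L_sub by (intro F.linear_extension_linear[OF TM.module_axioms]) (auto simp: f_def)
  have fl_basis: "fl (basis_vector R (c, y)) = basis_vector R (c, y)" if "c \<in> carrier L" "y \<in> carrier F" for c y
    unfolding fl_def using eM L_sub that by (subst F.linear_extension_basis[OF TM.module_axioms]) (auto simp: f_def)
  have "\<omega> \<in> (\<Union>\<phi>\<in>T. rM +>\<^bsub>TM\<^esub> fl \<phi>)"
    using om_Om T(1) unfolding T(2)[symmetric] tensor_map_def by (simp add: fl_def rM_def TM_def)
  then obtain \<phi> \<rho> where phi: "\<phi> \<in> T" and rho: "\<rho> \<in> rM" "\<omega> = \<rho> \<oplus>\<^bsub>TM\<^esub> fl \<phi>"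
    by (auto simp: a_r_coset_def')
  have phi: "\<phi> \<in> carrier TL"
  proof -
    have "submodule (tensor_relations R L F) R TL"
      unfolding TL_def by (rule tensor_relations_submodule(1)[OF L F])
    then show ?thesis using phi T(1) TL.submodule_mem(1)
      by (auto simp: tensor_def quotient_module_def A_RCOSETS_def' a_r_coset_def' TL_def[symmetric])
  qed
  have coord: "c l \<in> carrier R" if "c \<in> carrier L" for c l by (rule Mc[OF L_sub[OF that]])
  \<comment> \<open>The map \<open>c \<otimes> y \<mapsto> c\<^sub>l y\<close>, with the basis vector of \<open>y\<close> in place of \<open>y\<close>.\<close>
  define w where "w l = linear_extension R (carrier L \<times> carrier F) (res0 R F) (\<lambda>(c, y). c l \<odot>\<^bsub>res0 R F\<^esub> basis_vector R y)" for l
  have w: "linear R TL (res0 R F) (w l)" for l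
    unfolding w_def TL_def using coord pres(3) by (intro F.linear_extension_linear[OF P.module_axioms]) auto
  have w_basis: "w l (basis_vector R (c, y)) = c l \<odot>\<^bsub>res0 R F\<^esub> basis_vector R y" if "c \<in> carrier L" "y \<in> carrier F" for c y l
    unfolding w_def using coord pres(3) that by (subst F.linear_extension_basis[OF P.module_axioms]) auto
  have "presentation R F (w l \<phi>) = x l" if l: "l < r" for l
  proof -
    \<comment> \<open>On \<open>M \<otimes> F\<close> the map \<open>c \<otimes> y \<mapsto> c\<^sub>l y\<close> is well defined, and \<open>\<omega>\<close> and \<open>\<phi>\<close> represent the same tensor.\<close>
    define ev where "ev = linear_extension R (carrier M \<times> carrier F) F (\<lambda>(c, y). c l \<odot>\<^bsub>F\<^esub> y)"
    have ev: "linear R TM F ev"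
      unfolding ev_def TM_def using Mc by (intro F.linear_extension_linear[OF F]) auto
    have ev_basis: "ev (basis_vector R (c, y)) = c l \<odot>\<^bsub>F\<^esub> y" if "c \<in> carrier M" "y \<in> carrier F" for c y
      unfolding ev_def using Mc that by (subst F.linear_extension_basis[OF F]) auto
    have ev_rel: "ev \<rho> \<in> {\<zero>\<^bsub>F\<^esub>}"
    proof (rule tensor_relations_into[OF M.module_axioms F F ev[unfolded TM_def] submodule_zero[OF F] _ _ _ _ rho(1)[unfolded rM_def]])
      fix c c' y assume *: "c \<in> carrier M" "c' \<in> carrier M" "y \<in> carrier F"
      have "(c \<oplus>\<^bsub>M\<^esub> c') l = c l \<oplus>\<^bsub>R\<^esub> c' l" by (simp add: M_def free_module_sel)
      then show "ev (basis_vector R (c \<oplus>\<^bsub>M\<^esub> c', y)) \<ominus>\<^bsub>F\<^esub> (ev (basis_vector R (c, y)) \<oplus>\<^bsub>F\<^esub> ev (basis_vector R (c', y))) \<in> {\<zero>\<^bsub>F\<^esub>}"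
        using * Mc by (simp add: ev_basis F.diff_zero_iff F.smult_l_distr)
    next
      fix c y y' assume *: "c \<in> carrier M" "y \<in> carrier F" "y' \<in> carrier F"
      then show "ev (basis_vector R (c, y \<oplus>\<^bsub>F\<^esub> y')) \<ominus>\<^bsub>F\<^esub> (ev (basis_vector R (c, y)) \<oplus>\<^bsub>F\<^esub> ev (basis_vector R (c, y'))) \<in> {\<zero>\<^bsub>F\<^esub>}"
        using Mc by (simp add: ev_basis F.diff_zero_iff F.smult_r_distr)
    next
      fix b c y assume *: "b \<in> carrier R" "c \<in> carrier M" "y \<in> carrier F"
      have "(b \<odot>\<^bsub>M\<^esub> c) l = b \<otimes>\<^bsub>R\<^esub> c l" by (simp add: M_def free_module_sel)
      then show "ev (basis_vector R (b \<odot>\<^bsub>M\<^esub> c, y)) \<ominus>\<^bsub>F\<^esub> b \<odot>\<^bsub>F\<^esub> ev (basis_vector R (c, y)) \<in> {\<zero>\<^bsub>F\<^esub>}"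
        using * Mc by (simp add: ev_basis F.diff_zero_iff F.smult_assoc1)
    next
      fix b c y assume *: "b \<in> carrier R" "c \<in> carrier M" "y \<in> carrier F"
      have "c l \<odot>\<^bsub>F\<^esub> (b \<odot>\<^bsub>F\<^esub> y) = b \<odot>\<^bsub>F\<^esub> (c l \<odot>\<^bsub>F\<^esub> y)" using * Mc[of c l] by algebra
      then show "ev (basis_vector R (c, b \<odot>\<^bsub>F\<^esub> y)) \<ominus>\<^bsub>F\<^esub> b \<odot>\<^bsub>F\<^esub> ev (basis_vector R (c, y)) \<in> {\<zero>\<^bsub>F\<^esub>}"
        using * Mc by (simp add: ev_basis F.diff_zero_iff)
    qed
    have bl: "basis_vector R j l = (if j = l then \<one>\<^bsub>R\<^esub> else \<zero>\<^bsub>R\<^esub>)" for j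
      by (auto simp: basis_vector_def)
    have "ev \<omega> = (\<Oplus>\<^bsub>F\<^esub>j\<in>{..<r}. ev (basis_vector R (basis_vector R j, x j)))"
      unfolding \<omega>_def using eM eml xl by (intro linear_map_finsum[OF TM.module_axioms F ev]) auto
    also have "\<dots> = (\<Oplus>\<^bsub>F\<^esub>j\<in>{..<r}. if l = j then x j else \<zero>\<^bsub>F\<^esub>)"
      using eml xl by (intro F.finsum_cong') (auto simp: ev_basis bl)
    also have "\<dots> = x l" using l x by (intro F.finsum_singleton) auto
    finally have "ev \<omega> = x l" .
    moreover have "ev \<omega> = ev \<rho> \<oplus>\<^bsub>F\<^esub> ev (fl \<phi>)"
      unfolding rho(2) by (rule linear_add[OF ev TM.submodule_mem(1)[OF rMs(1) rho(1)] linear_closed[OF fl phi]])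
    ultimately have "ev (fl \<phi>) = x l" using ev_rel linear_closed[OF ev linear_closed[OF fl phi]] by simp
    moreover have "presentation R F (w l \<phi>) = ev (fl \<phi>)"
    proof (rule F.linear_eq_on_basis[OF F _ _ _ phi[unfolded TL_def]])
      show "linear R (free_module R (carrier L \<times> carrier F)) F (\<lambda>\<phi>. presentation R F (w l \<phi>))"
        using linear_comp[OF w pres(2)] by (simp add: TL_def)
      show "linear R (free_module R (carrier L \<times> carrier F)) F (\<lambda>\<phi>. ev (fl \<phi>))"
        using linear_comp[OF fl ev] by (simp add: TL_def)
      show "presentation R F (w l (basis_vector R z)) = ev (fl (basis_vector R z))" if "z \<in> carrier L \<times> carrier F" for z
        using that coord pres(3) by (auto simp: w_basis fl_basis ev_basis L_sub linear_smult[OF pres(2)] pres(4))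
    qed
    ultimately show ?thesis by simp
  qed
  moreover have "(\<Oplus>\<^bsub>res0 R F\<^esub>l\<in>{..<r}. a l \<odot>\<^bsub>res0 R F\<^esub> w l \<phi>) \<in> {\<zero>\<^bsub>res0 R F\<^esub>}"
  proof (rule F.linear_into_submodule[OF P.module_axioms _ submodule_zero[OF P.module_axioms] _ phi[unfolded TL_def]])
    show "linear R (free_module R (carrier L \<times> carrier F)) (res0 R F) (\<lambda>\<phi>. \<Oplus>\<^bsub>res0 R F\<^esub>l\<in>{..<r}. a l \<odot>\<^bsub>res0 R F\<^esub> w l \<phi>)"
      unfolding TL_def[symmetric] using xl(2)
      by (intro linear_finsum[OF P.module_axioms TL.module_axioms] linear_scale[OF P.module_axioms w]) auto
    fix z assume "z \<in> carrier L \<times> carrier F"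
    then obtain c y where z: "z = (c, y)" "c \<in> carrier L" "y \<in> carrier F" by auto
    have e: "basis_vector R y \<in> carrier (res0 R F)" by (rule pres(3)[OF z(3)])
    have "g c = \<zero>\<^bsub>N\<^esub>" using z(2) by (simp add: L_carrier module_kernel_def)
    then have "\<chi> c \<odot>\<^bsub>N\<^esub> u = \<zero>\<^bsub>N\<^esub>" using L_sub[OF z(2)] by (simp add: g_def)
    then have "\<chi> c = \<zero>\<^bsub>R\<^esub>" using chi_closed[OF L_sub[OF z(2)]]
      by (auto simp: N_def free_module_sel u_def basis_vector_def fun_eq_iff dest: spec[of _ 0])
    have "(\<Oplus>\<^bsub>res0 R F\<^esub>l\<in>{..<r}. a l \<odot>\<^bsub>res0 R F\<^esub> w l (basis_vector R z)) =
        (\<Oplus>\<^bsub>res0 R F\<^esub>l\<in>{..<r}. (c l \<otimes>\<^bsub>R\<^esub> a l) \<odot>\<^bsub>res0 R F\<^esub> basis_vector R y)"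
      using e xl(2) coord[OF z(2)]
      by (intro P.finsum_cong') (auto simp: z w_basis P.smult_assoc1[symmetric] F.m_comm)
    also have "\<dots> = \<chi> c \<odot>\<^bsub>res0 R F\<^esub> basis_vector R y"
    proof -
      have "(\<Oplus>\<^bsub>res0 R F\<^esub>l\<in>{..<n}. (c l \<otimes>\<^bsub>R\<^esub> a l) \<odot>\<^bsub>res0 R F\<^esub> basis_vector R y) =
        (\<Oplus>\<^bsub>R\<^esub>l\<in>{..<n}. c l \<otimes>\<^bsub>R\<^esub> a l) \<odot>\<^bsub>res0 R F\<^esub> basis_vector R y" if "n \<le> r" for n
        using that
      proof (induct n)
        case (Suc n)
        have s: "(\<Oplus>\<^bsub>R\<^esub>l\<in>{..<n}. c l \<otimes>\<^bsub>R\<^esub> a l) \<in> carrier R"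
          using Suc xl(2) coord[OF z(2)] by (intro F.R.finsum_closed) auto
        have "(\<Oplus>\<^bsub>R\<^esub>l\<in>{..<Suc n}. c l \<otimes>\<^bsub>R\<^esub> a l) = c n \<otimes>\<^bsub>R\<^esub> a n \<oplus>\<^bsub>R\<^esub> (\<Oplus>\<^bsub>R\<^esub>l\<in>{..<n}. c l \<otimes>\<^bsub>R\<^esub> a l)"
          unfolding lessThan_Suc using Suc xl(2) coord[OF z(2)] by (intro F.R.finsum_insert) auto
        moreover have "(\<Oplus>\<^bsub>res0 R F\<^esub>l\<in>{..<Suc n}. (c l \<otimes>\<^bsub>R\<^esub> a l) \<odot>\<^bsub>res0 R F\<^esub> basis_vector R y) =
          (c n \<otimes>\<^bsub>R\<^esub> a n) \<odot>\<^bsub>res0 R F\<^esub> basis_vector R y \<oplus>\<^bsub>res0 R F\<^esub>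
          (\<Oplus>\<^bsub>res0 R F\<^esub>l\<in>{..<n}. (c l \<otimes>\<^bsub>R\<^esub> a l) \<odot>\<^bsub>res0 R F\<^esub> basis_vector R y)"
          unfolding lessThan_Suc using Suc xl(2) coord[OF z(2)] e by (intro P.finsum_insert) auto
        ultimately show ?case
          using Suc xl(2)[of n] coord[OF z(2), of n] s e by (simp add: P.smult_l_distr)
      qed (use e in simp)
      then show ?thesis by (simp add: \<chi>_def)
    qed
    also have "\<dots> = \<zero>\<^bsub>res0 R F\<^esub>" using \<open>\<chi> c = \<zero>\<^bsub>R\<^esub>\<close> e by simp
    finally show "(\<Oplus>\<^bsub>res0 R F\<^esub>l\<in>{..<r}. a l \<odot>\<^bsub>res0 R F\<^esub> w l (basis_vector R z)) \<in> {\<zero>\<^bsub>res0 R F\<^esub>}" by simp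
  qed
  moreover have "(\<lambda>l. w l \<phi>) \<in> {..<r} \<rightarrow> carrier (res0 R F)" using linear_closed[OF w phi] by auto
  ultimately show ?thesis by (intro exI[of _ "\<lambda>l. w l \<phi>"]) auto
qed


definition retracts :: "('a, 'r) ring_scheme \<Rightarrow> ('a, 'b) module \<Rightarrow> 'b set \<Rightarrow> 'b set \<Rightarrow> ('b \<Rightarrow> 'b) \<Rightarrow> bool"
  where "retracts R P K A \<theta> \<longleftrightarrow> linear R P P \<theta> \<and> \<theta> ` carrier P \<subseteq> K \<and> (\<forall>k \<in> A. \<theta> k = k)"

text \<open>The coordinates \<open>k x\<close> of a syzygy are the coefficients of a relation between the elements \<open>x\<close> of
  \<open>F\<close>. Lift the relation to elements \<open>w x\<close> of \<open>P\<close> by the equational criterion. The map that sends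
  the basis vector of \<open>x\<close> to its difference with \<open>w x\<close> takes values in \<open>K\<close>, and it fixes \<open>k\<close> because the
  sum of all \<open>k x \<odot> w x\<close> vanishes.\<close>

lemma flat_retract_one:
  fixes R :: "('a, 'r) ring_scheme" and F :: "('a, 'f) module"
  assumes flat: "flat_module R F" and k: "k \<in> syzygy1 R F"
  shows "\<exists>\<theta>. retracts R (res0 R F) (syzygy1 R F) {k} \<theta>"
proof -
  have F: "module R F" using flat by (simp add: flat_module_def)
  interpret F: module R F by (rule F)
  note pres = presentation_props[OF F]
  interpret P: module R "res0 R F" by (rule pres)
  note Kmem = P.submodule_mem[OF pres(5)]
  have kP: "k \<in> carrier (free_module R (carrier F))" using k pres(6) by (simp add: res0_def)
  define S where "S = {x. k x \<noteq> \<zero>\<^bsub>R\<^esub>}"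
  have S: "finite S" "S \<subseteq> carrier F" unfolding S_def by (rule F.free_module_coord[OF kP])+
  obtain x where x: "bij_betw x {..<card S} S"
    using ex_bij_betw_nat_finite[OF S(1)] by (auto simp: atLeast0LessThan)
  define r where "r = card S"
  have x: "inj_on x {..<r}" "x ` {..<r} = S" using x by (auto simp: r_def bij_betw_def)
  have xF: "x l \<in> carrier F" if "l < r" for l using x(2) S(2) that by auto
  have kc: "k y \<in> carrier R" for y by (rule F.free_module_coord(1)[OF kP])
  have ext: "linear_extension R (carrier F) M h k = (\<Oplus>\<^bsub>M\<^esub>l\<in>{..<r}. k (x l) \<odot>\<^bsub>M\<^esub> h (x l))"
    if M: "module R M" and h: "h \<in> carrier F \<rightarrow> carrier M" for M :: "('a, 'm) module" and h
  proof -
    interpret M: module R M by (rule M)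
    have "linear_extension R (carrier F) M h k = (\<Oplus>\<^bsub>M\<^esub>y\<in>x ` {..<r}. k y \<odot>\<^bsub>M\<^esub> h y)"
      unfolding x(2) by (rule F.linear_extension_eq[OF M h kP S(1) _ S(2)]) (simp add: S_def)
    also have "\<dots> = (\<Oplus>\<^bsub>M\<^esub>l\<in>{..<r}. k (x l) \<odot>\<^bsub>M\<^esub> h (x l))"
      using x S(2) h kc by (intro M.finsum_reindex) auto
    finally show ?thesis .
  qed
  have "(\<Oplus>\<^bsub>F\<^esub>l\<in>{..<r}. k (x l) \<odot>\<^bsub>F\<^esub> x l) = \<zero>\<^bsub>F\<^esub>"
    using k ext[OF F, of "\<lambda>x. x"] by (simp add: pres(6) presentation_def)
  then obtain w where w: "w \<in> {..<r} \<rightarrow> carrier (res0 R F)" "\<And>l. l < r \<Longrightarrow> presentation R F (w l) = x l"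
    "(\<Oplus>\<^bsub>res0 R F\<^esub>l\<in>{..<r}. k (x l) \<odot>\<^bsub>res0 R F\<^esub> w l) = \<zero>\<^bsub>res0 R F\<^esub>"
    using flat_equational[OF flat, of "\<lambda>l. k (x l)" r x] kc xF by auto
  define v where "v y = w (inv_into {..<r} x y)" for y
  have vx: "v (x l) = w l" if "l < r" for l using x(1) that by (simp add: v_def)
  have v: "v y \<in> carrier (res0 R F)" "presentation R F (v y) = y" if "y \<in> S" for y
    using that w(1,2) vx unfolding x(2)[symmetric] by auto
  define h where "h y = (if y \<in> S then basis_vector R y \<ominus>\<^bsub>res0 R F\<^esub> v y else \<zero>\<^bsub>res0 R F\<^esub>)" for y
  have h: "h y \<in> syzygy1 R F" if "y \<in> carrier F" for y
    using that v[of y] pres(3,4) Kmem(2)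
    by (auto simp: h_def pres(6) linear_diff[OF pres(1) F pres(2)] F.diff_zero_iff)
  then have hP: "h \<in> carrier F \<rightarrow> carrier (res0 R F)" using Kmem(1) by auto
  define \<theta> where "\<theta> = linear_extension R (carrier F) (res0 R F) h"
  note lin' = F.linear_extension_linear[OF pres(1) hP, folded \<theta>_def]
  then have lin: "linear R (res0 R F) (res0 R F) \<theta>" by (simp add: res0_def)
  have "\<theta> \<phi> \<in> syzygy1 R F" if "\<phi> \<in> carrier (res0 R F)" for \<phi>
    by (rule F.linear_into_submodule[OF pres(1) lin' pres(5) _ that[unfolded res0_def]])
       (simp add: \<theta>_def F.linear_extension_basis[OF pres(1) hP] h)
  then have "\<theta> ` carrier (res0 R F) \<subseteq> syzygy1 R F" by auto
  moreover have "\<theta> k = k"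
  proof -
    have id: "linear_extension R (carrier F) (res0 R F) (basis_vector R) k = k"
    proof (rule F.linear_eq_on_basis[OF pres(1) _ _ _ kP])
      show "linear R (free_module R (carrier F)) (res0 R F) (\<lambda>y. y)" by (simp add: linear_def res0_def)
    qed (use pres(1,3) in \<open>auto intro!: F.linear_extension_linear F.linear_extension_basis\<close>)
    have "linear_extension R (carrier F) (res0 R F) (\<lambda>y. if y \<in> S then v y else \<zero>\<^bsub>res0 R F\<^esub>) k =
       (\<Oplus>\<^bsub>res0 R F\<^esub>l\<in>{..<r}. k (x l) \<odot>\<^bsub>res0 R F\<^esub> w l)"
      using v w(1) x(2) kc by (subst ext[OF pres(1)]) (auto simp: vx intro!: P.finsum_cong')
    also have "\<dots> = \<zero>\<^bsub>res0 R F\<^esub>" by (rule w(3))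
    finally have zero: "linear_extension R (carrier F) (res0 R F) (\<lambda>y. if y \<in> S then v y else \<zero>\<^bsub>res0 R F\<^esub>) k = \<zero>\<^bsub>res0 R F\<^esub>" .
    have "\<theta> k = (\<Oplus>\<^bsub>res0 R F\<^esub>l\<in>{..<r}. k (x l) \<odot>\<^bsub>res0 R F\<^esub> basis_vector R (x l) \<oplus>\<^bsub>res0 R F\<^esub>
        (\<ominus>\<^bsub>R\<^esub> \<one>\<^bsub>R\<^esub>) \<odot>\<^bsub>res0 R F\<^esub> (k (x l) \<odot>\<^bsub>res0 R F\<^esub> w l))"
    proof -
      have "k (x l) \<odot>\<^bsub>res0 R F\<^esub> h (x l) = k (x l) \<odot>\<^bsub>res0 R F\<^esub> basis_vector R (x l) \<oplus>\<^bsub>res0 R F\<^esub>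
        (\<ominus>\<^bsub>R\<^esub> \<one>\<^bsub>R\<^esub>) \<odot>\<^bsub>res0 R F\<^esub> (k (x l) \<odot>\<^bsub>res0 R F\<^esub> w l)" if "l < r" for l
      proof -
        have "h (x l) = basis_vector R (x l) \<ominus>\<^bsub>res0 R F\<^esub> w l" using that x(2) vx by (auto simp: h_def)
        moreover have "w l \<in> carrier (res0 R F)" "basis_vector R (x l) \<in> carrier (res0 R F)" "k (x l) \<in> carrier R"
          using w(1) that pres(3) xF kc by auto
        ultimately show ?thesis by simp algebra
      qed
      then show ?thesis unfolding \<theta>_def ext[OF pres(1) hP] using hP xF kc pres(3) w(1)
        by (intro P.finsum_cong') (auto simp: Pi_iff)
    qed
    also have "\<dots> = (\<Oplus>\<^bsub>res0 R F\<^esub>l\<in>{..<r}. k (x l) \<odot>\<^bsub>res0 R F\<^esub> basis_vector R (x l)) \<oplus>\<^bsub>res0 R F\<^esub>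
        (\<Oplus>\<^bsub>res0 R F\<^esub>l\<in>{..<r}. (\<ominus>\<^bsub>R\<^esub> \<one>\<^bsub>R\<^esub>) \<odot>\<^bsub>res0 R F\<^esub> (k (x l) \<odot>\<^bsub>res0 R F\<^esub> w l))"
      using xF kc pres(3) w(1) by (intro P.finsum_addf) (auto simp: Pi_iff)
    also have "(\<Oplus>\<^bsub>res0 R F\<^esub>l\<in>{..<r}. (\<ominus>\<^bsub>R\<^esub> \<one>\<^bsub>R\<^esub>) \<odot>\<^bsub>res0 R F\<^esub> (k (x l) \<odot>\<^bsub>res0 R F\<^esub> w l)) =
        (\<ominus>\<^bsub>R\<^esub> \<one>\<^bsub>R\<^esub>) \<odot>\<^bsub>res0 R F\<^esub> (\<Oplus>\<^bsub>res0 R F\<^esub>l\<in>{..<r}. k (x l) \<odot>\<^bsub>res0 R F\<^esub> w l)"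
      using kc w(1) by (intro P.finsum_smult_ldistr[symmetric]) (auto simp: Pi_iff)
    also have "(\<Oplus>\<^bsub>res0 R F\<^esub>l\<in>{..<r}. k (x l) \<odot>\<^bsub>res0 R F\<^esub> basis_vector R (x l)) = k"
      using ext[OF pres(1), of "basis_vector R"] pres(3) id by simp
    finally show ?thesis using w(3) k Kmem(1) by simp
  qed
  ultimately show ?thesis using lin by (auto simp: retracts_def)
qed

text \<open>Villamayor's criterion. If \<open>\<theta>\<close> fixes one element \<open>k\<close> and \<open>\<eta>\<close> fixes what \<open>1 - \<theta>\<close> leaves of the
  others, then the map \<open>\<zeta>\<close> with \<open>1 - \<zeta> = (1 - \<eta>) (1 - \<theta>)\<close> fixes all of them.\<close>

lemma flat_retracts:
  fixes R :: "('a, 'r) ring_scheme" and F :: "('a, 'f) module"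
  assumes flat: "flat_module R F" and A: "finite A" "A \<subseteq> syzygy1 R F"
  shows "\<exists>\<theta>. retracts R (res0 R F) (syzygy1 R F) A \<theta>"
proof -
  have F: "module R F" using flat by (simp add: flat_module_def)
  note pres = presentation_props[OF F]
  interpret P: module R "res0 R F" by (rule pres)
  note Kmem = P.submodule_mem[OF pres(5)]
  show ?thesis using A
  proof (induct A rule: measure_induct_rule[of card])
    case (less A)
    show ?case
    proof (cases "A = {}")
      case True
      then show ?thesis
        using Kmem(2) linear_zero_map[OF pres(1)]
        by (intro exI[of _ "\<lambda>x. \<zero>\<^bsub>res0 R F\<^esub>"]) (auto simp: retracts_def linear_def)
    next
      case False
      then obtain k where k: "k \<in> A" by blast
      then obtain \<theta> where "retracts R (res0 R F) (syzygy1 R F) {k} \<theta>"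
        using flat_retract_one[OF flat, of k] less by auto
      then have th: "linear R (res0 R F) (res0 R F) \<theta>" "\<And>x. x \<in> carrier (res0 R F) \<Longrightarrow> \<theta> x \<in> syzygy1 R F" "\<theta> k = k"
        by (auto simp: retracts_def)
      define B where "B = (\<lambda>b. b \<ominus>\<^bsub>res0 R F\<^esub> \<theta> b) ` (A - {k})"
      have "card B \<le> card (A - {k})" unfolding B_def using less(2) by (intro card_image_le) auto
      also have "\<dots> < card A" using k less(2) by (rule card_Diff1_less[rotated])
      finally have "card B < card A" .
      moreover have "finite B" "B \<subseteq> syzygy1 R F" using less(2,3) th(2) Kmem(1,5) by (auto simp: B_def)
      ultimately obtain \<eta> where "retracts R (res0 R F) (syzygy1 R F) B \<eta>" using less(1)[of B] by auto
      then have et: "linear R (res0 R F) (res0 R F) \<eta>" "\<And>x. x \<in> carrier (res0 R F) \<Longrightarrow> \<eta> x \<in> syzygy1 R F"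
        "\<And>b. b \<in> B \<Longrightarrow> \<eta> b = b"
        by (auto simp: retracts_def)
      define \<zeta> where "\<zeta> x = \<theta> x \<oplus>\<^bsub>res0 R F\<^esub> \<eta> (x \<ominus>\<^bsub>res0 R F\<^esub> \<theta> x)" for x
      have "linear R (res0 R F) (res0 R F) (\<lambda>x. x)" by (simp add: linear_def)
      from linear_comp[OF linear_diff_maps[OF pres(1) this th(1)] et(1)]
      have "linear R (res0 R F) (res0 R F) \<zeta>"
        unfolding \<zeta>_def by (intro linear_add_maps[OF pres(1) th(1)])
      moreover have "\<zeta> ` carrier (res0 R F) \<subseteq> syzygy1 R F"
        using th(2) et(2) Kmem(1,3) by (auto simp: \<zeta>_def)
      moreover have "\<zeta> b = b" if "b \<in> A" for b
      proof (cases "b = k")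
        case True
        then have "b \<in> carrier (res0 R F)" using that less(3) Kmem(1) by auto
        then show ?thesis using linear_zero[OF pres(1) pres(1) et(1)] True
          by (simp add: \<zeta>_def th(3) P.minus_eq P.r_neg)
      next
        case False
        then have "b \<ominus>\<^bsub>res0 R F\<^esub> \<theta> b \<in> B" using that by (auto simp: B_def)
        then have "\<zeta> b = \<theta> b \<oplus>\<^bsub>res0 R F\<^esub> (b \<ominus>\<^bsub>res0 R F\<^esub> \<theta> b)" by (simp add: \<zeta>_def et(3))
        also have "\<dots> = b"
        proof -
          have "b \<in> carrier (res0 R F)" "\<theta> b \<in> carrier (res0 R F)" using that less(3) Kmem(1) th(2) by auto
          then show ?thesis by algebra
        qed
        finally show ?thesis .
      qed
      ultimately show ?thesis by (auto simp: retracts_def)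
    qed
  qed
qed

section \<open>Localizations as modules\<close>

abbreviation frac :: "('a, 'r) ring_scheme \<Rightarrow> 'a set \<Rightarrow> 'a \<Rightarrow> 'a \<Rightarrow> ('a \<times> 'a) set"
  where "frac R S r s \<equiv> fraction_rel R S `` {(r, s)}"

locale multiplicative_set = cring R + submonoid S R for S and R (structure)
begin

lemma denominator: "s \<in> S \<Longrightarrow> s \<in> carrier R" using subset by blast

lemma fraction_rel_equiv: "equiv (carrier R \<times> S) (fraction_rel R S)"
proof (rule equivI)
  show "fraction_rel R S \<subseteq> (carrier R \<times> S) \<times> (carrier R \<times> S)" by (auto simp: fraction_rel_def)
  show "refl_on (carrier R \<times> S) (fraction_rel R S)"
    using one_closed denominator unfolding refl_on_def fraction_rel_def by force
  show "sym (fraction_rel R S)"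
    unfolding sym_def fraction_rel_def by auto metis
  show "trans (fraction_rel R S)"
  proof (rule transI)
    fix p q z assume "(p, q) \<in> fraction_rel R S" "(q, z) \<in> fraction_rel R S"
    then obtain r s r' s' r'' s'' t u where eq: "p = (r, s)" "q = (r', s')" "z = (r'', s'')"
      and c: "r \<in> carrier R" "s \<in> S" "r' \<in> carrier R" "s' \<in> S" "r'' \<in> carrier R" "s'' \<in> S" "t \<in> S" "u \<in> S"
      and h: "t \<otimes> (s' \<otimes> r) = t \<otimes> (s \<otimes> r')" "u \<otimes> (s'' \<otimes> r') = u \<otimes> (s' \<otimes> r'')"
      by (cases p; cases q; cases z) (auto simp: fraction_rel_def)
    note c' = c(1,3,5) c(2,4,6,7,8)[THEN denominator]
    have "(t \<otimes> u \<otimes> s') \<otimes> (s'' \<otimes> r) = (u \<otimes> s'') \<otimes> (t \<otimes> (s' \<otimes> r))" using c' by algebra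
    also have "\<dots> = (t \<otimes> s) \<otimes> (u \<otimes> (s'' \<otimes> r'))" unfolding h(1) using c' by algebra
    also have "\<dots> = (t \<otimes> u \<otimes> s') \<otimes> (s \<otimes> r'')" unfolding h(2) using c' by algebra
    finally show "(p, z) \<in> fraction_rel R S"
      using c m_closed by (auto simp: eq fraction_rel_def)
  qed
qed

lemma frac_eq_iff:
  assumes "r \<in> carrier R" "s \<in> S" "r' \<in> carrier R" "s' \<in> S"
  shows "frac R S r s = frac R S r' s' \<longleftrightarrow> (\<exists>t \<in> S. t \<otimes> (s' \<otimes> r) = t \<otimes> (s \<otimes> r'))"
proof -
  have "frac R S r s = frac R S r' s' \<longleftrightarrow> ((r, s), (r', s')) \<in> fraction_rel R S"
    using assms by (intro eq_equiv_class_iff[OF fraction_rel_equiv]) auto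
  then show ?thesis using assms by (simp add: fraction_rel_def)
qed

lemma mem_fracD:
  assumes "(r', s') \<in> frac R S r s"
  shows "r' \<in> carrier R" "s' \<in> S" "r \<in> carrier R" "s \<in> S" "\<exists>t \<in> S. t \<otimes> (s' \<otimes> r) = t \<otimes> (s \<otimes> r')"
  using assms by (auto simp: fraction_rel_def)

lemma frac_self: "r \<in> carrier R \<Longrightarrow> s \<in> S \<Longrightarrow> (r, s) \<in> frac R S r s"
  using equiv_class_self[OF fraction_rel_equiv] by auto

lemma frac_closed: "r \<in> carrier R \<Longrightarrow> s \<in> S \<Longrightarrow> frac R S r s \<in> carrier (localization R S)"
  by (auto simp: localization_def Let_def intro: quotientI)

lemma localization_cases:
  assumes "q \<in> carrier (localization R S)"
  obtains r s where "r \<in> carrier R" "s \<in> S" "q = frac R S r s"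
  using assms by (auto simp: localization_def Let_def elim!: quotientE)

lemma localization_zero: "\<zero>\<^bsub>localization R S\<^esub> = frac R S \<zero> \<one>"
  by (simp add: localization_def Let_def)

lemma localization_add:
  assumes c: "r \<in> carrier R" "s \<in> S" "r' \<in> carrier R" "s' \<in> S"
  shows "frac R S r s \<oplus>\<^bsub>localization R S\<^esub> frac R S r' s' = frac R S ((s' \<otimes> r) \<oplus> (s \<otimes> r')) (s \<otimes> s')"
proof -
  have eq: "frac R S ((s1' \<otimes> r1) \<oplus> (s1 \<otimes> r1')) (s1 \<otimes> s1') = frac R S ((s' \<otimes> r) \<oplus> (s \<otimes> r')) (s \<otimes> s')"
    if m: "(r1, s1) \<in> frac R S r s" "(r1', s1') \<in> frac R S r' s'" for r1 s1 r1' s1'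
  proof -
    obtain t u where t: "t \<in> S" "t \<otimes> (s1 \<otimes> r) = t \<otimes> (s \<otimes> r1)" and u: "u \<in> S" "u \<otimes> (s1' \<otimes> r') = u \<otimes> (s' \<otimes> r1')"
      using mem_fracD(5)[OF m(1)] mem_fracD(5)[OF m(2)] by blast
    note d = mem_fracD(1,2)[OF m(1)] mem_fracD(1,2)[OF m(2)]
    note c' = c(1,3) c(2,4)[THEN denominator] d(1,3) d(2,4)[THEN denominator] t(1)[THEN denominator] u(1)[THEN denominator]
    have "(t \<otimes> u) \<otimes> ((s \<otimes> s') \<otimes> ((s1' \<otimes> r1) \<oplus> (s1 \<otimes> r1'))) =
      (t \<otimes> (s \<otimes> r1)) \<otimes> (u \<otimes> (s' \<otimes> s1')) \<oplus> (u \<otimes> (s' \<otimes> r1')) \<otimes> (t \<otimes> (s \<otimes> s1))" using c' by algebra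
    also have "\<dots> = (t \<otimes> u) \<otimes> ((s1 \<otimes> s1') \<otimes> ((s' \<otimes> r) \<oplus> (s \<otimes> r')))"
      unfolding t(2)[symmetric] u(2)[symmetric] using c' by algebra
    finally show ?thesis
      using c d t(1) u(1) denominator by (subst frac_eq_iff) (auto intro!: bexI[of _ "t \<otimes> u"])
  qed
  have "frac R S r s \<oplus>\<^bsub>localization R S\<^esub> frac R S r' s' =
     (\<Union>p\<in>frac R S r s. \<Union>p'\<in>frac R S r' s'. frac R S ((s' \<otimes> r) \<oplus> (s \<otimes> r')) (s \<otimes> s'))"
    unfolding localization_def Let_def using eq by (auto simp: split_beta intro!: SUP_cong)
  then show ?thesis using frac_self[OF c(1,2)] frac_self[OF c(3,4)] by auto
qed

lemma localization_smult:
  assumes c: "a \<in> carrier R" "r \<in> carrier R" "s \<in> S"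
  shows "a \<odot>\<^bsub>localization R S\<^esub> frac R S r s = frac R S (a \<otimes> r) s"
proof -
  have eq: "frac R S (a \<otimes> r1) s1 = frac R S (a \<otimes> r) s" if m: "(r1, s1) \<in> frac R S r s" for r1 s1
  proof -
    obtain t where t: "t \<in> S" "t \<otimes> (s1 \<otimes> r) = t \<otimes> (s \<otimes> r1)" using mem_fracD(5)[OF m] by blast
    note d = mem_fracD(1,2)[OF m]
    note c' = c(1,2) c(3)[THEN denominator] d(1) d(2)[THEN denominator] t(1)[THEN denominator]
    have "t \<otimes> (s \<otimes> (a \<otimes> r1)) = a \<otimes> (t \<otimes> (s \<otimes> r1))" using c' by algebra
    also have "\<dots> = t \<otimes> (s1 \<otimes> (a \<otimes> r))" unfolding t(2)[symmetric] using c' by algebra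
    finally show ?thesis using c d t(1) denominator by (subst frac_eq_iff) auto
  qed
  have "a \<odot>\<^bsub>localization R S\<^esub> frac R S r s = (\<Union>p\<in>frac R S r s. frac R S (a \<otimes> r) s)"
    unfolding localization_def Let_def using eq by (auto simp: split_beta intro!: SUP_cong)
  then show ?thesis using frac_self[OF c(2,3)] by auto
qed

lemma localization_module: "module R (localization R S)"
proof -
  note arith = localization_add localization_smult localization_zero frac_closed
  note den = denominator m_closed one_closed
  show ?thesis
  proof (intro moduleI abelian_groupI)
    show "cring R" by (rule is_cring)
    fix x y z assume "x \<in> carrier (localization R S)" "y \<in> carrier (localization R S)" "z \<in> carrier (localization R S)"
    then obtain r s r' s' r'' s'' where
      eq: "x = frac R S r s" "y = frac R S r' s'" "z = frac R S r'' s''" and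
      c: "r \<in> carrier R" "s \<in> S" "r' \<in> carrier R" "s' \<in> S" "r'' \<in> carrier R" "s'' \<in> S"
      by (auto elim!: localization_cases)
    note c' = c(1,3,5) c(2,4,6)[THEN denominator]
    have "s'' \<otimes> (s' \<otimes> r \<oplus> s \<otimes> r') \<oplus> s \<otimes> s' \<otimes> r'' = s' \<otimes> s'' \<otimes> r \<oplus> s \<otimes> (s'' \<otimes> r' \<oplus> s' \<otimes> r'')"
      "s \<otimes> s' \<otimes> s'' = s \<otimes> (s' \<otimes> s'')" using c' by algebra+
    then show "x \<oplus>\<^bsub>localization R S\<^esub> y \<oplus>\<^bsub>localization R S\<^esub> z = x \<oplus>\<^bsub>localization R S\<^esub> (y \<oplus>\<^bsub>localization R S\<^esub> z)"
      using c c' den unfolding eq by (simp add: arith)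
  next
    fix x assume "x \<in> carrier (localization R S)"
    then obtain r s where eq: "x = frac R S r s" and c: "r \<in> carrier R" "s \<in> S" by (auto elim!: localization_cases)
    note c' = c(1) c(2)[THEN denominator]
    show "\<zero>\<^bsub>localization R S\<^esub> \<oplus>\<^bsub>localization R S\<^esub> x = x" "\<one> \<odot>\<^bsub>localization R S\<^esub> x = x"
      using c c' den unfolding eq by (simp_all add: arith)
    have "frac R S (\<ominus> r) s \<oplus>\<^bsub>localization R S\<^esub> x = frac R S (s \<otimes> (\<ominus> r) \<oplus> s \<otimes> r) (s \<otimes> s)"
      using c den unfolding eq by (simp add: arith)
    also have "s \<otimes> (\<ominus> r) \<oplus> s \<otimes> r = \<zero>" using c' by algebra
    also have "frac R S \<zero> (s \<otimes> s) = frac R S \<zero> \<one>"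
      using c c' den by (subst frac_eq_iff) auto
    finally show "\<exists>y\<in>carrier (localization R S). y \<oplus>\<^bsub>localization R S\<^esub> x = \<zero>\<^bsub>localization R S\<^esub>"
      using c by (intro bexI[of _ "frac R S (\<ominus> r) s"]) (auto simp: arith)
  next
    fix x y assume "x \<in> carrier (localization R S)" "y \<in> carrier (localization R S)"
    then obtain r s r' s' where
      eq: "x = frac R S r s" "y = frac R S r' s'" and
      c: "r \<in> carrier R" "s \<in> S" "r' \<in> carrier R" "s' \<in> S"
      by (auto elim!: localization_cases)
    note c' = c(1,3) c(2,4)[THEN denominator]
    have "s' \<otimes> r \<oplus> s \<otimes> r' = s \<otimes> r' \<oplus> s' \<otimes> r" "s \<otimes> s' = s' \<otimes> s" using c' by algebra+
    then show "x \<oplus>\<^bsub>localization R S\<^esub> y = y \<oplus>\<^bsub>localization R S\<^esub> x"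
      using c den unfolding eq by (simp add: arith)
    show "x \<oplus>\<^bsub>localization R S\<^esub> y \<in> carrier (localization R S)"
      using c den unfolding eq by (simp add: arith)
    fix a assume a: "a \<in> carrier R"
    show "a \<odot>\<^bsub>localization R S\<^esub> x \<in> carrier (localization R S)"
      using a c den unfolding eq by (simp add: arith)
    have "a \<otimes> (s' \<otimes> r \<oplus> s \<otimes> r') = s' \<otimes> (a \<otimes> r) \<oplus> s \<otimes> (a \<otimes> r')" using a c' by algebra
    then show "a \<odot>\<^bsub>localization R S\<^esub> (x \<oplus>\<^bsub>localization R S\<^esub> y) =
      a \<odot>\<^bsub>localization R S\<^esub> x \<oplus>\<^bsub>localization R S\<^esub> a \<odot>\<^bsub>localization R S\<^esub> y"
      using a c c' den unfolding eq by (simp add: arith)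
  next
    fix a b x assume a: "a \<in> carrier R" "b \<in> carrier R" and "x \<in> carrier (localization R S)"
    then obtain r s where eq: "x = frac R S r s" and c: "r \<in> carrier R" "s \<in> S" by (auto elim!: localization_cases)
    note c' = c(1) c(2)[THEN denominator]
    show "a \<otimes> b \<odot>\<^bsub>localization R S\<^esub> x = a \<odot>\<^bsub>localization R S\<^esub> (b \<odot>\<^bsub>localization R S\<^esub> x)"
      using a c c' den unfolding eq by (simp add: arith m_assoc)
    have "s \<otimes> s \<otimes> ((a \<oplus> b) \<otimes> r) = s \<otimes> (s \<otimes> (a \<otimes> r) \<oplus> s \<otimes> (b \<otimes> r))" using a c' by algebra
    then have "frac R S ((a \<oplus> b) \<otimes> r) s = frac R S (s \<otimes> (a \<otimes> r) \<oplus> s \<otimes> (b \<otimes> r)) (s \<otimes> s)"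
      using a c c' den by (subst frac_eq_iff) (auto intro!: bexI[of _ \<one>])
    then show "(a \<oplus> b) \<odot>\<^bsub>localization R S\<^esub> x = a \<odot>\<^bsub>localization R S\<^esub> x \<oplus>\<^bsub>localization R S\<^esub> b \<odot>\<^bsub>localization R S\<^esub> x"
      using a c c' den unfolding eq by (simp add: arith)
  next
    show "\<zero>\<^bsub>localization R S\<^esub> \<in> carrier (localization R S)" using den by (simp add: arith)
  qed
qed

end

section \<open>Almost cotorsion modules and telescopes\<close>

text \<open>
  The products \<open>t\<^sub>n\<close> of the factors \<open>s\<^sub>0, \<dots>, s\<^sub>n\<^sub>-\<^sub>1\<close>, where \<open>s\<^sub>n = t\<^sub>n e\<^sub>n\<close> is the \<open>step\<close>. Since \<open>t\<^sub>n\<^sub>+\<^sub>1\<close> is a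
  multiple of the square of \<open>t\<^sub>n\<close>, the set of divisors of the \<open>t\<^sub>n\<close> is multiplicative
  even if each \<open>e\<^sub>n\<close> occurs only once; it follows that the colimit of \<open>R\<close> along the multiplications
  \<open>s\<^sub>n\<close> is the localization at the \<open>e\<^sub>n\<close>.
\<close>

primrec tele :: "('a, 'r) ring_scheme \<Rightarrow> (nat \<Rightarrow> 'a) \<Rightarrow> nat \<Rightarrow> 'a" where
  "tele R e 0 = \<one>\<^bsub>R\<^esub>"
| "tele R e (Suc n) = tele R e n \<otimes>\<^bsub>R\<^esub> (tele R e n \<otimes>\<^bsub>R\<^esub> e n)"

definition step :: "('a, 'r) ring_scheme \<Rightarrow> (nat \<Rightarrow> 'a) \<Rightarrow> nat \<Rightarrow> 'a"
  where "step R e n = tele R e n \<otimes>\<^bsub>R\<^esub> e n"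

text \<open>The vanishing of the first derived limit of the quotient of \<open>H\<close> by \<open>Z\<close> along every sequence of steps.\<close>

definition telescoping :: "('a, 'r) ring_scheme \<Rightarrow> ('a, 'm) module \<Rightarrow> 'm set \<Rightarrow> 'm set \<Rightarrow> bool"
  where "telescoping R M H Z \<longleftrightarrow> (\<forall>e d. (\<forall>n. e n \<in> carrier R) \<longrightarrow> (\<forall>n. d n \<in> H) \<longrightarrow>
    (\<exists>x. (\<forall>n. x n \<in> H) \<and> (\<forall>n. x n \<ominus>\<^bsub>M\<^esub> step R e n \<odot>\<^bsub>M\<^esub> x (Suc n) \<ominus>\<^bsub>M\<^esub> d n \<in> Z)))"

lemma (in cring) tele_closed:
  assumes "\<And>n. e n \<in> carrier R"
  shows "tele R e n \<in> carrier R" "step R e n \<in> carrier R"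
proof -
  show t: "tele R e n \<in> carrier R" for n by (induct n) (use assms in auto)
  show "step R e n \<in> carrier R" using t assms by (simp add: step_def)
qed

lemma (in cring) tele_Suc:
  "tele R e (Suc n) = tele R e n \<otimes> step R e n"
  by (simp add: step_def)

lemma (in cring) tele_dvd:
  assumes "\<And>n. e n \<in> carrier R" "m \<le> n"
  shows "\<exists>v \<in> carrier R. tele R e n = tele R e m \<otimes> v"
  using assms(2)
proof (induct n rule: dec_induct)
  case base
  then show ?case using tele_closed[of e m, OF assms(1)] by (intro bexI[of _ \<one>]) auto
next
  case (step n)
  then obtain v where v: "v \<in> carrier R" "tele R e n = tele R e m \<otimes> v" by blast
  then show ?case unfolding tele_Suc
    using tele_closed[of e, OF assms(1)] by (intro bexI[of _ "v \<otimes> Submission.step R e n"]) (auto simp: m_assoc)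
qed

locale telescope = C?: module R C for R :: "('a, 'r) ring_scheme" and C :: "('a, 'c) module" +
  fixes e :: "nat \<Rightarrow> 'a" and d :: "nat \<Rightarrow> 'c"
  assumes e: "\<And>n. e n \<in> carrier R" and d: "\<And>n. d n \<in> carrier C"
begin

text \<open>In the module \<open>Y\<close> generated by \<open>C\<close> and symbols \<open>u\<^sub>n\<close> with \<open>u\<^sub>n = d\<^sub>n + s\<^sub>n u\<^sub>n\<^sub>+\<^sub>1\<close> one has
  \<open>u\<^sub>n = acc n m + prd n m \<odot> u\<^sub>m\<close> for \<open>n \<le> m\<close>. It is an extension by \<open>C\<close> of the localization, in which \<open>u\<^sub>n\<close>
  becomes the inverse of \<open>t\<^sub>n\<close>.\<close>

primrec prd :: "nat \<Rightarrow> nat \<Rightarrow> 'a" where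
  "prd n 0 = \<one>\<^bsub>R\<^esub>"
| "prd n (Suc m) = (if n \<le> m then prd n m \<otimes>\<^bsub>R\<^esub> step R e m else \<one>\<^bsub>R\<^esub>)"

primrec acc :: "nat \<Rightarrow> nat \<Rightarrow> 'c" where
  "acc n 0 = \<zero>\<^bsub>C\<^esub>"
| "acc n (Suc m) = (if n \<le> m then acc n m \<oplus>\<^bsub>C\<^esub> prd n m \<odot>\<^bsub>C\<^esub> d m else \<zero>\<^bsub>C\<^esub>)"

definition denoms :: "'a set" where
  "denoms = range (\<lambda>l. foldr (\<lambda>i w. e i \<otimes>\<^bsub>R\<^esub> w) l \<one>\<^bsub>R\<^esub>)"

lemma te: "tele R e n \<in> carrier R" "step R e n \<in> carrier R"
  using R.tele_closed[of e] e by auto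

lemma prd_closed: "prd n m \<in> carrier R" by (induct m) (auto simp: te)
lemma acc_closed: "acc n m \<in> carrier C" by (induct m) (auto simp: prd_closed d)
lemma prd_triv: "m \<le> n \<Longrightarrow> prd n m = \<one>\<^bsub>R\<^esub>" by (cases m) auto
lemma acc_triv: "m \<le> n \<Longrightarrow> acc n m = \<zero>\<^bsub>C\<^esub>" by (cases m) auto

lemma tele_prd: "n \<le> m \<Longrightarrow> tele R e m = tele R e n \<otimes>\<^bsub>R\<^esub> prd n m"
  by (induct m rule: dec_induct)
     (auto simp: prd_triv te R.tele_Suc R.m_assoc prd_closed simp del: tele.simps(2))

lemma prd_prd:
  assumes "n \<le> k" "k \<le> m"
  shows "prd n m = prd n k \<otimes>\<^bsub>R\<^esub> prd k m"
  using assms(2,1)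
  by (induct m rule: dec_induct) (auto simp: prd_triv R.m_assoc prd_closed te)

lemma acc_acc:
  assumes "n \<le> k" "k \<le> m"
  shows "acc n m = acc n k \<oplus>\<^bsub>C\<^esub> prd n k \<odot>\<^bsub>C\<^esub> acc k m"
  using assms(2)
proof (induct m rule: dec_induct)
  case base
  then show ?case by (simp add: acc_triv prd_closed acc_closed)
next
  case (step m)
  then have "acc n (Suc m) = (acc n k \<oplus>\<^bsub>C\<^esub> prd n k \<odot>\<^bsub>C\<^esub> acc k m) \<oplus>\<^bsub>C\<^esub> (prd n k \<otimes>\<^bsub>R\<^esub> prd k m) \<odot>\<^bsub>C\<^esub> d m"
    using assms(1) by (simp add: prd_prd[of n k m])
  also have "\<dots> = acc n k \<oplus>\<^bsub>C\<^esub> prd n k \<odot>\<^bsub>C\<^esub> (acc k m \<oplus>\<^bsub>C\<^esub> prd k m \<odot>\<^bsub>C\<^esub> d m)"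
    using acc_closed[of n k] acc_closed[of k m] prd_closed[of n k] prd_closed[of k m] d[of m] by algebra
  finally show ?case using step by simp
qed

lemma acc_first: "n < m \<Longrightarrow> acc n m = d n \<oplus>\<^bsub>C\<^esub> step R e n \<odot>\<^bsub>C\<^esub> acc (Suc n) m"
  using acc_acc[of n "Suc n" m] by (simp add: acc_triv prd_triv d te acc_closed)

lemma denoms_countable: "countable denoms"
  unfolding denoms_def by (rule countable_image) simp

lemma denoms_submonoid: "submonoid denoms R"
proof
  have c: "foldr (\<lambda>i w. e i \<otimes>\<^bsub>R\<^esub> w) l \<one>\<^bsub>R\<^esub> \<in> carrier R" for l by (induct l) (auto simp: e)
  show "denoms \<subseteq> carrier R" using c by (auto simp: denoms_def)
  show "\<one>\<^bsub>R\<^esub> \<in> denoms" by (auto simp: denoms_def intro!: range_eqI[of _ _ "[]"])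
  have "foldr (\<lambda>i w. e i \<otimes>\<^bsub>R\<^esub> w) l \<one>\<^bsub>R\<^esub> \<otimes>\<^bsub>R\<^esub> foldr (\<lambda>i w. e i \<otimes>\<^bsub>R\<^esub> w) l' \<one>\<^bsub>R\<^esub> = foldr (\<lambda>i w. e i \<otimes>\<^bsub>R\<^esub> w) (l @ l') \<one>\<^bsub>R\<^esub>" for l l'
    by (induct l) (use c in \<open>auto simp: R.m_assoc e\<close>)
  then show "x \<otimes>\<^bsub>R\<^esub> y \<in> denoms" if "x \<in> denoms" "y \<in> denoms" for x y
    using that unfolding denoms_def by fastforce
qed

sublocale multiplicative_set denoms R
  by (intro multiplicative_set.intro R.is_cring denoms_submonoid)

lemma e_mem: "e i \<in> denoms"
  by (auto simp: denoms_def e intro!: range_eqI[of _ _ "[i]"])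

lemma tele_mem: "tele R e n \<in> denoms"
  by (induct n) (auto intro!: R.m_closed denoms_submonoid[THEN submonoid.m_closed] denoms_submonoid[THEN submonoid.one_closed] e_mem)

lemma denoms_dvd_tele: "w \<in> denoms \<Longrightarrow> \<exists>k. \<exists>v \<in> carrier R. tele R e k = w \<otimes>\<^bsub>R\<^esub> v"
proof -
  have "\<exists>k. \<exists>v \<in> carrier R. tele R e k = foldr (\<lambda>i w. e i \<otimes>\<^bsub>R\<^esub> w) l \<one>\<^bsub>R\<^esub> \<otimes>\<^bsub>R\<^esub> v" for l
  proof (induct l)
    case Nil
    show ?case using te by (intro exI[of _ 0] bexI[of _ "\<one>\<^bsub>R\<^esub>"]) auto
  next
    case (Cons i l)
    define w where "w = foldr (\<lambda>i w. e i \<otimes>\<^bsub>R\<^esub> w) l \<one>\<^bsub>R\<^esub>"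
    have w: "w \<in> carrier R" unfolding w_def by (induct l) (auto simp: e)
    obtain k v where v: "v \<in> carrier R" "tele R e k = w \<otimes>\<^bsub>R\<^esub> v" using Cons by (auto simp: w_def)
    define n where "n = max k (Suc i)"
    obtain v1 where v1: "v1 \<in> carrier R" "tele R e n = tele R e k \<otimes>\<^bsub>R\<^esub> v1"
      using R.tele_dvd[of e k n] e by (auto simp: n_def)
    obtain v2 where v2: "v2 \<in> carrier R" "tele R e n = tele R e (Suc i) \<otimes>\<^bsub>R\<^esub> v2"
      using R.tele_dvd[of e "Suc i" n] e by (auto simp: n_def)
    have "tele R e (Suc n) = tele R e n \<otimes>\<^bsub>R\<^esub> tele R e n \<otimes>\<^bsub>R\<^esub> e n" using te e by (simp add: R.m_assoc)
    also have "\<dots> = (w \<otimes>\<^bsub>R\<^esub> v \<otimes>\<^bsub>R\<^esub> v1) \<otimes>\<^bsub>R\<^esub> (tele R e i \<otimes>\<^bsub>R\<^esub> (tele R e i \<otimes>\<^bsub>R\<^esub> e i) \<otimes>\<^bsub>R\<^esub> v2) \<otimes>\<^bsub>R\<^esub> e n"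
      using v1(2) v2(2) by (simp add: v(2))
    also have "\<dots> = e i \<otimes>\<^bsub>R\<^esub> w \<otimes>\<^bsub>R\<^esub> (v \<otimes>\<^bsub>R\<^esub> v1 \<otimes>\<^bsub>R\<^esub> tele R e i \<otimes>\<^bsub>R\<^esub> tele R e i \<otimes>\<^bsub>R\<^esub> v2 \<otimes>\<^bsub>R\<^esub> e n)"
      using w v(1) v1(1) v2(1) te(1)[of i] e[of i] e[of n] by algebra
    finally show ?case using v v1 v2 te e
      by (intro exI[of _ "Suc n"] bexI[of _ "v \<otimes>\<^bsub>R\<^esub> v1 \<otimes>\<^bsub>R\<^esub> tele R e i \<otimes>\<^bsub>R\<^esub> tele R e i \<otimes>\<^bsub>R\<^esub> v2 \<otimes>\<^bsub>R\<^esub> e n"])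
         (auto simp: w_def simp del: tele.simps)
  qed
  then show "w \<in> denoms \<Longrightarrow> ?thesis" by (auto simp: denoms_def)
qed

text \<open>Divisibility holds arbitrarily far out, since each step is a multiple of the product of all
  earlier ones.\<close>

lemma denoms_dvd_prd: "w \<in> denoms \<Longrightarrow> \<exists>m \<ge> n. \<exists>v \<in> carrier R. prd n m = w \<otimes>\<^bsub>R\<^esub> v"
proof -
  assume w: "w \<in> denoms"
  then obtain k v where v: "v \<in> carrier R" "tele R e k = w \<otimes>\<^bsub>R\<^esub> v" using denoms_dvd_tele by blast
  define m where "m = max k n"
  obtain v1 where v1: "v1 \<in> carrier R" "tele R e m = tele R e k \<otimes>\<^bsub>R\<^esub> v1"
    using R.tele_dvd[of e k m] e by (auto simp: m_def)
  have "prd n (Suc m) = prd n m \<otimes>\<^bsub>R\<^esub> (w \<otimes>\<^bsub>R\<^esub> v \<otimes>\<^bsub>R\<^esub> v1 \<otimes>\<^bsub>R\<^esub> e m)"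
    using v1(2) v(2) by (simp add: m_def step_def)
  also have "\<dots> = w \<otimes>\<^bsub>R\<^esub> (prd n m \<otimes>\<^bsub>R\<^esub> v \<otimes>\<^bsub>R\<^esub> v1 \<otimes>\<^bsub>R\<^esub> e m)"
    using denominator[OF w] v(1) v1(1) e[of m] prd_closed[of n m] by algebra
  finally show ?thesis using v v1 e prd_closed
    by (intro exI[of _ "Suc m"] conjI bexI[of _ "prd n m \<otimes>\<^bsub>R\<^esub> v \<otimes>\<^bsub>R\<^esub> v1 \<otimes>\<^bsub>R\<^esub> e m"]) (auto simp: m_def)
qed

text \<open>
  An element \<open>c + a \<odot> u\<^sub>n\<close> of the extension \<open>Y\<close> is replaced by the sequence of its approximations
  \<open>c + a \<odot> acc n m\<close>, in which \<open>u\<^sub>m\<close> is set to zero. For an element of \<open>C\<close> this sequence is eventually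
  constant, so equations in \<open>C\<close> can be read off from sequences, where the operations are pointwise.
  \<open>germ_of \<xi> q\<close> says that \<open>\<xi>\<close> comes from a preimage of the fraction \<open>q\<close>.
\<close>

definition germ :: "(nat \<Rightarrow> 'c) \<Rightarrow> nat \<Rightarrow> 'a \<Rightarrow> bool" where
  "germ \<xi> n a \<longleftrightarrow> a \<in> carrier R \<and> (\<forall>m. \<xi> m \<in> carrier C) \<and> (\<forall>m \<ge> n. \<xi> m = \<xi> n \<oplus>\<^bsub>C\<^esub> a \<odot>\<^bsub>C\<^esub> acc n m)"

lemma germ_raise:
  assumes "germ \<xi> n a" "n \<le> k"
  shows "germ \<xi> k (a \<otimes>\<^bsub>R\<^esub> prd n k)"
    "frac R denoms (a \<otimes>\<^bsub>R\<^esub> prd n k) (tele R e k) = frac R denoms a (tele R e n)"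
proof -
  have g: "a \<in> carrier R" "\<And>m. \<xi> m \<in> carrier C" "\<And>m. m \<ge> n \<Longrightarrow> \<xi> m = \<xi> n \<oplus>\<^bsub>C\<^esub> a \<odot>\<^bsub>C\<^esub> acc n m"
    using assms(1) unfolding germ_def by blast+
  have "\<xi> m = \<xi> k \<oplus>\<^bsub>C\<^esub> (a \<otimes>\<^bsub>R\<^esub> prd n k) \<odot>\<^bsub>C\<^esub> acc k m" if "m \<ge> k" for m
  proof -
    have "\<xi> m = \<xi> n \<oplus>\<^bsub>C\<^esub> a \<odot>\<^bsub>C\<^esub> (acc n k \<oplus>\<^bsub>C\<^esub> prd n k \<odot>\<^bsub>C\<^esub> acc k m)"
      using g(3)[of m] that assms(2) acc_acc[OF assms(2) that] by simp
    also have "\<dots> = (\<xi> n \<oplus>\<^bsub>C\<^esub> a \<odot>\<^bsub>C\<^esub> acc n k) \<oplus>\<^bsub>C\<^esub> (a \<otimes>\<^bsub>R\<^esub> prd n k) \<odot>\<^bsub>C\<^esub> acc k m"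
      using g(1) g(2)[of n] acc_closed[of n k] acc_closed[of k m] prd_closed[of n k] by algebra
    also have "\<xi> n \<oplus>\<^bsub>C\<^esub> a \<odot>\<^bsub>C\<^esub> acc n k = \<xi> k" using g(3)[of k] assms(2) by simp
    finally show ?thesis .
  qed
  moreover have "a \<otimes>\<^bsub>R\<^esub> prd n k \<in> carrier R" using g(1) prd_closed by simp
  ultimately show "germ \<xi> k (a \<otimes>\<^bsub>R\<^esub> prd n k)" using g(2) unfolding germ_def by blast
  have "tele R e n \<otimes>\<^bsub>R\<^esub> (a \<otimes>\<^bsub>R\<^esub> prd n k) = tele R e k \<otimes>\<^bsub>R\<^esub> a"
    unfolding tele_prd[OF assms(2)] using te(1)[of n] prd_closed[of n k] g(1) by algebra
  then show "frac R denoms (a \<otimes>\<^bsub>R\<^esub> prd n k) (tele R e k) = frac R denoms a (tele R e n)"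
    using g(1) prd_closed tele_mem te(1) by (subst frac_eq_iff) (auto intro!: bexI[of _ "\<one>\<^bsub>R\<^esub>"])
qed

definition germ_of :: "(nat \<Rightarrow> 'c) \<Rightarrow> ('a \<times> 'a) set \<Rightarrow> bool" where
  "germ_of \<xi> q \<longleftrightarrow> (\<exists>n a. germ \<xi> n a \<and> q = frac R denoms a (tele R e n))"

lemma germ_of_add:
  assumes "germ_of \<xi> q" "germ_of \<zeta> q'"
  shows "germ_of (\<lambda>m. \<xi> m \<oplus>\<^bsub>C\<^esub> \<zeta> m) (q \<oplus>\<^bsub>localization R denoms\<^esub> q')"
proof -
  obtain n a n' a' where g: "germ \<xi> n a" "q = frac R denoms a (tele R e n)" "germ \<zeta> n' a'" "q' = frac R denoms a' (tele R e n')"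
    using assms by (auto simp: germ_of_def)
  define k where "k = max n n'"
  define b where "b = a \<otimes>\<^bsub>R\<^esub> prd n k" define b' where "b' = a' \<otimes>\<^bsub>R\<^esub> prd n' k"
  have h: "germ \<xi> k b" "q = frac R denoms b (tele R e k)" "germ \<zeta> k b'" "q' = frac R denoms b' (tele R e k)"
    using germ_raise[OF g(1), of k] germ_raise[OF g(3), of k] g(2,4) by (auto simp: k_def b_def b'_def)
  have c: "b \<in> carrier R" "b' \<in> carrier R" "\<And>m. \<xi> m \<in> carrier C" "\<And>m. \<zeta> m \<in> carrier C"
    using h(1,3) unfolding germ_def by blast+
  have "\<xi> m \<oplus>\<^bsub>C\<^esub> \<zeta> m = (\<xi> k \<oplus>\<^bsub>C\<^esub> \<zeta> k) \<oplus>\<^bsub>C\<^esub> (b \<oplus>\<^bsub>R\<^esub> b') \<odot>\<^bsub>C\<^esub> acc k m" if "m \<ge> k" for m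
  proof -
    have "\<xi> m \<oplus>\<^bsub>C\<^esub> \<zeta> m = (\<xi> k \<oplus>\<^bsub>C\<^esub> b \<odot>\<^bsub>C\<^esub> acc k m) \<oplus>\<^bsub>C\<^esub> (\<zeta> k \<oplus>\<^bsub>C\<^esub> b' \<odot>\<^bsub>C\<^esub> acc k m)"
      using h(1,3) that unfolding germ_def by metis
    also have "\<dots> = (\<xi> k \<oplus>\<^bsub>C\<^esub> \<zeta> k) \<oplus>\<^bsub>C\<^esub> (b \<oplus>\<^bsub>R\<^esub> b') \<odot>\<^bsub>C\<^esub> acc k m"
      using c(1,2) c(3)[of k] c(4)[of k] acc_closed[of k m] by algebra
    finally show ?thesis .
  qed
  moreover have "b \<oplus>\<^bsub>R\<^esub> b' \<in> carrier R" "\<And>m. \<xi> m \<oplus>\<^bsub>C\<^esub> \<zeta> m \<in> carrier C" using c by auto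
  ultimately have "germ (\<lambda>m. \<xi> m \<oplus>\<^bsub>C\<^esub> \<zeta> m) k (b \<oplus>\<^bsub>R\<^esub> b')" unfolding germ_def by blast
  moreover have "q \<oplus>\<^bsub>localization R denoms\<^esub> q' = frac R denoms (b \<oplus>\<^bsub>R\<^esub> b') (tele R e k)"
  proof -
    have "tele R e k \<otimes>\<^bsub>R\<^esub> (tele R e k \<otimes>\<^bsub>R\<^esub> b \<oplus>\<^bsub>R\<^esub> tele R e k \<otimes>\<^bsub>R\<^esub> b') = tele R e k \<otimes>\<^bsub>R\<^esub> tele R e k \<otimes>\<^bsub>R\<^esub> (b \<oplus>\<^bsub>R\<^esub> b')"
      using c(1,2) te(1)[of k] by algebra
    then show ?thesis unfolding h(2,4) using c(1,2) tele_mem te(1) denoms_submonoid[THEN submonoid.m_closed]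
        denoms_submonoid[THEN submonoid.one_closed]
      by (subst localization_add, simp_all, subst frac_eq_iff) (auto intro!: bexI[of _ "\<one>\<^bsub>R\<^esub>"])
  qed
  ultimately show ?thesis by (auto simp: germ_of_def)
qed

lemma germ_of_smult:
  assumes "germ_of \<xi> q" "b \<in> carrier R"
  shows "germ_of (\<lambda>m. b \<odot>\<^bsub>C\<^esub> \<xi> m) (b \<odot>\<^bsub>localization R denoms\<^esub> q)"
proof -
  obtain n a where g: "germ \<xi> n a" "q = frac R denoms a (tele R e n)" using assms by (auto simp: germ_of_def)
  have c: "a \<in> carrier R" "\<And>m. \<xi> m \<in> carrier C" using g(1) unfolding germ_def by blast+
  have "b \<odot>\<^bsub>C\<^esub> \<xi> m = b \<odot>\<^bsub>C\<^esub> \<xi> n \<oplus>\<^bsub>C\<^esub> (b \<otimes>\<^bsub>R\<^esub> a) \<odot>\<^bsub>C\<^esub> acc n m" if "m \<ge> n" for m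
  proof -
    have "b \<odot>\<^bsub>C\<^esub> \<xi> m = b \<odot>\<^bsub>C\<^esub> (\<xi> n \<oplus>\<^bsub>C\<^esub> a \<odot>\<^bsub>C\<^esub> acc n m)" using g(1) that unfolding germ_def by metis
    also have "\<dots> = b \<odot>\<^bsub>C\<^esub> \<xi> n \<oplus>\<^bsub>C\<^esub> (b \<otimes>\<^bsub>R\<^esub> a) \<odot>\<^bsub>C\<^esub> acc n m"
      using c(1) c(2)[of n] assms(2) acc_closed[of n m] by algebra
    finally show ?thesis .
  qed
  moreover have "b \<otimes>\<^bsub>R\<^esub> a \<in> carrier R" "\<And>m. b \<odot>\<^bsub>C\<^esub> \<xi> m \<in> carrier C" using c assms(2) by auto
  ultimately have "germ (\<lambda>m. b \<odot>\<^bsub>C\<^esub> \<xi> m) n (b \<otimes>\<^bsub>R\<^esub> a)" unfolding germ_def by blast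
  moreover have "b \<odot>\<^bsub>localization R denoms\<^esub> q = frac R denoms (b \<otimes>\<^bsub>R\<^esub> a) (tele R e n)"
    unfolding g(2) using c assms(2) tele_mem by (simp add: localization_smult)
  ultimately show ?thesis by (auto simp: germ_of_def)
qed

text \<open>A preimage of zero in the extension lies in \<open>C\<close>: a denominator kills the numerator, and it divides one
  of the later products of steps.\<close>

lemma germ_of_zero_const:
  assumes "germ_of \<xi> \<zero>\<^bsub>localization R denoms\<^esub>"
  shows "\<exists>k. \<forall>m \<ge> k. \<xi> m = \<xi> k"
proof -
  obtain n a where g: "germ \<xi> n a" "\<zero>\<^bsub>localization R denoms\<^esub> = frac R denoms a (tele R e n)" using assms by (auto simp: germ_of_def)
  have c: "a \<in> carrier R" "\<And>m. \<xi> m \<in> carrier C" using g(1) unfolding germ_def by blast+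
  have "frac R denoms a (tele R e n) = frac R denoms \<zero>\<^bsub>R\<^esub> \<one>\<^bsub>R\<^esub>"
    using g(2) by (simp add: localization_zero)
  then obtain w where w: "w \<in> denoms" "w \<otimes>\<^bsub>R\<^esub> a = \<zero>\<^bsub>R\<^esub>"
    using c te tele_mem denominator denoms_submonoid[THEN submonoid.one_closed] by (auto simp: frac_eq_iff)
  obtain k v where k: "k \<ge> n" "v \<in> carrier R" "prd n k = w \<otimes>\<^bsub>R\<^esub> v" using denoms_dvd_prd[OF w(1)] by blast
  have "a \<otimes>\<^bsub>R\<^esub> prd n k = (w \<otimes>\<^bsub>R\<^esub> a) \<otimes>\<^bsub>R\<^esub> v" unfolding k(3) using c(1) k(2) denominator[OF w(1)] by algebra
  then have "a \<otimes>\<^bsub>R\<^esub> prd n k = \<zero>\<^bsub>R\<^esub>" using w(2) k(2) by simp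
  then have "germ \<xi> k \<zero>\<^bsub>R\<^esub>" using germ_raise(1)[OF g(1) k(1)] by simp
  then show ?thesis unfolding germ_def using c(2) acc_closed by (metis C.smult_l_null C.M.r_zero)
qed

lemma germ_of_acc: "germ_of (acc n) (frac R denoms \<one>\<^bsub>R\<^esub> (tele R e n))"
proof -
  have "germ (acc n) n \<one>\<^bsub>R\<^esub>" by (simp add: germ_def acc_closed acc_triv)
  then show ?thesis unfolding germ_of_def by blast
qed

lemma germ_of_exists:
  assumes "q \<in> carrier (localization R denoms)"
  shows "\<exists>\<xi>. germ_of \<xi> q"
proof -
  obtain r w where r: "r \<in> carrier R" "w \<in> denoms" "q = frac R denoms r w" using assms by (auto elim!: localization_cases)
  obtain k v where v: "v \<in> carrier R" "tele R e k = w \<otimes>\<^bsub>R\<^esub> v" using denoms_dvd_tele[OF r(2)] by blast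
  have "w \<otimes>\<^bsub>R\<^esub> (v \<otimes>\<^bsub>R\<^esub> r) = tele R e k \<otimes>\<^bsub>R\<^esub> r" unfolding v(2) using r(1) v(1) denominator[OF r(2)] by algebra
  then have "q = frac R denoms (v \<otimes>\<^bsub>R\<^esub> r) (tele R e k)"
    unfolding r(3) using r v(1) te(1) tele_mem denoms_submonoid[THEN submonoid.one_closed]  denominator
    by (subst frac_eq_iff) (auto intro!: bexI[of _ "\<one>\<^bsub>R\<^esub>"])
  also have "\<dots> = (v \<otimes>\<^bsub>R\<^esub> r) \<odot>\<^bsub>localization R denoms\<^esub> frac R denoms \<one>\<^bsub>R\<^esub> (tele R e k)"
    using r v(1) by (subst localization_smult[OF _ R.one_closed tele_mem]) (auto simp: denominator)
  finally show ?thesis using germ_of_smult[OF germ_of_acc, of "v \<otimes>\<^bsub>R\<^esub> r" k] r v by auto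
qed

lemma germ_of_closed: "germ_of \<xi> q \<Longrightarrow> \<xi> m \<in> carrier C"
  by (auto simp: germ_of_def germ_def)

end

text \<open>
  The system defines the extension \<open>Y\<close> of the localization \<open>Q\<close> by \<open>C\<close>. Choose a preimage \<open>b q\<close>
  in \<open>Y\<close> for each \<open>q\<close>. Its linear extension \<open>\<Xi>\<close> maps the first syzygy of \<open>Q\<close> to \<open>C\<close>, and an extension \<open>g\<close> of
  this map \<open>f\<close> to the free module corrects the choice \<open>b\<close> to a section of \<open>Y\<close> over \<open>Q\<close>. The difference of
  \<open>u\<^sub>n\<close> and the value of the section at the inverse of \<open>t\<^sub>n\<close> solves the system.
\<close>

lemma almost_cotorsion_telescoping:
  fixes R :: "('a, 'r) ring_scheme" and C :: "('a, 'c) module"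
  assumes ac: "almost_cotorsion R C"
  shows "telescoping R C (carrier C) {\<zero>\<^bsub>C\<^esub>}"
  unfolding telescoping_def
proof (intro allI impI)
  fix e :: "nat \<Rightarrow> 'a" and d :: "nat \<Rightarrow> 'c"
  assume e: "\<forall>n. e n \<in> carrier R" and d: "\<forall>n. d n \<in> carrier C"
  have C: "module R C" using ac by (simp add: almost_cotorsion_def)
  interpret T: telescope R C e d
    using C e d by (simp add: telescope_def telescope_axioms_def)
  define Q where "Q = localization R T.denoms"
  have Q: "module R Q" unfolding Q_def by (rule T.localization_module)
  interpret Q: module R Q by (rule Q)
  note pres = presentation_props[OF Q]
  interpret P: module R "res0 R Q" by (rule pres(1))
  have "zero_module (Ext1 R Q C)"
    using ac T.denoms_submonoid T.denoms_countable unfolding almost_cotorsion_def Q_def by blast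
  note ext = this[unfolded Ext1_zero_iff[OF Q C], rule_format]
  define b where "b q = (SOME \<xi>. T.germ_of \<xi> q)" for q
  have b: "T.germ_of (b q) q" if "q \<in> carrier Q" for q
    unfolding b_def by (rule someI_ex[OF T.germ_of_exists[OF that[unfolded Q_def]]])
  have bc: "(\<lambda>q. b q m) \<in> carrier Q \<rightarrow> carrier C" for m using b T.germ_of_closed by auto
  define \<Xi> where "\<Xi> m = linear_extension R (carrier Q) C (\<lambda>q. b q m)" for m
  have Xi: "linear R (res0 R Q) C (\<Xi> m)" for m
    unfolding \<Xi>_def res0_def by (rule T.R.linear_extension_linear[OF C bc])
  note Xi_closed = linear_closed[OF Xi]
  have Xi_basis: "\<Xi> m (basis_vector R q) = b q m" if "q \<in> carrier Q" for q m
    unfolding \<Xi>_def by (rule T.R.linear_extension_basis[OF C bc that])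
  have Xi_germ: "T.germ_of (\<lambda>m. \<Xi> m \<phi>) (presentation R Q \<phi>)" if "\<phi> \<in> carrier (res0 R Q)" for \<phi>
  proof -
    have "submodule {\<phi> \<in> carrier (res0 R Q). T.germ_of (\<lambda>m. \<Xi> m \<phi>) (presentation R Q \<phi>)} R (res0 R Q)"
    proof (rule P.submodule_of_scalar_closed)
      have "T.germ_of (\<lambda>m. \<zero>\<^bsub>R\<^esub> \<odot>\<^bsub>C\<^esub> T.acc 0 m) (\<zero>\<^bsub>R\<^esub> \<odot>\<^bsub>localization R T.denoms\<^esub> frac R T.denoms \<one>\<^bsub>R\<^esub> (tele R e 0))"
        by (rule T.germ_of_smult[OF T.germ_of_acc]) simp
      then show "\<zero>\<^bsub>res0 R Q\<^esub> \<in> {\<phi> \<in> carrier (res0 R Q). T.germ_of (\<lambda>m. \<Xi> m \<phi>) (presentation R Q \<phi>)}"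
        using T.frac_closed[OF T.R.one_closed T.tele_mem]
        by (simp add: linear_zero[OF pres(1) C Xi] linear_zero[OF pres(1) Q pres(2)] T.acc_closed Q_def[symmetric] del: tele.simps)
    qed (auto simp: linear_add[OF Xi] linear_smult[OF Xi] linear_add[OF pres(2)] linear_smult[OF pres(2)]
          intro: T.germ_of_add[folded Q_def] T.germ_of_smult[folded Q_def])
    moreover have "basis_vector R q \<in> {\<phi> \<in> carrier (res0 R Q). T.germ_of (\<lambda>m. \<Xi> m \<phi>) (presentation R Q \<phi>)}"
      if "q \<in> carrier Q" for q
      using that pres(3,4) b by (simp add: Xi_basis)
    ultimately show ?thesis using T.R.free_module_subset that unfolding res0_def by blast
  qed
  \<comment> \<open>The element of \<open>C\<close> that an eventually constant sequence stands for.\<close>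
  define lim where "lim \<xi> = (THE v. \<exists>k. \<forall>m \<ge> k. \<xi> m = v)" for \<xi> :: "nat \<Rightarrow> 'c"
  have lim_eq: "lim \<xi> = v" if "\<And>m. m \<ge> k \<Longrightarrow> \<xi> m = v" for \<xi> v k
    unfolding lim_def
  proof (rule the_equality)
    show "\<exists>k. \<forall>m \<ge> k. \<xi> m = v" using that by blast
    fix w assume "\<exists>k. \<forall>m \<ge> k. \<xi> m = w"
    then obtain l where "\<forall>m \<ge> l. \<xi> m = w" by blast
    then show "w = v" using that[of "max k l"] by (metis max.cobounded1 max.cobounded2)
  qed
  have lim: "\<exists>k. \<forall>m \<ge> k. \<xi> m = lim \<xi>" if "T.germ_of \<xi> \<zero>\<^bsub>Q\<^esub>" for \<xi>
    using T.germ_of_zero_const[OF that[unfolded Q_def]] lim_eq by metis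
  define f where "f \<phi> = lim (\<lambda>m. \<Xi> m \<phi>)" for \<phi>
  have f: "\<exists>k. \<forall>m \<ge> k. \<Xi> m \<phi> = f \<phi>" if "\<phi> \<in> syzygy1 R Q" for \<phi>
    unfolding f_def using Xi_germ[of \<phi>] that by (intro lim) (simp add: pres(6))
  note Kmem = P.submodule_mem[OF pres(5)]
  have "linear R ((res0 R Q)\<lparr>carrier := syzygy1 R Q\<rparr>) C f"
  proof (rule linearI, goal_cases)
    case (1 \<phi>)
    then obtain k where "\<Xi> k \<phi> = f \<phi>" using f by auto
    then show ?case using Xi_closed[of \<phi> k] Kmem(1) 1 by auto
  next
    case (2 \<phi> \<psi>)
    then obtain k l where k: "\<And>m. m \<ge> k \<Longrightarrow> \<Xi> m \<phi> = f \<phi>" "\<And>m. m \<ge> l \<Longrightarrow> \<Xi> m \<psi> = f \<psi>" using f[of \<phi>] f[of \<psi>] by auto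
    show ?case unfolding f_def[of "_ \<oplus>\<^bsub>_\<^esub> _"]
      by (rule lim_eq[of "max k l"]) (use 2 Kmem(1) k in \<open>simp add: linear_add[OF Xi]\<close>)
  next
    case (3 a \<phi>)
    then obtain k where k: "\<And>m. m \<ge> k \<Longrightarrow> \<Xi> m \<phi> = f \<phi>" using f[of \<phi>] by auto
    show ?case unfolding f_def[of "_ \<odot>\<^bsub>_\<^esub> _"]
      by (rule lim_eq[of k]) (use 3 Kmem(1) k in \<open>simp add: linear_smult[OF Xi]\<close>)
  qed
  then obtain g where g: "linear R (res0 R Q) C g" "\<And>k. k \<in> syzygy1 R Q \<Longrightarrow> g k = f k"
    using ext by blast
  define q where "q n = frac R T.denoms \<one>\<^bsub>R\<^esub> (tele R e n)" for n
  have q: "q n \<in> carrier Q" for n unfolding q_def Q_def by (rule T.frac_closed[OF T.R.one_closed T.tele_mem])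
  have q_step: "step R e n \<odot>\<^bsub>Q\<^esub> q (Suc n) = q n" for n
  proof -
    have "step R e n \<odot>\<^bsub>Q\<^esub> q (Suc n) = frac R T.denoms (step R e n) (tele R e (Suc n))"
      using T.te(2) unfolding q_def Q_def by (subst T.localization_smult[OF _ T.R.one_closed T.tele_mem]) auto
    also have "\<dots> = q n" unfolding q_def
      using T.te T.tele_mem T.tele_mem[of "Suc n", unfolded T.R.tele_Suc] submonoid.one_closed[OF T.denoms_submonoid]
      by (subst T.frac_eq_iff) (auto simp: T.R.tele_Suc simp del: tele.simps intro!: bexI[of _ "\<one>\<^bsub>R\<^esub>"])
    finally show ?thesis .
  qed
  define u where "u n = basis_vector R (q n)" for n
  have u: "u n \<in> carrier (res0 R Q)" for n unfolding u_def by (rule pres(3)[OF q])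
  have pu: "presentation R Q (u n) = q n" for n unfolding u_def by (rule pres(4)[OF q])
  \<comment> \<open>The element \<open>u\<^sub>n - b (q n)\<close> of the extension, which lies in \<open>C\<close>.\<close>
  define z where "z n m = T.acc n m \<oplus>\<^bsub>C\<^esub> (\<ominus>\<^bsub>R\<^esub> \<one>\<^bsub>R\<^esub>) \<odot>\<^bsub>C\<^esub> \<Xi> m (u n)" for n m
  have zlim: "\<exists>k. \<forall>m \<ge> k. z n m = lim (z n)" for n
  proof (rule lim)
    have "T.germ_of (\<lambda>m. \<Xi> m (u n)) (q n)" using Xi_germ[OF u[of n]] pu by simp
    then have "T.germ_of (z n) (q n \<oplus>\<^bsub>Q\<^esub> (\<ominus>\<^bsub>R\<^esub> \<one>\<^bsub>R\<^esub>) \<odot>\<^bsub>Q\<^esub> q n)"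
      using T.germ_of_add[OF T.germ_of_acc[of n, folded q_def] T.germ_of_smult[of _ "q n" "\<ominus>\<^bsub>R\<^esub> \<one>\<^bsub>R\<^esub>"]]
      unfolding z_def Q_def by auto
    also have "q n \<oplus>\<^bsub>Q\<^esub> (\<ominus>\<^bsub>R\<^esub> \<one>\<^bsub>R\<^esub>) \<odot>\<^bsub>Q\<^esub> q n = \<zero>\<^bsub>Q\<^esub>" using q[of n] by algebra
    finally show "T.germ_of (z n) \<zero>\<^bsub>Q\<^esub>" .
  qed
  define x where "x n = lim (z n) \<oplus>\<^bsub>C\<^esub> g (u n)" for n
  have gu: "g (u n) \<in> carrier C" for n by (rule linear_closed[OF g(1) u])
  have zc: "z n m \<in> carrier C" for n m unfolding z_def using T.acc_closed Xi_closed[OF u] by simp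
  have lc: "lim (z n) \<in> carrier C" for n using zlim[of n] zc by (metis order_refl)
  have "x n \<ominus>\<^bsub>C\<^esub> step R e n \<odot>\<^bsub>C\<^esub> x (Suc n) \<ominus>\<^bsub>C\<^esub> d n = \<zero>\<^bsub>C\<^esub>" for n
  proof -
    define k where "k = u n \<ominus>\<^bsub>res0 R Q\<^esub> step R e n \<odot>\<^bsub>res0 R Q\<^esub> u (Suc n)"
    have su: "step R e n \<odot>\<^bsub>res0 R Q\<^esub> u (Suc n) \<in> carrier (res0 R Q)" using u T.te(2) by simp
    have lin: "h k = h (u n) \<ominus>\<^bsub>C\<^esub> step R e n \<odot>\<^bsub>C\<^esub> h (u (Suc n))" if "linear R (res0 R Q) C h" for h
      unfolding k_def linear_diff[OF pres(1) C that u su] linear_smult[OF that T.te(2) u] ..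
    have k: "k \<in> syzygy1 R Q"
      using u su q unfolding pres(6) k_def linear_diff[OF pres(1) Q pres(2) u su] linear_smult[OF pres(2) T.te(2) u] pu q_step
      by (simp add: Q.diff_zero_iff)
    obtain l1 l2 l3 where l: "\<And>m. m \<ge> l1 \<Longrightarrow> \<Xi> m k = f k" "\<And>m. m \<ge> l2 \<Longrightarrow> z n m = lim (z n)"
      "\<And>m. m \<ge> l3 \<Longrightarrow> z (Suc n) m = lim (z (Suc n))"
      using f[OF k] zlim[of n] zlim[of "Suc n"] by blast
    define m where "m = Suc (n + l1 + l2 + l3)"
    have e1: "g (u n) \<ominus>\<^bsub>C\<^esub> step R e n \<odot>\<^bsub>C\<^esub> g (u (Suc n)) = \<Xi> m (u n) \<ominus>\<^bsub>C\<^esub> step R e n \<odot>\<^bsub>C\<^esub> \<Xi> m (u (Suc n))"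
      unfolding lin[OF g(1), symmetric] lin[OF Xi, symmetric] using g(2)[OF k] l(1)[of m] by (simp add: m_def)
    have xn: "x n = z n m \<oplus>\<^bsub>C\<^esub> g (u n)" "x (Suc n) = z (Suc n) m \<oplus>\<^bsub>C\<^esub> g (u (Suc n))"
      unfolding x_def using l(2,3)[of m] by (auto simp: m_def)
    have a: "T.acc n m = d n \<oplus>\<^bsub>C\<^esub> step R e n \<odot>\<^bsub>C\<^esub> T.acc (Suc n) m" by (rule T.acc_first) (simp add: m_def)
    note c = gu[of n] gu[of "Suc n"] Xi_closed[OF u, of m n] Xi_closed[OF u, of m "Suc n"] T.te(2)[of n] T.acc_closed[of "Suc n" m] T.d[of n]
    have "x n \<ominus>\<^bsub>C\<^esub> step R e n \<odot>\<^bsub>C\<^esub> x (Suc n) \<ominus>\<^bsub>C\<^esub> d n =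
      (g (u n) \<ominus>\<^bsub>C\<^esub> step R e n \<odot>\<^bsub>C\<^esub> g (u (Suc n))) \<ominus>\<^bsub>C\<^esub> (\<Xi> m (u n) \<ominus>\<^bsub>C\<^esub> step R e n \<odot>\<^bsub>C\<^esub> \<Xi> m (u (Suc n)))"
      unfolding xn z_def a using c by algebra
    also have "\<dots> = \<zero>\<^bsub>C\<^esub>" unfolding e1 using c by algebra
    finally show ?thesis .
  qed
  then show "\<exists>x. (\<forall>n. x n \<in> carrier C) \<and> (\<forall>n. x n \<ominus>\<^bsub>C\<^esub> step R e n \<odot>\<^bsub>C\<^esub> x (Suc n) \<ominus>\<^bsub>C\<^esub> d n \<in> {\<zero>\<^bsub>C\<^esub>})"
    using lc gu by (intro exI[of _ x]) (auto simp: x_def)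
qed

section \<open>Congruence modulo a submodule\<close>

definition cong_mod :: "('b, 'm) ring_scheme \<Rightarrow> 'b set \<Rightarrow> 'b \<Rightarrow> 'b \<Rightarrow> bool"
  where "cong_mod M Z x y \<longleftrightarrow> x \<in> carrier M \<and> y \<in> carrier M \<and> x \<ominus>\<^bsub>M\<^esub> y \<in> Z"

context module begin

lemma cong_mod_carrier: "cong_mod M Z x y \<Longrightarrow> x \<in> carrier M" "cong_mod M Z x y \<Longrightarrow> y \<in> carrier M"
  by (auto simp: cong_mod_def)

context
  fixes Z assumes Z: "submodule Z R M"
begin

lemma cong_mod_refl: "x \<in> carrier M \<Longrightarrow> cong_mod M Z x x"
  using submodule_mem(2)[OF Z] by (simp add: cong_mod_def M.minus_eq M.r_neg)

lemma cong_mod_sym: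
  assumes "cong_mod M Z x y" shows "cong_mod M Z y x"
proof -
  have c: "x \<in> carrier M" "y \<in> carrier M" "x \<ominus>\<^bsub>M\<^esub> y \<in> Z" using assms by (auto simp: cong_mod_def)
  have "y \<ominus>\<^bsub>M\<^esub> x = \<ominus>\<^bsub>M\<^esub> (x \<ominus>\<^bsub>M\<^esub> y)" using c(1,2) by algebra
  then show ?thesis using c submodule_mem(4)[OF Z c(3)] by (simp add: cong_mod_def)
qed

lemma cong_mod_add:
  assumes "cong_mod M Z x y" "cong_mod M Z x' y'" shows "cong_mod M Z (x \<oplus>\<^bsub>M\<^esub> x') (y \<oplus>\<^bsub>M\<^esub> y')"
proof -
  have c: "x \<in> carrier M" "y \<in> carrier M" "x' \<in> carrier M" "y' \<in> carrier M"
    and d: "x \<ominus>\<^bsub>M\<^esub> y \<in> Z" "x' \<ominus>\<^bsub>M\<^esub> y' \<in> Z" using assms by (auto simp: cong_mod_def)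
  have "(x \<oplus>\<^bsub>M\<^esub> x') \<ominus>\<^bsub>M\<^esub> (y \<oplus>\<^bsub>M\<^esub> y') = (x \<ominus>\<^bsub>M\<^esub> y) \<oplus>\<^bsub>M\<^esub> (x' \<ominus>\<^bsub>M\<^esub> y')" using c by algebra
  then show ?thesis using c submodule_mem(3)[OF Z d] by (simp add: cong_mod_def)
qed

lemma cong_mod_diff:
  assumes "cong_mod M Z x y" "cong_mod M Z x' y'" shows "cong_mod M Z (x \<ominus>\<^bsub>M\<^esub> x') (y \<ominus>\<^bsub>M\<^esub> y')"
proof -
  have c: "x \<in> carrier M" "y \<in> carrier M" "x' \<in> carrier M" "y' \<in> carrier M"
    and d: "x \<ominus>\<^bsub>M\<^esub> y \<in> Z" "x' \<ominus>\<^bsub>M\<^esub> y' \<in> Z" using assms by (auto simp: cong_mod_def)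
  have "(x \<ominus>\<^bsub>M\<^esub> x') \<ominus>\<^bsub>M\<^esub> (y \<ominus>\<^bsub>M\<^esub> y') = (x \<ominus>\<^bsub>M\<^esub> y) \<ominus>\<^bsub>M\<^esub> (x' \<ominus>\<^bsub>M\<^esub> y')" using c by algebra
  then show ?thesis using c submodule_mem(5)[OF Z d] by (simp add: cong_mod_def)
qed

lemma cong_mod_smult:
  assumes "a \<in> carrier R" "cong_mod M Z x y" shows "cong_mod M Z (a \<odot>\<^bsub>M\<^esub> x) (a \<odot>\<^bsub>M\<^esub> y)"
proof -
  have c: "x \<in> carrier M" "y \<in> carrier M" and d: "x \<ominus>\<^bsub>M\<^esub> y \<in> Z" using assms by (auto simp: cong_mod_def)
  have "a \<odot>\<^bsub>M\<^esub> x \<ominus>\<^bsub>M\<^esub> a \<odot>\<^bsub>M\<^esub> y = a \<odot>\<^bsub>M\<^esub> (x \<ominus>\<^bsub>M\<^esub> y)" using c assms(1) by algebra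
  then show ?thesis using c assms(1) submodule_mem(6)[OF Z assms(1) d] by (simp add: cong_mod_def)
qed

lemma cong_mod_trans:
  assumes "cong_mod M Z x y" "cong_mod M Z y z" shows "cong_mod M Z x z"
proof -
  have c: "x \<in> carrier M" "y \<in> carrier M" "z \<in> carrier M" 
    and d: "x \<ominus>\<^bsub>M\<^esub> y \<in> Z" "y \<ominus>\<^bsub>M\<^esub> z \<in> Z" using assms by (auto simp: cong_mod_def)
  have "x \<ominus>\<^bsub>M\<^esub> z = (x \<ominus>\<^bsub>M\<^esub> y) \<oplus>\<^bsub>M\<^esub> (y \<ominus>\<^bsub>M\<^esub> z)" using c by algebra
  then show ?thesis using c submodule_mem(3)[OF Z d] by (simp add: cong_mod_def)
qed

lemma cong_mod_zero_iff: "cong_mod M Z x \<zero>\<^bsub>M\<^esub> \<longleftrightarrow> x \<in> Z"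
proof -
  have "x \<ominus>\<^bsub>M\<^esub> \<zero>\<^bsub>M\<^esub> = x" if "x \<in> carrier M" using that by algebra
  then show ?thesis using submodule_mem(1)[OF Z] by (auto simp: cong_mod_def)
qed

lemma cong_mod_mem: "cong_mod M Z x y \<Longrightarrow> y \<in> Z \<Longrightarrow> x \<in> Z"
  using cong_mod_trans cong_mod_zero_iff by blast

end

lemma cong_mod_mono: "cong_mod M Z x y \<Longrightarrow> Z \<subseteq> Z' \<Longrightarrow> cong_mod M Z' x y"
  by (auto simp: cong_mod_def)

lemma cong_mod_member: "submodule H R M \<Longrightarrow> Z \<subseteq> H \<Longrightarrow> cong_mod M Z x y \<Longrightarrow> y \<in> H \<Longrightarrow> x \<in> H"
  using cong_mod_mono cong_mod_mem by blast

end

section \<open>Maps into subquotients of an ambient module\<close>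

definition pair_module :: "('a, 'p) module \<Rightarrow> ('a, 'c) module \<Rightarrow> ('a, 'p \<times> 'c) module"
  where "pair_module P C =
    \<lparr>carrier = carrier P \<times> carrier C, monoid.mult = undefined, one = undefined,
     ring.zero = (\<zero>\<^bsub>P\<^esub>, \<zero>\<^bsub>C\<^esub>),
     ring.add = (\<lambda>v w. (fst v \<oplus>\<^bsub>P\<^esub> fst w, snd v \<oplus>\<^bsub>C\<^esub> snd w)),
     smult = (\<lambda>a w. (a \<odot>\<^bsub>P\<^esub> fst w, a \<odot>\<^bsub>C\<^esub> snd w))\<rparr>"

lemma pair_module_sel:
  "carrier (pair_module P C) = carrier P \<times> carrier C"
  "\<zero>\<^bsub>pair_module P C\<^esub> = (\<zero>\<^bsub>P\<^esub>, \<zero>\<^bsub>C\<^esub>)"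
  "v \<oplus>\<^bsub>pair_module P C\<^esub> w = (fst v \<oplus>\<^bsub>P\<^esub> fst w, snd v \<oplus>\<^bsub>C\<^esub> snd w)"
  "a \<odot>\<^bsub>pair_module P C\<^esub> w = (a \<odot>\<^bsub>P\<^esub> fst w, a \<odot>\<^bsub>C\<^esub> snd w)"
  by (simp_all add: pair_module_def)

lemma pair_module_module:
  assumes "module R P" "module R C"
  shows "module R (pair_module P C)"
proof -
  interpret P: module R P by fact
  interpret C: module R C by fact
  show ?thesis
  proof (intro moduleI abelian_groupI P.R.is_cring)
    fix w assume "w \<in> carrier (pair_module P C)"
    then show "\<exists>v \<in> carrier (pair_module P C). v \<oplus>\<^bsub>pair_module P C\<^esub> w = \<zero>\<^bsub>pair_module P C\<^esub>"
      by (intro bexI[of _ "(\<ominus>\<^bsub>P\<^esub> fst w, \<ominus>\<^bsub>C\<^esub> snd w)"])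
         (auto simp: pair_module_sel P.l_neg C.l_neg)
  qed (auto simp: pair_module_sel P.a_ac C.a_ac P.smult_l_distr C.smult_l_distr
        P.smult_r_distr C.smult_r_distr P.smult_assoc1 C.smult_assoc1)
qed

lemma pair_module_diff:
  assumes P: "module R P" and C: "module R C" and "x \<in> carrier P" "x' \<in> carrier P" "y \<in> carrier C" "y' \<in> carrier C"
  shows "(x, y) \<ominus>\<^bsub>pair_module P C\<^esub> (x', y') = (x \<ominus>\<^bsub>P\<^esub> x', y \<ominus>\<^bsub>C\<^esub> y')"
proof -
  interpret P: module R P by (rule P)
  interpret C: module R C by (rule C)
  interpret Q: module R "pair_module P C" by (rule pair_module_module[OF P C])
  have "(x', y') \<in> carrier (pair_module P C)" using assms by (simp add: pair_module_sel)
  then have "(x, y) \<ominus>\<^bsub>pair_module P C\<^esub> (x', y') = (x, y) \<oplus>\<^bsub>pair_module P C\<^esub> (\<ominus>\<^bsub>R\<^esub> \<one>\<^bsub>R\<^esub>) \<odot>\<^bsub>pair_module P C\<^esub> (x', y')"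
    by (simp add: Q.smult_l_minus Q.minus_eq)
  also have "\<dots> = (x \<ominus>\<^bsub>P\<^esub> x', y \<ominus>\<^bsub>C\<^esub> y')"
    using assms by (simp add: pair_module_sel P.smult_l_minus C.smult_l_minus P.minus_eq C.minus_eq)
  finally show ?thesis .
qed

definition function_module :: "('a, 'p) module \<Rightarrow> ('a, 'i \<Rightarrow> 'p) module"
  where "function_module N =
    \<lparr>carrier = {w. \<forall>l. w l \<in> carrier N}, monoid.mult = undefined, one = undefined,
     ring.zero = (\<lambda>l. \<zero>\<^bsub>N\<^esub>), ring.add = (\<lambda>v w l. v l \<oplus>\<^bsub>N\<^esub> w l), smult = (\<lambda>a w l. a \<odot>\<^bsub>N\<^esub> w l)\<rparr>"

lemma function_module_module:
  assumes "module R N"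
  shows "module R (function_module N)"
proof -
  interpret N: module R N by fact
  show ?thesis
  proof (intro moduleI abelian_groupI N.R.is_cring)
    fix w assume "w \<in> carrier (function_module N)"
    then show "\<exists>v \<in> carrier (function_module N). v \<oplus>\<^bsub>function_module N\<^esub> w = \<zero>\<^bsub>function_module N\<^esub>"
      by (intro bexI[of _ "\<lambda>l. \<ominus>\<^bsub>N\<^esub> w l"]) (auto simp: function_module_def N.l_neg)
  qed (auto simp: function_module_def fun_eq_iff N.a_ac N.smult_l_distr N.smult_r_distr N.smult_assoc1)
qed

text \<open>
  The free module \<open>P\<close> on \<open>B\<close> and its submodule \<open>K\<close> are as in Villamayor's criterion. The maps \<open>\<delta> n\<close> decode
  every element of \<open>M\<close> into a sequence in the direct sum of \<open>P\<close> and \<open>M\<close>, and by \<open>decode\<close> every sequence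
  occurs. Hence the module of sequences in a submodule of this direct sum is again a subquotient of \<open>M\<close>, so
  the class of subquotients of \<open>M\<close> is closed under the constructions of the induction.
\<close>

locale ambient = module R M for R :: "('a, 'r) ring_scheme" and M :: "('a, 'm) module" +
  fixes B :: "'x set" and K :: "('x \<Rightarrow> 'a) set" and \<delta> :: "nat \<Rightarrow> 'm \<Rightarrow> ('x \<Rightarrow> 'a) \<times> 'm"
  assumes K: "submodule K R (free_module R B)"
    and retract: "\<And>A. finite A \<Longrightarrow> A \<subseteq> K \<Longrightarrow> \<exists>\<theta>. retracts R (free_module R B) K A \<theta>"
    and \<delta>: "\<And>n. linear R M (pair_module (free_module R B) M) (\<delta> n)"
    and decode: "\<And>q. (\<And>n. q n \<in> carrier (pair_module (free_module R B) M)) \<Longrightarrow> \<exists>w \<in> carrier M. \<forall>n. \<delta> n w = q n"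
begin

abbreviation P where "P \<equiv> free_module R B"
abbreviation PM where "PM \<equiv> pair_module P M"

sublocale P: module R P by (rule R.free_module_module)
sublocale PM: module R PM by (rule pair_module_module[OF R.free_module_module module_axioms])

lemmas M_module = module_axioms
lemmas K_mem = P.submodule_mem[OF K]

definition subquotient :: "'m set \<Rightarrow> 'm set \<Rightarrow> bool" where
  "subquotient H Z \<longleftrightarrow> submodule H R M \<and> submodule Z R M \<and> Z \<subseteq> H"

text \<open>A linear map from \<open>K\<close> to the quotient of \<open>H\<close> by \<open>Z\<close> is given by representatives of its values,
  which need not depend linearly on the argument. A linear map on \<open>P\<close> lifts to a linear map to \<open>H\<close>.\<close>

definition quasilinear :: "'m set \<Rightarrow> 'm set \<Rightarrow> (('x \<Rightarrow> 'a) \<Rightarrow> 'm) \<Rightarrow> bool" where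
  "quasilinear H Z f \<longleftrightarrow> (\<forall>k \<in> K. f k \<in> H) \<and>
    (\<forall>k \<in> K. \<forall>k' \<in> K. cong_mod M Z (f (k \<oplus>\<^bsub>P\<^esub> k')) (f k \<oplus>\<^bsub>M\<^esub> f k')) \<and>
    (\<forall>a \<in> carrier R. \<forall>k \<in> K. cong_mod M Z (f (a \<odot>\<^bsub>P\<^esub> k)) (a \<odot>\<^bsub>M\<^esub> f k))"

definition extensible :: "'m set \<Rightarrow> 'm set \<Rightarrow> bool" where
  "extensible H Z \<longleftrightarrow> (\<forall>f. quasilinear H Z f \<longrightarrow>
    (\<exists>g. linear R P M g \<and> (\<forall>y \<in> carrier P. g y \<in> H) \<and> (\<forall>k \<in> K. cong_mod M Z (f k) (g k))))"

definition annihilator :: "'m set \<Rightarrow> 'm set \<Rightarrow> 'a set" where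
  "annihilator H Z = {r \<in> carrier R. \<forall>h \<in> H. r \<odot>\<^bsub>M\<^esub> h \<in> Z}"

text \<open>The submodule \<open>a D\<close> of \<open>D = H/Z\<close>.\<close>

definition multiples :: "'a \<Rightarrow> 'm set \<Rightarrow> 'm set \<Rightarrow> 'm set" where
  "multiples a H Z = {y \<in> carrier M. \<exists>h \<in> H. cong_mod M Z y (a \<odot>\<^bsub>M\<^esub> h)}"

lemma quasilinearD:
  assumes "quasilinear H Z f"
  shows "k \<in> K \<Longrightarrow> f k \<in> H"
    "k \<in> K \<Longrightarrow> k' \<in> K \<Longrightarrow> cong_mod M Z (f (k \<oplus>\<^bsub>P\<^esub> k')) (f k \<oplus>\<^bsub>M\<^esub> f k')"
    "a \<in> carrier R \<Longrightarrow> k \<in> K \<Longrightarrow> cong_mod M Z (f (a \<odot>\<^bsub>P\<^esub> k)) (a \<odot>\<^bsub>M\<^esub> f k)"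
  using assms by (auto simp: quasilinear_def)

lemma subquotientD:
  assumes "subquotient H Z"
  shows "submodule H R M" "submodule Z R M" "Z \<subseteq> H" "h \<in> H \<Longrightarrow> h \<in> carrier M" "z \<in> Z \<Longrightarrow> z \<in> carrier M"
  using assms submodule_subset by (auto simp: subquotient_def)

lemma quasilinear_zero:
  assumes "subquotient H Z" "quasilinear H Z f" shows "f \<zero>\<^bsub>P\<^esub> \<in> Z"
proof -
  have "cong_mod M Z (f (\<zero>\<^bsub>R\<^esub> \<odot>\<^bsub>P\<^esub> \<zero>\<^bsub>P\<^esub>)) (\<zero>\<^bsub>R\<^esub> \<odot>\<^bsub>M\<^esub> f \<zero>\<^bsub>P\<^esub>)"
    by (rule quasilinearD(3)[OF assms(2) R.zero_closed K_mem(2)])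
  then show ?thesis
    using quasilinearD(1)[OF assms(2) K_mem(2)] subquotientD[OF assms(1)] by (simp add: cong_mod_zero_iff)
qed

lemma quasilinear_diff:
  assumes s: "subquotient H Z" and q: "quasilinear H Z f" and k: "k \<in> K" "k' \<in> K"
  shows "cong_mod M Z (f (k \<ominus>\<^bsub>P\<^esub> k')) (f k \<ominus>\<^bsub>M\<^esub> f k')"
proof -
  note sD = subquotientD[OF s]
  have c: "f (k \<ominus>\<^bsub>P\<^esub> k') \<in> carrier M" "f k' \<in> carrier M" "f k \<in> carrier M"
    using quasilinearD(1)[OF q] K_mem k sD(4) by auto
  have "cong_mod M Z (f ((k \<ominus>\<^bsub>P\<^esub> k') \<oplus>\<^bsub>P\<^esub> k')) (f (k \<ominus>\<^bsub>P\<^esub> k') \<oplus>\<^bsub>M\<^esub> f k')"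
    using q K_mem(5) k by (intro quasilinearD(2)) auto
  moreover have "(k \<ominus>\<^bsub>P\<^esub> k') \<oplus>\<^bsub>P\<^esub> k' = k" using k[THEN K_mem(1)] by algebra
  ultimately have "cong_mod M Z (f (k \<ominus>\<^bsub>P\<^esub> k') \<oplus>\<^bsub>M\<^esub> f k') (f k)" using cong_mod_sym[OF sD(2)] by simp
  from cong_mod_diff[OF sD(2) this cong_mod_refl[OF sD(2) c(2)]]
  show ?thesis
  proof -
    have "f (k \<ominus>\<^bsub>P\<^esub> k') \<oplus>\<^bsub>M\<^esub> f k' \<ominus>\<^bsub>M\<^esub> f k' = f (k \<ominus>\<^bsub>P\<^esub> k')" using c(1,2) by algebra
    then show "cong_mod M Z (f (k \<ominus>\<^bsub>P\<^esub> k') \<oplus>\<^bsub>M\<^esub> f k' \<ominus>\<^bsub>M\<^esub> f k') (f k \<ominus>\<^bsub>M\<^esub> f k') \<Longrightarrow> ?thesis" by simp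
  qed
qed

lemma annihilator_ideal:
  assumes "subquotient H Z"
  shows "ideal (annihilator H Z) R"
proof -
  note s = subquotientD[OF assms] note Zm = submodule_mem[OF s(2)] note Hm = submodule_mem[OF s(1)]
  have "additive_subgroup (annihilator H Z) R"
  proof (intro additive_subgroup.intro R.add.subgroupI)
    show "annihilator H Z \<subseteq> carrier R" by (auto simp: annihilator_def)
    have "\<zero>\<^bsub>R\<^esub> \<in> annihilator H Z" using s Zm(2) by (auto simp: annihilator_def)
    then show "annihilator H Z \<noteq> {}" by blast
  qed (use s Zm in \<open>auto simp: annihilator_def smult_l_minus smult_l_distr\<close>)
  then show ?thesis
  proof (intro idealI R.ring_axioms, goal_cases)
    case 1 then show ?case by (rule additive_subgroup.a_subgroup)
  next
    case (2 a x)
    then show ?case using s Zm(6) by (auto simp: annihilator_def smult_assoc1)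
  next
    case (3 a x)
    then show ?case using s Hm(6) by (auto simp: annihilator_def smult_assoc1)
  qed
qed

lemma multiples_subquotient:
  assumes s: "subquotient H Z" and a: "a \<in> carrier R"
  shows "subquotient H (multiples a H Z)" "subquotient (multiples a H Z) Z"
proof -
  note sD = subquotientD[OF s] note Hm = submodule_mem[OF sD(1)]
  have sub: "submodule (multiples a H Z) R M"
  proof (rule submodule_of_scalar_closed)
    show "multiples a H Z \<subseteq> carrier M" by (auto simp: multiples_def)
    show "\<zero>\<^bsub>M\<^esub> \<in> multiples a H Z"
      using Hm(2) a cong_mod_refl[OF sD(2) M.zero_closed] by (auto simp: multiples_def intro!: bexI[of _ "\<zero>\<^bsub>M\<^esub>"])
  next
    fix x y assume "x \<in> multiples a H Z" "y \<in> multiples a H Z"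
    then obtain h h' where h: "h \<in> H" "cong_mod M Z x (a \<odot>\<^bsub>M\<^esub> h)" "h' \<in> H" "cong_mod M Z y (a \<odot>\<^bsub>M\<^esub> h')"
      by (auto simp: multiples_def)
    have "cong_mod M Z (x \<oplus>\<^bsub>M\<^esub> y) (a \<odot>\<^bsub>M\<^esub> (h \<oplus>\<^bsub>M\<^esub> h'))"
      using cong_mod_add[OF sD(2) h(2,4)] a h sD(4) by (simp add: smult_r_distr)
    then show "x \<oplus>\<^bsub>M\<^esub> y \<in> multiples a H Z" using Hm(3)[OF h(1,3)] cong_mod_carrier by (auto simp: multiples_def)
  next
    fix b x assume b: "b \<in> carrier R" and "x \<in> multiples a H Z"
    then obtain h where h: "h \<in> H" "cong_mod M Z x (a \<odot>\<^bsub>M\<^esub> h)" by (auto simp: multiples_def)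
    have "cong_mod M Z (b \<odot>\<^bsub>M\<^esub> x) (a \<odot>\<^bsub>M\<^esub> (b \<odot>\<^bsub>M\<^esub> h))"
      using cong_mod_smult[OF sD(2) b h(2)] a b h sD(4) by (simp add: smult_assoc1[symmetric] R.m_comm)
    then show "b \<odot>\<^bsub>M\<^esub> x \<in> multiples a H Z" using Hm(6)[OF b h(1)] cong_mod_carrier by (auto simp: multiples_def)
  qed
  have "multiples a H Z \<subseteq> H"
    using cong_mod_member[OF sD(1,3)] Hm(6)[OF a] by (auto simp: multiples_def)
  then show "subquotient H (multiples a H Z)" using sub sD(1) by (simp add: subquotient_def)
  have "Z \<subseteq> multiples a H Z"
    using cong_mod_zero_iff[OF sD(2)] sD(5) a Hm(2) by (auto simp: multiples_def intro!: bexI[of _ "\<zero>\<^bsub>M\<^esub>"])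
  then show "subquotient (multiples a H Z) Z" using sub sD(2) by (simp add: subquotient_def)
qed

lemma telescopingD:
  assumes "telescoping R M H Z" "subquotient H Z" "\<And>n. e n \<in> carrier R" "\<And>n. d n \<in> H"
  shows "\<exists>x. (\<forall>n. x n \<in> H) \<and> (\<forall>n. cong_mod M Z (x n \<ominus>\<^bsub>M\<^esub> step R e n \<odot>\<^bsub>M\<^esub> x (Suc n)) (d n))"
proof -
  have st: "step R e n \<in> carrier R" for n by (rule R.tele_closed(2)[OF assms(3)])
  obtain x where x: "\<And>n. x n \<in> H" "\<And>n. x n \<ominus>\<^bsub>M\<^esub> step R e n \<odot>\<^bsub>M\<^esub> x (Suc n) \<ominus>\<^bsub>M\<^esub> d n \<in> Z"
    using assms(1)[unfolded telescoping_def, rule_format, of e d] assms(3,4) by blast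
  then show ?thesis using assms(4) subquotientD(4)[OF assms(2)] st by (intro exI[of _ x]) (auto simp: cong_mod_def)
qed

lemma telescopingI:
  assumes "\<And>s e d. (\<And>n. e n \<in> carrier R) \<Longrightarrow> (\<And>n. s n \<in> carrier R) \<Longrightarrow> s = step R e \<Longrightarrow> (\<And>n. d n \<in> H) \<Longrightarrow>
    \<exists>x. (\<forall>n. x n \<in> H) \<and> (\<forall>n. cong_mod M Z (x n \<ominus>\<^bsub>M\<^esub> s n \<odot>\<^bsub>M\<^esub> x (Suc n)) (d n))"
  shows "telescoping R M H Z"
  unfolding telescoping_def
proof (intro allI impI)
  fix e :: "nat \<Rightarrow> 'a" and d :: "nat \<Rightarrow> 'm" assume ed: "\<forall>n. e n \<in> carrier R" "\<forall>n. d n \<in> H"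
  have "step R e n \<in> carrier R" for n using R.tele_closed(2)[of e] ed by blast
  then obtain x where "\<forall>n. x n \<in> H" "\<forall>n. cong_mod M Z (x n \<ominus>\<^bsub>M\<^esub> step R e n \<odot>\<^bsub>M\<^esub> x (Suc n)) (d n)"
    using assms[of e "step R e" d] ed by blast
  then show "\<exists>x. (\<forall>n. x n \<in> H) \<and> (\<forall>n. x n \<ominus>\<^bsub>M\<^esub> step R e n \<odot>\<^bsub>M\<^esub> x (Suc n) \<ominus>\<^bsub>M\<^esub> d n \<in> Z)"
    by (auto simp: cong_mod_def)
qed

lemma telescoping_multiples:
  assumes s: "subquotient H Z" and t: "telescoping R M H Z" and a: "a \<in> carrier R"
  shows "telescoping R M H (multiples a H Z)" "telescoping R M (multiples a H Z) Z"
proof -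
  note sD = subquotientD[OF s]
  show "telescoping R M H (multiples a H Z)"
    using t subquotientD(3)[OF multiples_subquotient(2)[OF s a]] unfolding telescoping_def by (meson subsetD)
  show "telescoping R M (multiples a H Z) Z"
  proof (rule telescopingI)
    fix c e :: "nat \<Rightarrow> 'a" and d :: "nat \<Rightarrow> 'm" assume e: "\<And>n. e n \<in> carrier R" "\<And>n. c n \<in> carrier R" "c = step R e" and d: "\<And>n. d n \<in> multiples a H Z"
    have "\<exists>h. \<forall>n :: nat. h n \<in> H \<and> cong_mod M Z (d n) (a \<odot>\<^bsub>M\<^esub> h n)"
      using d by (intro choice) (auto simp: multiples_def)
    then obtain h where h: "\<And>n. h n \<in> H" "\<And>n. cong_mod M Z (d n) (a \<odot>\<^bsub>M\<^esub> h n)" by blast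
    obtain x where x: "\<And>n. x n \<in> H" "\<And>n. cong_mod M Z (x n \<ominus>\<^bsub>M\<^esub> c n \<odot>\<^bsub>M\<^esub> x (Suc n)) (h n)"
      using telescopingD[OF t s, of e h] e(1,3) h(1) by blast
    have "cong_mod M Z (a \<odot>\<^bsub>M\<^esub> x n \<ominus>\<^bsub>M\<^esub> c n \<odot>\<^bsub>M\<^esub> (a \<odot>\<^bsub>M\<^esub> x (Suc n))) (d n)" for n
    proof -
      have "a \<odot>\<^bsub>M\<^esub> x n \<ominus>\<^bsub>M\<^esub> c n \<odot>\<^bsub>M\<^esub> (a \<odot>\<^bsub>M\<^esub> x (Suc n)) = a \<odot>\<^bsub>M\<^esub> (x n \<ominus>\<^bsub>M\<^esub> c n \<odot>\<^bsub>M\<^esub> x (Suc n))"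
        using a e(2)[of n] x(1)[of n, THEN sD(4)] x(1)[of "Suc n", THEN sD(4)] by algebra
      then show ?thesis
        using cong_mod_trans[OF sD(2) cong_mod_smult[OF sD(2) a x(2)] cong_mod_sym[OF sD(2) h(2)]] by simp
    qed
    moreover have "a \<odot>\<^bsub>M\<^esub> x n \<in> multiples a H Z" for n
      using x(1)[of n] sD(4) a cong_mod_refl[OF sD(2), of "a \<odot>\<^bsub>M\<^esub> x n"] by (auto simp: multiples_def)
    ultimately show "\<exists>x. (\<forall>n. x n \<in> multiples a H Z) \<and> (\<forall>n. cong_mod M Z (x n \<ominus>\<^bsub>M\<^esub> c n \<odot>\<^bsub>M\<^esub> x (Suc n)) (d n))"
      by (intro exI[of _ "\<lambda>n. a \<odot>\<^bsub>M\<^esub> x n"]) blast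
  qed
qed

lemma quasilinear_diff_linear:
  assumes s: "subquotient H Z" and f: "quasilinear H Z f" and g: "linear R P M g" "\<And>y. y \<in> carrier P \<Longrightarrow> g y \<in> H"
  shows "quasilinear H Z (\<lambda>k. f k \<ominus>\<^bsub>M\<^esub> g k)"
proof -
  note sD = subquotientD[OF s]
  note fc = quasilinearD(1)[OF f, THEN sD(4)]
  note gc = linear_closed[OF g(1) K_mem(1)]
  show ?thesis
    unfolding quasilinear_def
  proof (intro conjI ballI)
    fix k k' assume k: "k \<in> K" "k' \<in> K"
    have "cong_mod M Z (f (k \<oplus>\<^bsub>P\<^esub> k') \<ominus>\<^bsub>M\<^esub> g (k \<oplus>\<^bsub>P\<^esub> k')) ((f k \<oplus>\<^bsub>M\<^esub> f k') \<ominus>\<^bsub>M\<^esub> (g k \<oplus>\<^bsub>M\<^esub> g k'))"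
      using linear_add[OF g(1) k[THEN K_mem(1)]] gc k cong_mod_diff[OF sD(2) quasilinearD(2)[OF f k] cong_mod_refl[OF sD(2)]] by simp
    also have "(f k \<oplus>\<^bsub>M\<^esub> f k') \<ominus>\<^bsub>M\<^esub> (g k \<oplus>\<^bsub>M\<^esub> g k') = f k \<ominus>\<^bsub>M\<^esub> g k \<oplus>\<^bsub>M\<^esub> (f k' \<ominus>\<^bsub>M\<^esub> g k')"
      using fc[OF k(1)] fc[OF k(2)] gc[OF k(1)] gc[OF k(2)] by algebra
    finally show "cong_mod M Z (f (k \<oplus>\<^bsub>P\<^esub> k') \<ominus>\<^bsub>M\<^esub> g (k \<oplus>\<^bsub>P\<^esub> k')) (f k \<ominus>\<^bsub>M\<^esub> g k \<oplus>\<^bsub>M\<^esub> (f k' \<ominus>\<^bsub>M\<^esub> g k'))" .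
  next
    fix a k assume k: "a \<in> carrier R" "k \<in> K"
    have "cong_mod M Z (f (a \<odot>\<^bsub>P\<^esub> k) \<ominus>\<^bsub>M\<^esub> g (a \<odot>\<^bsub>P\<^esub> k)) (a \<odot>\<^bsub>M\<^esub> f k \<ominus>\<^bsub>M\<^esub> a \<odot>\<^bsub>M\<^esub> g k)"
      using linear_smult[OF g(1) k(1) k(2)[THEN K_mem(1)]] gc k cong_mod_diff[OF sD(2) quasilinearD(3)[OF f k] cong_mod_refl[OF sD(2)]] by simp
    also have "a \<odot>\<^bsub>M\<^esub> f k \<ominus>\<^bsub>M\<^esub> a \<odot>\<^bsub>M\<^esub> g k = a \<odot>\<^bsub>M\<^esub> (f k \<ominus>\<^bsub>M\<^esub> g k)"
      using fc[OF k(2)] gc[OF k(2)] k(1) by algebra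
    finally show "cong_mod M Z (f (a \<odot>\<^bsub>P\<^esub> k) \<ominus>\<^bsub>M\<^esub> g (a \<odot>\<^bsub>P\<^esub> k)) (a \<odot>\<^bsub>M\<^esub> (f k \<ominus>\<^bsub>M\<^esub> g k))" .
  qed (use submodule_mem(5)[OF sD(1)] quasilinearD(1)[OF f] g(2) K_mem(1) in blast)
qed

text \<open>The class of modules with vanishing first Ext group is closed under extensions: first extend the map
  modulo \<open>Z1\<close>, then what remains takes values in \<open>Z1\<close>.\<close>

lemma extensible_devissage:
  assumes s: "subquotient H Z1" "subquotient Z1 Z" and e: "extensible H Z1" "extensible Z1 Z"
  shows "extensible H Z"
  unfolding extensible_def
proof (intro allI impI)
  fix f assume f: "quasilinear H Z f"
  note sD = subquotientD[OF s(1)] subquotientD[OF s(2)]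
  note Zm = submodule_mem[OF sD(7)]
  have "quasilinear H Z1 f" using f sD(8) cong_mod_mono unfolding quasilinear_def by blast
  then obtain g where g: "linear R P M g" "\<And>y. y \<in> carrier P \<Longrightarrow> g y \<in> H" "\<And>k. k \<in> K \<Longrightarrow> cong_mod M Z1 (f k) (g k)"
    using e(1) unfolding extensible_def by blast
  note gc = linear_closed[OF g(1) K_mem(1)]
  note fc = quasilinearD(1)[OF f, THEN sD(4)]
  have "subquotient H Z" using s by (auto simp: subquotient_def)
  from quasilinear_diff_linear[OF this f g(1,2)]
  have "quasilinear Z1 Z (\<lambda>k. f k \<ominus>\<^bsub>M\<^esub> g k)"
    using g(3) unfolding quasilinear_def cong_mod_def by blast
  then obtain h where h: "linear R P M h" "\<And>y. y \<in> carrier P \<Longrightarrow> h y \<in> Z1" "\<And>k. k \<in> K \<Longrightarrow> cong_mod M Z (f k \<ominus>\<^bsub>M\<^esub> g k) (h k)"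
    using e(2) unfolding extensible_def by blast
  show "\<exists>g. linear R P M g \<and> (\<forall>y \<in> carrier P. g y \<in> H) \<and> (\<forall>k \<in> K. cong_mod M Z (f k) (g k))"
  proof (intro exI conjI ballI)
    show "linear R P M (\<lambda>y. g y \<oplus>\<^bsub>M\<^esub> h y)" by (rule linear_add_maps[OF M_module g(1) h(1)])
    show "g y \<oplus>\<^bsub>M\<^esub> h y \<in> H" if "y \<in> carrier P" for y
      using submodule_mem(3)[OF sD(1)] g(2) h(2) sD(3) that by blast
    fix k assume k: "k \<in> K"
    have "f k = g k \<oplus>\<^bsub>M\<^esub> (f k \<ominus>\<^bsub>M\<^esub> g k)" using fc[OF k] gc[OF k] by algebra
    also have "cong_mod M Z \<dots> (g k \<oplus>\<^bsub>M\<^esub> h k)" by (rule cong_mod_add[OF sD(7) cong_mod_refl[OF sD(7) gc[OF k]] h(3)[OF k]])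
    finally show "cong_mod M Z (f k) (g k \<oplus>\<^bsub>M\<^esub> h k)" .
  qed
qed

lemma quasilinear_retract:
  assumes s: "subquotient H Z" and f: "quasilinear H Z f" and th: "linear R P P \<theta>" "\<And>y. y \<in> carrier P \<Longrightarrow> \<theta> y \<in> K"
    and g: "linear R P M g" and bas: "\<And>b. b \<in> B \<Longrightarrow> cong_mod M Z (f (\<theta> (basis_vector R b))) (g (basis_vector R b))"
    and y: "y \<in> carrier P"
  shows "cong_mod M Z (f (\<theta> y)) (g y)"
proof -
  note sD = subquotientD[OF s]
  have "submodule {y \<in> carrier P. cong_mod M Z (f (\<theta> y)) (g y)} R P"
  proof (rule P.submodule_of_scalar_closed)
    have "\<theta> \<zero>\<^bsub>P\<^esub> = \<zero>\<^bsub>P\<^esub>" "g \<zero>\<^bsub>P\<^esub> = \<zero>\<^bsub>M\<^esub>"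
      using linear_zero[OF P.module_axioms P.module_axioms th(1)] linear_zero[OF P.module_axioms M_module g] by auto
    then show "\<zero>\<^bsub>P\<^esub> \<in> {y \<in> carrier P. cong_mod M Z (f (\<theta> y)) (g y)}"
      using quasilinear_zero[OF s f] cong_mod_zero_iff[OF sD(2)] by simp
  next
    fix x y assume "x \<in> {y \<in> carrier P. cong_mod M Z (f (\<theta> y)) (g y)}" "y \<in> {y \<in> carrier P. cong_mod M Z (f (\<theta> y)) (g y)}"
    then have h: "x \<in> carrier P" "y \<in> carrier P" "cong_mod M Z (f (\<theta> x)) (g x)" "cong_mod M Z (f (\<theta> y)) (g y)" by auto
    have "cong_mod M Z (f (\<theta> x \<oplus>\<^bsub>P\<^esub> \<theta> y)) (g x \<oplus>\<^bsub>M\<^esub> g y)"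
      using quasilinearD(2)[OF f th(2) th(2)] cong_mod_add[OF sD(2) h(3,4)] cong_mod_trans[OF sD(2)] h(1,2) by blast
    then show "x \<oplus>\<^bsub>P\<^esub> y \<in> {y \<in> carrier P. cong_mod M Z (f (\<theta> y)) (g y)}"
      using h by (simp add: linear_add[OF th(1)] linear_add[OF g])
  next
    fix a x assume a: "a \<in> carrier R" and "x \<in> {y \<in> carrier P. cong_mod M Z (f (\<theta> y)) (g y)}"
    then have h: "x \<in> carrier P" "cong_mod M Z (f (\<theta> x)) (g x)" by auto
    have "cong_mod M Z (f (a \<odot>\<^bsub>P\<^esub> \<theta> x)) (a \<odot>\<^bsub>M\<^esub> g x)"
      using quasilinearD(3)[OF f a th(2)] cong_mod_smult[OF sD(2) a h(2)] cong_mod_trans[OF sD(2)] h(1) by blast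
    then show "a \<odot>\<^bsub>P\<^esub> x \<in> {y \<in> carrier P. cong_mod M Z (f (\<theta> y)) (g y)}"
      using h a by (simp add: linear_smult[OF th(1)] linear_smult[OF g])
  qed auto
  moreover have "basis_vector R b \<in> {y \<in> carrier P. cong_mod M Z (f (\<theta> y)) (g y)}" if "b \<in> B" for b
    using that bas by (simp add: R.basis_vector_closed)
  ultimately show ?thesis using R.free_module_subset y by blast
qed

lemma linear_map_from_basis:
  assumes gH: "\<And>b. b \<in> B \<Longrightarrow> g b \<in> H" and H: "submodule H R M"
  shows "\<exists>h. linear R P M h \<and> (\<forall>y \<in> carrier P. h y \<in> H) \<and> (\<forall>b \<in> B. h (basis_vector R b) = g b)"
proof -
  have g: "g \<in> B \<rightarrow> carrier M" using gH submodule_mem(1)[OF H] by blast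
  note l = R.linear_extension_linear[OF M_module g]
  note b = R.linear_extension_basis[OF M_module g]
  show ?thesis
    using l b R.linear_into_submodule[OF M_module l H] gH by (intro exI[of _ "linear_extension R B M g"]) auto
qed

text \<open>An element of \<open>K\<close> with coordinates in the annihilator \<open>p\<close> lies in \<open>p K\<close>, by flatness: if \<open>\<theta>\<close> maps
  \<open>P\<close> to \<open>K\<close> and fixes \<open>y\<close>, then \<open>y\<close> is the combination of the images of the basis vectors
  with the coordinates of \<open>y\<close> as coefficients.\<close>

lemma quasilinear_coordinates:
  assumes s: "subquotient H Z" and f: "quasilinear H Z f" and y: "y \<in> K" "\<And>b. y b \<in> annihilator H Z"
  shows "f y \<in> Z"
proof -
  note sD = subquotientD[OF s]
  have yP: "y \<in> carrier P" by (rule K_mem(1)[OF y(1)])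
  obtain \<theta> where "retracts R P K {y} \<theta>" using retract[of "{y}"] y by auto
  then have th: "linear R P P \<theta>" "\<And>y. y \<in> carrier P \<Longrightarrow> \<theta> y \<in> K" "\<theta> y = y" by (auto simp: retracts_def)
  define g where "g b = f (\<theta> (basis_vector R b))" for b
  have gH: "g b \<in> H" if "b \<in> B" for b
    unfolding g_def using that by (intro quasilinearD(1)[OF f] th(2) R.basis_vector_closed)
  then have gM: "g \<in> B \<rightarrow> carrier M" using sD(4) by auto
  have "cong_mod M Z (f (\<theta> y)) (linear_extension R B M g y)"
    using gH sD(4) cong_mod_refl[OF sD(2)]
    by (intro quasilinear_retract[OF s f th(1,2) R.linear_extension_linear[OF M_module gM] _ yP])
       (auto simp: R.linear_extension_basis[OF M_module gM] g_def[symmetric])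
  moreover have "linear_extension R B M g y \<in> Z"
  proof -
    note sup = R.free_module_coord(2,3)[OF yP]
    show ?thesis
      unfolding R.linear_extension_eq[OF M_module gM yP sup(1) order.refl sup(2)]
      using sup(2) y(2) gH by (intro submodule_finsum[OF sD(2)]) (auto simp: annihilator_def)
  qed
  ultimately show ?thesis using cong_mod_mem[OF sD(2)] th(3) by simp
qed

section \<open>Reduced powers and division by a ring element\<close>

text \<open>
  The module of all sequences in \<open>Y\<close>, and its submodule of those sequences that modulo \<open>W\<close> are eventually
  constant with value in \<open>A\<close>. The quotient is the reduced power of \<open>Y/W\<close> modulo the diagonal
  image of \<open>A\<close>.
\<close>

definition power_sub :: "(('x \<Rightarrow> 'a) \<times> 'm) set \<Rightarrow> 'm set" where
  "power_sub Y = {w \<in> carrier M. \<forall>n. \<delta> n w \<in> Y}"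

definition power_null :: "(('x \<Rightarrow> 'a) \<times> 'm) set \<Rightarrow> (('x \<Rightarrow> 'a) \<times> 'm) set \<Rightarrow> (('x \<Rightarrow> 'a) \<times> 'm) set \<Rightarrow> 'm set" where
  "power_null Y A W = {w \<in> power_sub Y. \<exists>a \<in> A. \<exists>m. \<forall>n \<ge> m. \<delta> n w \<ominus>\<^bsub>PM\<^esub> a \<in> W}"

lemma power_nullI:
  "w \<in> power_sub Y \<Longrightarrow> a \<in> A \<Longrightarrow> (\<And>n. n \<ge> m \<Longrightarrow> \<delta> n w \<ominus>\<^bsub>PM\<^esub> a \<in> W) \<Longrightarrow> w \<in> power_null Y A W"
  by (auto simp: power_null_def)

lemma \<delta>_zero: "\<delta> n \<zero>\<^bsub>M\<^esub> = \<zero>\<^bsub>PM\<^esub>"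
  by (rule linear_zero[OF M_module PM.module_axioms \<delta>])

lemma power_subquotient:
  assumes Y: "submodule Y R PM" and A: "submodule A R PM" and W: "submodule W R PM"
  shows "subquotient (power_sub Y) (power_null Y A W)"
proof -
  note Ym = PM.submodule_mem[OF Y] and Am = PM.submodule_mem[OF A] and Wm = PM.submodule_mem[OF W]
  note lin = linear_add[OF \<delta>] linear_smult[OF \<delta>]
  have H: "submodule (power_sub Y) R M"
    by (rule submodule_of_scalar_closed) (auto simp: power_sub_def lin \<delta>_zero Ym)
  note Hm = submodule_mem[OF H]
  have "submodule (power_null Y A W) R M"
  proof (rule submodule_of_scalar_closed)
    show "power_null Y A W \<subseteq> carrier M" by (auto simp: power_null_def power_sub_def)
    have "\<zero>\<^bsub>PM\<^esub> \<ominus>\<^bsub>PM\<^esub> \<zero>\<^bsub>PM\<^esub> \<in> W" by (rule Wm(5)[OF Wm(2) Wm(2)])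
    then show "\<zero>\<^bsub>M\<^esub> \<in> power_null Y A W"
      using Am(2) by (intro power_nullI[OF Hm(2), of "\<zero>\<^bsub>PM\<^esub>" A 0]) (auto simp: \<delta>_zero)
  next
    fix x y assume "x \<in> power_null Y A W" "y \<in> power_null Y A W"
    then obtain a b m n where x: "x \<in> power_sub Y" "a \<in> A" "\<And>i. i \<ge> m \<Longrightarrow> \<delta> i x \<ominus>\<^bsub>PM\<^esub> a \<in> W"
      and y: "y \<in> power_sub Y" "b \<in> A" "\<And>i. i \<ge> n \<Longrightarrow> \<delta> i y \<ominus>\<^bsub>PM\<^esub> b \<in> W"
      unfolding power_null_def by blast
    note xM = Hm(1)[OF x(1)] and yM = Hm(1)[OF y(1)]
    show "x \<oplus>\<^bsub>M\<^esub> y \<in> power_null Y A W"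
    proof (rule power_nullI[OF Hm(3)[OF x(1) y(1)] Am(3)[OF x(2) y(2)]])
      fix i assume i: "i \<ge> max m n"
      have "\<delta> i (x \<oplus>\<^bsub>M\<^esub> y) \<ominus>\<^bsub>PM\<^esub> (a \<oplus>\<^bsub>PM\<^esub> b) = (\<delta> i x \<ominus>\<^bsub>PM\<^esub> a) \<oplus>\<^bsub>PM\<^esub> (\<delta> i y \<ominus>\<^bsub>PM\<^esub> b)"
        unfolding lin(1)[OF xM yM] using linear_closed[OF \<delta> xM, of i] linear_closed[OF \<delta> yM, of i] Am(1)[OF x(2)] Am(1)[OF y(2)]
        by algebra
      then show "\<delta> i (x \<oplus>\<^bsub>M\<^esub> y) \<ominus>\<^bsub>PM\<^esub> (a \<oplus>\<^bsub>PM\<^esub> b) \<in> W" using Wm(3)[OF x(3) y(3)] i by simp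
    qed
  next
    fix r x assume r: "r \<in> carrier R" and "x \<in> power_null Y A W"
    then obtain a m where x: "x \<in> power_sub Y" "a \<in> A" "\<And>i. i \<ge> m \<Longrightarrow> \<delta> i x \<ominus>\<^bsub>PM\<^esub> a \<in> W"
      unfolding power_null_def by blast
    note xM = Hm(1)[OF x(1)]
    show "r \<odot>\<^bsub>M\<^esub> x \<in> power_null Y A W"
    proof (rule power_nullI[OF Hm(6)[OF r x(1)] Am(6)[OF r x(2)]])
      fix i assume i: "i \<ge> m"
      have "\<delta> i (r \<odot>\<^bsub>M\<^esub> x) \<ominus>\<^bsub>PM\<^esub> r \<odot>\<^bsub>PM\<^esub> a = r \<odot>\<^bsub>PM\<^esub> (\<delta> i x \<ominus>\<^bsub>PM\<^esub> a)"
        unfolding lin(2)[OF r xM] using linear_closed[OF \<delta> xM, of i] Am(1)[OF x(2)] r by algebra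
      then show "\<delta> i (r \<odot>\<^bsub>M\<^esub> x) \<ominus>\<^bsub>PM\<^esub> r \<odot>\<^bsub>PM\<^esub> a \<in> W" using Wm(6)[OF r x(3)[OF i]] by simp
    qed
  qed
  then show ?thesis using H by (auto simp: subquotient_def power_null_def)
qed

text \<open>Any finite number of the equations can be solved by descending recursion. In the coordinate \<open>m\<close> take
  a solution of the equations up to index \<open>m\<close>; then each equation holds in almost all coordinates.\<close>

lemma power_telescoping:
  assumes Y: "submodule Y R PM" and A: "submodule A R PM" and W: "submodule W R PM"
  shows "telescoping R M (power_sub Y) (power_null Y A W)"
proof (rule telescopingI)
  note Am = PM.submodule_mem[OF A] and Wm = PM.submodule_mem[OF W]
  note Hm = submodule_mem[OF subquotientD(1)[OF power_subquotient[OF Y A W]]]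
  fix t e :: "nat \<Rightarrow> 'a" and d :: "nat \<Rightarrow> 'm"
  assume t: "\<And>n. t n \<in> carrier R" and d: "\<And>n. d n \<in> power_sub Y"
  \<comment> \<open>\<open>v m\<close> solves the equations with index at most \<open>m\<close>, by descending recursion from \<open>v m (m + 1) = 0\<close>.\<close>
  define v where "v m n = rec_nat \<zero>\<^bsub>M\<^esub> (\<lambda>j y. d (m - j) \<oplus>\<^bsub>M\<^esub> t (m - j) \<odot>\<^bsub>M\<^esub> y) (Suc m - n)" for m n
  have v_step: "v m n = d n \<oplus>\<^bsub>M\<^esub> t n \<odot>\<^bsub>M\<^esub> v m (Suc n)" if "n \<le> m" for m n
    using that by (simp add: v_def Suc_diff_le)
  have vH: "v m n \<in> power_sub Y" for m n
  proof -
    have "rec_nat \<zero>\<^bsub>M\<^esub> (\<lambda>j y. d (m - j) \<oplus>\<^bsub>M\<^esub> t (m - j) \<odot>\<^bsub>M\<^esub> y) i \<in> power_sub Y" for i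
      by (induct i) (auto intro: Hm(2,3,6) d t)
    then show ?thesis by (simp add: v_def)
  qed
  note vM = Hm(1)[OF vH] and dM = Hm(1)[OF d]
  have "\<exists>w. w \<in> carrier M \<and> (\<forall>m. \<delta> m w = \<delta> m (v m n))" for n
    using decode[of "\<lambda>m. \<delta> m (v m n)"] linear_closed[OF \<delta> vM] by blast
  then obtain w where w: "\<And>n. w n \<in> carrier M" "\<And>m n. \<delta> m (w n) = \<delta> m (v m n)" by metis
  have wH: "w n \<in> power_sub Y" for n using vH w by (simp add: power_sub_def)
  have "cong_mod M (power_null Y A W) (w n \<ominus>\<^bsub>M\<^esub> t n \<odot>\<^bsub>M\<^esub> w (Suc n)) (d n)" for n
  proof -
    define r where "r = w n \<ominus>\<^bsub>M\<^esub> t n \<odot>\<^bsub>M\<^esub> w (Suc n) \<ominus>\<^bsub>M\<^esub> d n"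
    have rH: "r \<in> power_sub Y" unfolding r_def by (intro Hm(5) Hm(6) wH d t)
    note ld = linear_diff[OF M_module PM.module_axioms \<delta>] linear_smult[OF \<delta>]
    have "\<delta> m r = \<zero>\<^bsub>PM\<^esub>" if m: "m \<ge> n" for m
    proof -
      have "\<delta> m r = \<delta> m (v m n \<ominus>\<^bsub>M\<^esub> t n \<odot>\<^bsub>M\<^esub> v m (Suc n) \<ominus>\<^bsub>M\<^esub> d n)"
        using w vM dM t by (simp add: r_def ld)
      also have "v m n \<ominus>\<^bsub>M\<^esub> t n \<odot>\<^bsub>M\<^esub> v m (Suc n) \<ominus>\<^bsub>M\<^esub> d n = \<zero>\<^bsub>M\<^esub>"
        unfolding v_step[OF m] using vM[of m "Suc n"] dM[of n] t[of n] by algebra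
      finally show ?thesis by (simp add: \<delta>_zero)
    qed
    then have "r \<in> power_null Y A W"
      using Am(2) Wm(5)[OF Wm(2) Wm(2)] by (intro power_nullI[OF rH, of "\<zero>\<^bsub>PM\<^esub>" A n]) auto
    then show ?thesis using w(1) dM t by (simp add: cong_mod_def r_def)
  qed
  then show "\<exists>x. (\<forall>n. x n \<in> power_sub Y) \<and> (\<forall>n. cong_mod M (power_null Y A W) (x n \<ominus>\<^bsub>M\<^esub> t n \<odot>\<^bsub>M\<^esub> x (Suc n)) (d n))"
    using wH by blast
qed

lemma power_annihilator:
  assumes Y: "submodule Y R PM" and A: "submodule A R PM" and W: "submodule W R PM"
    and r: "r \<in> carrier R" "\<And>y. y \<in> Y \<Longrightarrow> r \<odot>\<^bsub>PM\<^esub> y \<in> W"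
  shows "r \<in> annihilator (power_sub Y) (power_null Y A W)"
proof -
  note Am = PM.submodule_mem[OF A] and Wm = PM.submodule_mem[OF W]
  note Hm = submodule_mem[OF subquotientD(1)[OF power_subquotient[OF Y A W]]]
  have "r \<odot>\<^bsub>M\<^esub> w \<in> power_null Y A W" if w: "w \<in> power_sub Y" for w
  proof (rule power_nullI[OF Hm(6)[OF r(1) w] Am(2)])
    fix n
    have "r \<odot>\<^bsub>PM\<^esub> \<delta> n w \<in> W" using w by (intro r(2)) (simp add: power_sub_def)
    then show "\<delta> n (r \<odot>\<^bsub>M\<^esub> w) \<ominus>\<^bsub>PM\<^esub> \<zero>\<^bsub>PM\<^esub> \<in> W"
      using Wm(5)[OF _ Wm(2)] by (simp add: linear_smult[OF \<delta> r(1) Hm(1)[OF w]])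
  qed
  then show ?thesis using r(1) by (simp add: annihilator_def)
qed

lemma power_const_cong:
  assumes Y: "submodule Y R PM" and A: "submodule A R PM" and W: "submodule W R PM"
    and xy: "x \<in> power_sub Y" "y \<in> power_sub Y" "\<And>n. \<delta> n x = a" "\<And>n. \<delta> n y = b" and ab: "a \<ominus>\<^bsub>PM\<^esub> b \<in> A"
  shows "cong_mod M (power_null Y A W) x y"
proof -
  note Am = PM.submodule_mem[OF A] and Wm = PM.submodule_mem[OF W]
  note Hm = submodule_mem[OF subquotientD(1)[OF power_subquotient[OF Y A W]]]
  have "\<delta> n (x \<ominus>\<^bsub>M\<^esub> y) = a \<ominus>\<^bsub>PM\<^esub> b" for n
    using linear_diff[OF M_module PM.module_axioms \<delta> Hm(1)[OF xy(1)] Hm(1)[OF xy(2)]] xy(3,4) by simp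
  then have "x \<ominus>\<^bsub>M\<^esub> y \<in> power_null Y A W"
    using Wm(2) Am(1)[OF ab] by (intro power_nullI[OF Hm(5)[OF xy(1,2)] ab, of 0])
      (simp add: PM.minus_eq[of "a \<ominus>\<^bsub>PM\<^esub> b"] PM.r_neg)
  then show ?thesis using Hm(1)[OF xy(1)] Hm(1)[OF xy(2)] by (simp add: cong_mod_def)
qed

text \<open>
  Let \<open>D = H/Z\<close>, and let \<open>Y\<close> be the pullback of \<open>f\<close> and the multiplication by \<open>c\<close>; it is an extension of \<open>K\<close>
  by \<open>A = D[c]\<close>, and a section of it is the required \<open>f'\<close>. Let \<open>J\<close> be the set of ring elements that
  annihilate \<open>A\<close>; it contains \<open>c\<close> and the annihilator of \<open>D\<close>. Because \<open>K\<close> is flat, \<open>A\<close> meets \<open>J Y\<close>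
  trivially, so \<open>A\<close> embeds into the reduced power of \<open>Y/J Y\<close>. By the induction hypothesis the
  diagonal map from \<open>K = Y/A\<close> to the quotient of this reduced power by \<open>A\<close> extends to \<open>P\<close>, and since
  \<open>P\<close> is free it lifts to a map \<open>\<psi>\<close> into the reduced power. The difference of the diagonal map on \<open>Y\<close> and \<open>\<psi>\<close>
  takes values in \<open>A\<close> and is the identity on \<open>A\<close>, so its kernel is a complement of \<open>A\<close> in \<open>Y\<close>.

  In place of \<open>J Y\<close> the proof uses a submodule \<open>W\<close> that contains it and still meets \<open>A\<close> trivially. A pair
  \<open>(\<theta>, \<eta>)\<close> is good for \<open>S\<close> if it is a linear map from \<open>P\<close> to \<open>Y\<close> whose first component fixes \<open>S\<close>;
  it is then a partial section of \<open>Y\<close> over \<open>S\<close>. An element of \<open>Y\<close> belongs to \<open>W\<close> if all partial sections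
  over some finite \<open>S\<close> agree with it. This happens for \<open>r (k, h)\<close> with \<open>r\<close> in \<open>J\<close> and \<open>S = {k}\<close>,
  because two lifts of \<open>k\<close> differ by an element of \<open>A\<close>.
\<close>

lemma division_lift:
  assumes s: "subquotient H Z" and c: "c \<in> carrier R" "c \<notin> annihilator H Z"
    and IH: "\<And>H' Z'. subquotient H' Z' \<Longrightarrow> telescoping R M H' Z' \<Longrightarrow> annihilator H Z \<subset> annihilator H' Z' \<Longrightarrow> extensible H' Z'"
    and f: "quasilinear (multiples c H Z) Z f"
  shows "\<exists>f'. quasilinear H Z f' \<and> (\<forall>k \<in> K. cong_mod M Z (f k) (c \<odot>\<^bsub>M\<^esub> f' k))"
proof -
  note sD = subquotientD[OF s] note Hm = submodule_mem[OF sD(1)] note Zm = submodule_mem[OF sD(2)]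
  note s' = multiples_subquotient(2)[OF s c(1)]
  note pm = pair_module_sel pair_module_diff[OF P.module_axioms M_module]
  note f0 = quasilinear_zero[OF s' f]
  define Y where "Y = {(k, h). k \<in> K \<and> h \<in> H \<and> cong_mod M Z (f k) (c \<odot>\<^bsub>M\<^esub> h)}"
  define A where "A = {(\<zero>\<^bsub>P\<^esub>, h) | h. h \<in> H \<and> c \<odot>\<^bsub>M\<^esub> h \<in> Z}"
  have Y: "submodule Y R PM"
  proof (rule PM.submodule_of_scalar_closed)
    show "Y \<subseteq> carrier PM" using K_mem(1) sD(4) by (auto simp: Y_def pm)
    show "\<zero>\<^bsub>PM\<^esub> \<in> Y" using K_mem(2) Hm(2) f0 c(1) cong_mod_zero_iff[OF sD(2)] by (simp add: Y_def pm)
  next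
    fix x y assume "x \<in> Y" "y \<in> Y"
    then obtain k h k' h' where xy: "x = (k, h)" "y = (k', h')"
      and a: "k \<in> K" "k' \<in> K" "h \<in> H" "h' \<in> H" "cong_mod M Z (f k) (c \<odot>\<^bsub>M\<^esub> h)" "cong_mod M Z (f k') (c \<odot>\<^bsub>M\<^esub> h')"
      by (auto simp: Y_def)
    have "cong_mod M Z (f (k \<oplus>\<^bsub>P\<^esub> k')) (c \<odot>\<^bsub>M\<^esub> h \<oplus>\<^bsub>M\<^esub> c \<odot>\<^bsub>M\<^esub> h')"
      by (rule cong_mod_trans[OF sD(2) quasilinearD(2)[OF f a(1,2)] cong_mod_add[OF sD(2) a(5,6)]])
    then show "x \<oplus>\<^bsub>PM\<^esub> y \<in> Y" using a K_mem(3) Hm(3) c(1) sD(4) by (simp add: Y_def pm xy smult_r_distr)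
  next
    fix a x assume r: "a \<in> carrier R" and "x \<in> Y"
    then obtain k h where x: "x = (k, h)" and b: "k \<in> K" "h \<in> H" "cong_mod M Z (f k) (c \<odot>\<^bsub>M\<^esub> h)"
      by (auto simp: Y_def)
    have "cong_mod M Z (f (a \<odot>\<^bsub>P\<^esub> k)) (a \<odot>\<^bsub>M\<^esub> (c \<odot>\<^bsub>M\<^esub> h))"
      by (rule cong_mod_trans[OF sD(2) quasilinearD(3)[OF f r b(1)] cong_mod_smult[OF sD(2) r b(3)]])
    moreover have "a \<odot>\<^bsub>M\<^esub> (c \<odot>\<^bsub>M\<^esub> h) = c \<odot>\<^bsub>M\<^esub> (a \<odot>\<^bsub>M\<^esub> h)" using b(2)[THEN sD(4)] r c(1) by algebra
    ultimately show "a \<odot>\<^bsub>PM\<^esub> x \<in> Y" using b K_mem(6) Hm(6) r by (simp add: Y_def pm x)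
  qed
  note Ym = PM.submodule_mem[OF Y]
  have A: "submodule A R PM"
  proof (rule PM.submodule_of_scalar_closed)
    fix a x assume r: "a \<in> carrier R" and "x \<in> A"
    then obtain h where h: "x = (\<zero>\<^bsub>P\<^esub>, h)" "h \<in> H" "c \<odot>\<^bsub>M\<^esub> h \<in> Z" by (auto simp: A_def)
    have "c \<odot>\<^bsub>M\<^esub> (a \<odot>\<^bsub>M\<^esub> h) = a \<odot>\<^bsub>M\<^esub> (c \<odot>\<^bsub>M\<^esub> h)" using h(2)[THEN sD(4)] r c(1) by algebra
    then show "a \<odot>\<^bsub>PM\<^esub> x \<in> A" using h Hm(6) Zm(6) r by (simp add: A_def pm)
  qed (use sD(4) Hm(2,3) Zm(2,3) c(1) in \<open>auto simp: A_def pm smult_r_distr\<close>)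
  have A_of_Y: "(\<zero>\<^bsub>P\<^esub>, h) \<in> A" if "(\<zero>\<^bsub>P\<^esub>, h) \<in> Y" for h
    using that f0 cong_mod_mem[OF sD(2) cong_mod_sym[OF sD(2)]] by (auto simp: Y_def A_def)
  have Y_lift: "\<exists>h. (k, h) \<in> Y" if "k \<in> K" for k
    using quasilinearD(1)[OF f that] that by (auto simp: multiples_def Y_def)
  define good where "good S \<theta> \<eta> \<longleftrightarrow> retracts R P K S \<theta> \<and> linear R P M \<eta> \<and> (\<forall>x \<in> carrier P. (\<theta> x, \<eta> x) \<in> Y)" for S \<theta> \<eta>
  have good_ex: "\<exists>\<theta> \<eta>. good S \<theta> \<eta>" if S: "finite S" "S \<subseteq> K" for S
  proof -
    obtain \<theta> where th: "retracts R P K S \<theta>" using retract[OF S] by blast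
    then have l: "linear R P P \<theta>" "\<And>y. y \<in> carrier P \<Longrightarrow> \<theta> y \<in> K" by (auto simp: retracts_def)
    have "\<exists>v. \<forall>b\<in>B. (\<theta> (basis_vector R b), v b) \<in> Y"
      by (intro bchoice ballI Y_lift l(2) R.basis_vector_closed)
    then obtain v where v: "\<And>b. b \<in> B \<Longrightarrow> (\<theta> (basis_vector R b), v b) \<in> Y" by blast
    then have "v b \<in> H" if "b \<in> B" for b using that by (auto simp: Y_def)
    then obtain \<eta> where et: "linear R P M \<eta>" "\<forall>y\<in>carrier P. \<eta> y \<in> H" "\<forall>b\<in>B. \<eta> (basis_vector R b) = v b"
      using linear_map_from_basis[OF _ sD(1)] by blast
    have bas: "cong_mod M Z (f (\<theta> (basis_vector R b))) (c \<odot>\<^bsub>M\<^esub> \<eta> (basis_vector R b))" if "b \<in> B" for b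
      using v[OF that] et(3) that by (simp add: Y_def)
    have "cong_mod M Z (f (\<theta> y)) (c \<odot>\<^bsub>M\<^esub> \<eta> y)" if "y \<in> carrier P" for y
      by (rule quasilinear_retract[OF s' f l linear_scale[OF M_module et(1) c(1)] bas that])
    then have "(\<theta> y, \<eta> y) \<in> Y" if "y \<in> carrier P" for y using that et(2) l(2) by (simp add: Y_def)
    then have "good S \<theta> \<eta>" using th et(1) by (simp add: good_def)
    then show ?thesis by blast
  qed
  have good_lin: "linear R P M \<eta>" if "good S \<theta> \<eta>" for S \<theta> \<eta> using that by (simp add: good_def)
  have good_mem: "(\<theta> x, \<eta> x) \<in> Y" if "good S \<theta> \<eta>" "x \<in> carrier P" for S \<theta> \<eta> x using that by (simp add: good_def)
  have good_fix: "\<theta> k = k" if "good S \<theta> \<eta>" "k \<in> S" for S \<theta> \<eta> k using that by (simp add: good_def retracts_def)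
  have good_mono: "good S \<theta> \<eta>" if "good S' \<theta> \<eta>" "S \<subseteq> S'" for S S' \<theta> \<eta>
    using that by (auto simp: good_def retracts_def)
  define W where "W = {(k, h). k \<in> K \<and> h \<in> H \<and>
    (\<exists>S. finite S \<and> S \<subseteq> K \<and> (\<forall>\<theta> \<eta>. good S \<theta> \<eta> \<longrightarrow> cong_mod M Z h (\<eta> k)))}"
  have WI: "(k, h) \<in> W" if "k \<in> K" "h \<in> H" "finite S" "S \<subseteq> K" "\<And>\<theta> \<eta>. good S \<theta> \<eta> \<Longrightarrow> cong_mod M Z h (\<eta> k)" for k h S
    using that by (auto simp: W_def)
  have W_zeroD: "h \<in> Z" if w: "(\<zero>\<^bsub>P\<^esub>, h) \<in> W" for h
  proof -
    obtain S where S: "finite S" "S \<subseteq> K" "\<forall>\<theta> \<eta>. good S \<theta> \<eta> \<longrightarrow> cong_mod M Z h (\<eta> \<zero>\<^bsub>P\<^esub>)" using w by (auto simp: W_def)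
    obtain \<theta> \<eta> where g: "good S \<theta> \<eta>" using good_ex[OF S(1,2)] by blast
    then have "cong_mod M Z h \<zero>\<^bsub>M\<^esub>" using S(3) linear_zero[OF P.module_axioms M_module good_lin[OF g]] by metis
    then show ?thesis by (simp add: cong_mod_zero_iff[OF sD(2)])
  qed
  have W: "submodule W R PM"
  proof (rule PM.submodule_of_scalar_closed)
    show "W \<subseteq> carrier PM" using K_mem(1) sD(4) by (auto simp: W_def pm)
    show "\<zero>\<^bsub>PM\<^esub> \<in> W"
      unfolding pm(2) using linear_zero[OF P.module_axioms M_module good_lin] cong_mod_refl[OF sD(2) M.zero_closed]
      by (intro WI[OF K_mem(2) Hm(2), of "{}"]) auto
  next
    fix x y assume "x \<in> W" "y \<in> W"
    then obtain k h k' h' S S' where xy: "x = (k, h)" "y = (k', h')" and kh: "k \<in> K" "k' \<in> K" "h \<in> H" "h' \<in> H"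
      and S: "finite S" "S \<subseteq> K" "\<forall>\<theta> \<eta>. good S \<theta> \<eta> \<longrightarrow> cong_mod M Z h (\<eta> k)"
      and S': "finite S'" "S' \<subseteq> K" "\<forall>\<theta> \<eta>. good S' \<theta> \<eta> \<longrightarrow> cong_mod M Z h' (\<eta> k')"
      by (auto simp: W_def)
    show "x \<oplus>\<^bsub>PM\<^esub> y \<in> W"
      unfolding xy pm fst_conv snd_conv
    proof (rule WI[OF K_mem(3)[OF kh(1,2)] Hm(3)[OF kh(3,4)], of "S \<union> S'"])
      fix \<theta> \<eta> assume g: "good (S \<union> S') \<theta> \<eta>"
      have "cong_mod M Z h (\<eta> k)" "cong_mod M Z h' (\<eta> k')" using S(3) S'(3) good_mono[OF g] by blast+
      then show "cong_mod M Z (h \<oplus>\<^bsub>M\<^esub> h') (\<eta> (k \<oplus>\<^bsub>P\<^esub> k'))"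
        using cong_mod_add[OF sD(2)] linear_add[OF good_lin[OF g] kh(1,2)[THEN K_mem(1)]] by simp
    qed (use S S' in auto)
  next
    fix a x assume a: "a \<in> carrier R" and "x \<in> W"
    then obtain k h S where x: "x = (k, h)" and kh: "k \<in> K" "h \<in> H"
      and S: "finite S" "S \<subseteq> K" "\<forall>\<theta> \<eta>. good S \<theta> \<eta> \<longrightarrow> cong_mod M Z h (\<eta> k)"
      by (auto simp: W_def)
    show "a \<odot>\<^bsub>PM\<^esub> x \<in> W"
      unfolding x pm fst_conv snd_conv
    proof (rule WI[OF K_mem(6)[OF a kh(1)] Hm(6)[OF a kh(2)] S(1,2)])
      fix \<theta> \<eta> assume g: "good S \<theta> \<eta>"
      then have "cong_mod M Z h (\<eta> k)" using S(3) by blast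
      then show "cong_mod M Z (a \<odot>\<^bsub>M\<^esub> h) (\<eta> (a \<odot>\<^bsub>P\<^esub> k))"
        using cong_mod_smult[OF sD(2) a] linear_smult[OF good_lin[OF g] a K_mem(1)[OF kh(1)]] by simp
    qed
  qed
  note Wm = PM.submodule_mem[OF W]
  have W_kill: "r \<odot>\<^bsub>PM\<^esub> y \<in> W"
    if y: "y \<in> Y" and r: "r \<in> carrier R" "\<And>h. h \<in> H \<Longrightarrow> c \<odot>\<^bsub>M\<^esub> h \<in> Z \<Longrightarrow> r \<odot>\<^bsub>M\<^esub> h \<in> Z" for r y
  proof -
    obtain k h where kh: "y = (k, h)" "k \<in> K" "h \<in> H" using y by (auto simp: Y_def)
    note kP = K_mem(1)[OF kh(2)] and hM = sD(4)[OF kh(3)]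
    show ?thesis
      unfolding kh(1) pm fst_conv snd_conv
    proof (rule WI[OF K_mem(6)[OF r(1) kh(2)] Hm(6)[OF r(1) kh(3)], of "{k}"])
      fix \<theta> \<eta> assume g: "good {k} \<theta> \<eta>"
      have eM: "\<eta> k \<in> carrier M" by (rule linear_closed[OF good_lin[OF g] kP])
      have "(k, h) \<ominus>\<^bsub>PM\<^esub> (k, \<eta> k) \<in> Y" using Ym(5)[OF y good_mem[OF g kP]] good_fix[OF g, of k] kh(1) by simp
      then have "(\<zero>\<^bsub>P\<^esub>, h \<ominus>\<^bsub>M\<^esub> \<eta> k) \<in> Y" using kP hM eM by (simp add: pm P.minus_eq P.r_neg)
      then have "r \<odot>\<^bsub>M\<^esub> (h \<ominus>\<^bsub>M\<^esub> \<eta> k) \<in> Z" using A_of_Y r(2) by (auto simp: A_def)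
      moreover have "r \<odot>\<^bsub>M\<^esub> (h \<ominus>\<^bsub>M\<^esub> \<eta> k) = r \<odot>\<^bsub>M\<^esub> h \<ominus>\<^bsub>M\<^esub> r \<odot>\<^bsub>M\<^esub> \<eta> k" using hM eM r(1) by algebra
      ultimately show "cong_mod M Z (r \<odot>\<^bsub>M\<^esub> h) (\<eta> (r \<odot>\<^bsub>P\<^esub> k))"
        using hM eM r(1) by (simp add: cong_mod_def linear_smult[OF good_lin[OF g] r(1) kP])
    qed (use kh(2) in auto)
  qed
  let ?H = "power_sub Y" and ?Z = "power_null Y A W"
  have kill: "r \<in> annihilator ?H ?Z" if "r \<in> carrier R" "\<And>h. h \<in> H \<Longrightarrow> c \<odot>\<^bsub>M\<^esub> h \<in> Z \<Longrightarrow> r \<odot>\<^bsub>M\<^esub> h \<in> Z" for r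
    by (rule power_annihilator[OF Y A W that(1)]) (rule W_kill[OF _ that])
  have "annihilator H Z \<subseteq> annihilator ?H ?Z" by (auto simp: annihilator_def[of H Z] intro: kill)
  moreover have "c \<in> annihilator ?H ?Z" by (rule kill[OF c(1)])
  ultimately have ext': "extensible ?H ?Z"
    using IH[OF power_subquotient[OF Y A W] power_telescoping[OF Y A W]] c(2) by blast
  have "\<exists>h. \<forall>k \<in> K. (k, h k) \<in> Y" by (intro bchoice ballI Y_lift)
  then obtain h where h: "\<And>k. k \<in> K \<Longrightarrow> (k, h k) \<in> Y" by blast
  have hM: "h k \<in> carrier M" "h k \<in> H" if "k \<in> K" for k using h[OF that] sD(4) by (auto simp: Y_def)
  have "\<exists>w. \<forall>k \<in> K. w k \<in> carrier M \<and> (\<forall>n. \<delta> n (w k) = (k, h k))"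
  proof (intro bchoice ballI)
    fix k assume "k \<in> K"
    then show "\<exists>w. w \<in> carrier M \<and> (\<forall>n. \<delta> n w = (k, h k))"
      using decode[of "\<lambda>_. (k, h k)"] K_mem(1) hM(1) by (auto simp: pm)
  qed
  then obtain w where w: "\<And>k. k \<in> K \<Longrightarrow> w k \<in> carrier M" "\<And>n k. k \<in> K \<Longrightarrow> \<delta> n (w k) = (k, h k)" by blast
  have wH: "w k \<in> ?H" if "k \<in> K" for k using w h that by (simp add: power_sub_def)
  note Hm' = submodule_mem[OF subquotientD(1)[OF power_subquotient[OF Y A W]]]
  note const = power_const_cong[OF Y A W]
  have "quasilinear ?H ?Z w"
    unfolding quasilinear_def
  proof (intro conjI ballI)
    fix k k' assume k: "k \<in> K" "k' \<in> K"
    note kk = K_mem(3)[OF k]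
    have "(k \<oplus>\<^bsub>P\<^esub> k', h (k \<oplus>\<^bsub>P\<^esub> k')) \<ominus>\<^bsub>PM\<^esub> (k \<oplus>\<^bsub>P\<^esub> k', h k \<oplus>\<^bsub>M\<^esub> h k') \<in> Y"
      using Ym(5)[OF h[OF kk] Ym(3)[OF h[OF k(1)] h[OF k(2)]]] by (simp add: pm(3))
    then have "(k \<oplus>\<^bsub>P\<^esub> k', h (k \<oplus>\<^bsub>P\<^esub> k')) \<ominus>\<^bsub>PM\<^esub> (k \<oplus>\<^bsub>P\<^esub> k', h k \<oplus>\<^bsub>M\<^esub> h k') \<in> A"
      using A_of_Y k hM(1) kk K_mem(1) by (simp add: pm P.minus_eq P.r_neg)
    then show "cong_mod M ?Z (w (k \<oplus>\<^bsub>P\<^esub> k')) (w k \<oplus>\<^bsub>M\<^esub> w k')"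
      using k kk wH Hm'(3) w by (intro const) (auto simp: linear_add[OF \<delta>] pm(3))
  next
    fix a k assume k: "a \<in> carrier R" "k \<in> K"
    note ak = K_mem(6)[OF k]
    have "(a \<odot>\<^bsub>P\<^esub> k, h (a \<odot>\<^bsub>P\<^esub> k)) \<ominus>\<^bsub>PM\<^esub> (a \<odot>\<^bsub>P\<^esub> k, a \<odot>\<^bsub>M\<^esub> h k) \<in> Y"
      using Ym(5)[OF h[OF ak] Ym(6)[OF k(1) h[OF k(2)]]] by (simp add: pm(4))
    then have "(a \<odot>\<^bsub>P\<^esub> k, h (a \<odot>\<^bsub>P\<^esub> k)) \<ominus>\<^bsub>PM\<^esub> (a \<odot>\<^bsub>P\<^esub> k, a \<odot>\<^bsub>M\<^esub> h k) \<in> A"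
      using A_of_Y k hM(1) ak K_mem(1) by (simp add: pm P.minus_eq P.r_neg)
    then show "cong_mod M ?Z (w (a \<odot>\<^bsub>P\<^esub> k)) (a \<odot>\<^bsub>M\<^esub> w k)"
      using k ak wH Hm'(6) w by (intro const) (auto simp: linear_smult[OF \<delta>] pm(4))
  qed (rule wH)
  then obtain \<psi> where psi: "linear R P M \<psi>" "\<And>k. k \<in> K \<Longrightarrow> cong_mod M ?Z (w k) (\<psi> k)"
    using ext' unfolding extensible_def by blast
  have psiM: "\<psi> k \<in> carrier M" if "k \<in> K" for k by (rule linear_closed[OF psi(1) K_mem(1)[OF that]])
  note \<delta>c = linear_closed[OF \<delta>]
  \<comment> \<open>The lift \<open>f' k\<close> of \<open>k\<close> is singled out by the condition that it agrees with \<open>\<psi> k\<close> eventually.\<close>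
  have "\<exists>f'. \<forall>k \<in> K. (k, h k) \<ominus>\<^bsub>PM\<^esub> (k, f' k) \<in> A \<and> f' k \<in> H \<and> (\<exists>m. \<forall>n \<ge> m. (k, f' k) \<ominus>\<^bsub>PM\<^esub> \<delta> n (\<psi> k) \<in> W)"
  proof (intro bchoice ballI)
    fix k assume k: "k \<in> K"
    have "w k \<ominus>\<^bsub>M\<^esub> \<psi> k \<in> ?Z" using psi(2)[OF k] by (simp add: cong_mod_def)
    then obtain a m where a: "a \<in> A" "\<And>n. n \<ge> m \<Longrightarrow> \<delta> n (w k \<ominus>\<^bsub>M\<^esub> \<psi> k) \<ominus>\<^bsub>PM\<^esub> a \<in> W"
      by (auto simp: power_null_def)
    obtain \<nu> where nu: "a = (\<zero>\<^bsub>P\<^esub>, \<nu>)" "\<nu> \<in> H" using a(1) by (auto simp: A_def)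
    note kP = K_mem(1)[OF k] and nuM = sD(4)[OF nu(2)]
    have khP: "(k, h k) \<in> carrier PM" "a \<in> carrier PM" using kP hM(1)[OF k] nuM by (auto simp: pm nu(1))
    have sub: "(k, h k) \<ominus>\<^bsub>PM\<^esub> a = (k, h k \<ominus>\<^bsub>M\<^esub> \<nu>)" using kP hM(1)[OF k] nuM by (simp add: pm nu(1) P.minus_eq P.a_inv_zero)
    have "(k, h k \<ominus>\<^bsub>M\<^esub> \<nu>) \<ominus>\<^bsub>PM\<^esub> \<delta> n (\<psi> k) \<in> W" if n: "n \<ge> m" for n
    proof -
      have "(k, h k) \<ominus>\<^bsub>PM\<^esub> a \<ominus>\<^bsub>PM\<^esub> \<delta> n (\<psi> k) = (k, h k) \<ominus>\<^bsub>PM\<^esub> \<delta> n (\<psi> k) \<ominus>\<^bsub>PM\<^esub> a"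
        using khP \<delta>c[OF psiM[OF k], of n] by algebra
      then show ?thesis
        using a(2)[OF n] w(2)[OF k] linear_diff[OF M_module PM.module_axioms \<delta> w(1)[OF k] psiM[OF k]] sub by simp
    qed
    moreover have "(k, h k) \<ominus>\<^bsub>PM\<^esub> (k, h k \<ominus>\<^bsub>M\<^esub> \<nu>) \<in> A"
    proof -
      have "(k, h k) \<ominus>\<^bsub>PM\<^esub> ((k, h k) \<ominus>\<^bsub>PM\<^esub> a) = a" using khP by algebra
      then show ?thesis using a(1) sub by simp
    qed
    moreover have "h k \<ominus>\<^bsub>M\<^esub> \<nu> \<in> H" by (rule Hm(5)[OF hM(2)[OF k] nu(2)])
    ultimately show "\<exists>v. (k, h k) \<ominus>\<^bsub>PM\<^esub> (k, v) \<in> A \<and> v \<in> H \<and> (\<exists>m. \<forall>n \<ge> m. (k, v) \<ominus>\<^bsub>PM\<^esub> \<delta> n (\<psi> k) \<in> W)" by blast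
  qed
  then obtain f' where f': "\<And>k. k \<in> K \<Longrightarrow> (k, h k) \<ominus>\<^bsub>PM\<^esub> (k, f' k) \<in> A" "\<And>k. k \<in> K \<Longrightarrow> f' k \<in> H"
    "\<And>k. k \<in> K \<Longrightarrow> \<exists>m. \<forall>n \<ge> m. (k, f' k) \<ominus>\<^bsub>PM\<^esub> \<delta> n (\<psi> k) \<in> W" by blast
  have f'M: "f' k \<in> carrier M" "(k, f' k) \<in> carrier PM" if "k \<in> K" for k
    using f'(2)[OF that] sD(4) K_mem(1)[OF that] by (auto simp: pm)
  have "cong_mod M Z (f k) (c \<odot>\<^bsub>M\<^esub> f' k)" if k: "k \<in> K" for k
  proof -
    have "c \<odot>\<^bsub>M\<^esub> (h k \<ominus>\<^bsub>M\<^esub> f' k) \<in> Z"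
      using f'(1)[OF k] K_mem(1)[OF k] hM(1)[OF k] f'M(1)[OF k] by (auto simp: pm A_def)
    moreover have "c \<odot>\<^bsub>M\<^esub> (h k \<ominus>\<^bsub>M\<^esub> f' k) = c \<odot>\<^bsub>M\<^esub> h k \<ominus>\<^bsub>M\<^esub> c \<odot>\<^bsub>M\<^esub> f' k"
      using hM(1)[OF k] f'M(1)[OF k] c(1) by algebra
    ultimately have "cong_mod M Z (c \<odot>\<^bsub>M\<^esub> h k) (c \<odot>\<^bsub>M\<^esub> f' k)" using hM(1)[OF k] f'M(1)[OF k] c(1) by (simp add: cong_mod_def)
    moreover have "cong_mod M Z (f k) (c \<odot>\<^bsub>M\<^esub> h k)" using h[OF k] by (simp add: Y_def)
    ultimately show ?thesis using cong_mod_trans[OF sD(2)] by blast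
  qed
  moreover have "quasilinear H Z f'"
    unfolding quasilinear_def
  proof (intro conjI ballI)
    fix k k' assume k: "k \<in> K" "k' \<in> K"
    note kk = K_mem(3)[OF k]
    obtain m1 m2 m3 where m: "\<And>n. n \<ge> m1 \<Longrightarrow> (k, f' k) \<ominus>\<^bsub>PM\<^esub> \<delta> n (\<psi> k) \<in> W"
       "\<And>n. n \<ge> m2 \<Longrightarrow> (k', f' k') \<ominus>\<^bsub>PM\<^esub> \<delta> n (\<psi> k') \<in> W"
       "\<And>n. n \<ge> m3 \<Longrightarrow> (k \<oplus>\<^bsub>P\<^esub> k', f' (k \<oplus>\<^bsub>P\<^esub> k')) \<ominus>\<^bsub>PM\<^esub> \<delta> n (\<psi> (k \<oplus>\<^bsub>P\<^esub> k')) \<in> W"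
      using f'(3)[OF k(1)] f'(3)[OF k(2)] f'(3)[OF kk] by blast
    define n where "n = m1 + m2 + m3"
    define x where "x = \<delta> n (\<psi> k)" define x' where "x' = \<delta> n (\<psi> k')"
    define y where "y = (k, f' k)" define y' where "y' = (k', f' k')"
    define z where "z = (k \<oplus>\<^bsub>P\<^esub> k', f' (k \<oplus>\<^bsub>P\<^esub> k'))"
    have xc: "x \<in> carrier PM" "x' \<in> carrier PM" "y \<in> carrier PM" "y' \<in> carrier PM" "z \<in> carrier PM"
      unfolding x_def x'_def y_def y'_def z_def by (intro \<delta>c psiM f'M k kk)+
    have sum: "\<delta> n (\<psi> (k \<oplus>\<^bsub>P\<^esub> k')) = x \<oplus>\<^bsub>PM\<^esub> x'"
      using k[THEN K_mem(1)] psiM[OF k(1)] psiM[OF k(2)] by (simp add: linear_add[OF psi(1)] linear_add[OF \<delta>] x_def x'_def)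
    have mm: "y \<ominus>\<^bsub>PM\<^esub> x \<in> W" "y' \<ominus>\<^bsub>PM\<^esub> x' \<in> W" "z \<ominus>\<^bsub>PM\<^esub> (x \<oplus>\<^bsub>PM\<^esub> x') \<in> W"
      using m(1)[of n] m(2)[of n] m(3)[of n] unfolding sum x_def[symmetric] x'_def[symmetric] y_def[symmetric] y'_def[symmetric] z_def[symmetric]
      by (auto simp: n_def)
    have "z \<ominus>\<^bsub>PM\<^esub> (y \<oplus>\<^bsub>PM\<^esub> y') = (z \<ominus>\<^bsub>PM\<^esub> (x \<oplus>\<^bsub>PM\<^esub> x')) \<ominus>\<^bsub>PM\<^esub> ((y \<ominus>\<^bsub>PM\<^esub> x) \<oplus>\<^bsub>PM\<^esub> (y' \<ominus>\<^bsub>PM\<^esub> x'))"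
      using xc by algebra
    also have "\<dots> \<in> W" by (rule Wm(5)[OF mm(3) Wm(3)[OF mm(1,2)]])
    finally have "(\<zero>\<^bsub>P\<^esub>, f' (k \<oplus>\<^bsub>P\<^esub> k') \<ominus>\<^bsub>M\<^esub> (f' k \<oplus>\<^bsub>M\<^esub> f' k')) \<in> W"
      using f'M(1)[OF k(1)] f'M(1)[OF k(2)] f'M(1)[OF kk] K_mem(1)[OF kk] unfolding z_def y_def y'_def
      by (simp add: pm P.minus_eq[of "k \<oplus>\<^bsub>P\<^esub> k'"] P.r_neg)
    then show "cong_mod M Z (f' (k \<oplus>\<^bsub>P\<^esub> k')) (f' k \<oplus>\<^bsub>M\<^esub> f' k')"
      using W_zeroD f'M(1)[OF k(1)] f'M(1)[OF k(2)] f'M(1)[OF kk] by (simp add: cong_mod_def)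
  next
    fix a k assume k: "a \<in> carrier R" "k \<in> K"
    note ak = K_mem(6)[OF k]
    obtain m1 m2 where m: "\<And>n. n \<ge> m1 \<Longrightarrow> (k, f' k) \<ominus>\<^bsub>PM\<^esub> \<delta> n (\<psi> k) \<in> W"
       "\<And>n. n \<ge> m2 \<Longrightarrow> (a \<odot>\<^bsub>P\<^esub> k, f' (a \<odot>\<^bsub>P\<^esub> k)) \<ominus>\<^bsub>PM\<^esub> \<delta> n (\<psi> (a \<odot>\<^bsub>P\<^esub> k)) \<in> W"
      using f'(3)[OF k(2)] f'(3)[OF ak] by blast
    define n where "n = m1 + m2"
    define x where "x = \<delta> n (\<psi> k)" define y where "y = (k, f' k)"
    define z where "z = (a \<odot>\<^bsub>P\<^esub> k, f' (a \<odot>\<^bsub>P\<^esub> k))"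
    have xc: "x \<in> carrier PM" "y \<in> carrier PM" "z \<in> carrier PM"
      unfolding x_def y_def z_def by (intro \<delta>c psiM f'M k ak)+
    have sum: "\<delta> n (\<psi> (a \<odot>\<^bsub>P\<^esub> k)) = a \<odot>\<^bsub>PM\<^esub> x"
      using k(1) K_mem(1)[OF k(2)] psiM[OF k(2)] by (simp add: linear_smult[OF psi(1)] linear_smult[OF \<delta>] x_def)
    have mm: "y \<ominus>\<^bsub>PM\<^esub> x \<in> W" "z \<ominus>\<^bsub>PM\<^esub> a \<odot>\<^bsub>PM\<^esub> x \<in> W"
      using m(1)[of n] m(2)[of n] unfolding sum x_def[symmetric] y_def[symmetric] z_def[symmetric] by (auto simp: n_def)
    have "z \<ominus>\<^bsub>PM\<^esub> a \<odot>\<^bsub>PM\<^esub> y = (z \<ominus>\<^bsub>PM\<^esub> a \<odot>\<^bsub>PM\<^esub> x) \<ominus>\<^bsub>PM\<^esub> a \<odot>\<^bsub>PM\<^esub> (y \<ominus>\<^bsub>PM\<^esub> x)"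
      using xc k(1) by algebra
    also have "\<dots> \<in> W" by (rule Wm(5)[OF mm(2) Wm(6)[OF k(1) mm(1)]])
    finally have "(\<zero>\<^bsub>P\<^esub>, f' (a \<odot>\<^bsub>P\<^esub> k) \<ominus>\<^bsub>M\<^esub> a \<odot>\<^bsub>M\<^esub> f' k) \<in> W"
      using f'M(1)[OF k(2)] f'M(1)[OF ak] K_mem(1)[OF ak] k(1) K_mem(1)[OF k(2)] unfolding z_def y_def
      by (simp add: pm P.minus_eq P.r_neg)
    then show "cong_mod M Z (f' (a \<odot>\<^bsub>P\<^esub> k)) (a \<odot>\<^bsub>M\<^esub> f' k)"
      using W_zeroD f'M(1)[OF k(2)] f'M(1)[OF ak] k(1) by (simp add: cong_mod_def)
  qed (rule f'(2))
  ultimately show ?thesis by blast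
qed

end

section \<open>Subquotients with prime annihilator\<close>

lemma (in noetherian_ring) maximal_ideal_exists:
  assumes "I \<in> \<J>" "\<And>J. J \<in> \<J> \<Longrightarrow> ideal J R"
  shows "\<exists>J \<in> \<J>. \<forall>J' \<in> \<J>. J \<subseteq> J' \<longrightarrow> J' = J"
proof (rule subset_Zorn_nonempty)
  show "\<J> \<noteq> {}" using assms(1) by blast
  fix \<C> assume C: "\<C> \<noteq> {}" "subset.chain \<J> \<C>"
  then have "subset.chain {I. ideal I R} \<C>"
    using assms(2) by (auto simp: pred_on.chain_def)
  then have "\<Union>\<C> \<in> \<C>" by (rule ideal_chain_is_trivial[OF C(1)])
  then show "\<Union>\<C> \<in> \<J>" using C(2) by (auto simp: pred_on.chain_def)
qed

text \<open>Let \<open>e\<close> enumerate elements of \<open>q - p\<close>, one for each prime ideal \<open>q\<close> strictly above \<open>p\<close>. If no product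
  \<open>t\<^sub>m\<close> were in the ideal generated by \<open>p\<close> and \<open>r\<close>, then this ideal would be contained in an ideal maximal
  with this property. Such an ideal is prime by the usual argument, as the product of two \<open>t\<^sub>m\<close> divides
  another one, but it contains some \<open>e\<^sub>n\<close> and hence \<open>t\<^sub>n\<^sub>+\<^sub>1\<close>.\<close>

lemma meeting_sequence:
  fixes R :: "('a, 'r) ring_scheme"
  assumes R: "cring R" and N: "noetherian_ring R" and count: "countable (spectrum R)" and p: "primeideal p R"
  shows "\<exists>e. (\<forall>n. e n \<in> carrier R) \<and> (\<forall>n. step R e n \<notin> p) \<and>
    (\<forall>r \<in> carrier R - p. \<exists>m. \<exists>u \<in> carrier R. u \<otimes>\<^bsub>R\<^esub> r \<ominus>\<^bsub>R\<^esub> tele R e m \<in> p)"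
proof -
  interpret R: cring R by (rule R)
  interpret N: noetherian_ring R by (rule N)
  interpret p: primeideal p R by (rule p)
  define \<Q> where "\<Q> = {q. primeideal q R \<and> p \<subset> q}"
  have cQ: "countable \<Q>" by (rule countable_subset[OF _ count]) (auto simp: \<Q>_def spectrum_def)
  have "\<forall>q \<in> \<Q>. \<exists>c. c \<in> q - p" by (auto simp: \<Q>_def)
  then obtain c where c: "\<And>q. q \<in> \<Q> \<Longrightarrow> c q \<in> q - p" by metis
  have one: "\<one>\<^bsub>R\<^esub> \<notin> p" using p.I_notcarr p.one_imp_carrier by blast
  define e where "e n = (if \<Q> = {} then \<one>\<^bsub>R\<^esub> else c (from_nat_into \<Q> n))" for n
  have e: "e n \<in> carrier R - p" for n
  proof (cases "\<Q> = {}")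
    case False
    then have q: "from_nat_into \<Q> n \<in> \<Q>" by (rule from_nat_into)
    then interpret q: primeideal "from_nat_into \<Q> n" R by (simp add: \<Q>_def)
    show ?thesis using c[OF q] q.a_subset False by (auto simp: e_def)
  qed (use one in \<open>simp add: e_def\<close>)
  have eR: "e n \<in> carrier R" for n using e by blast
  have hit: "\<exists>n. e n \<in> q" if q: "q \<in> \<Q>" for q
  proof -
    obtain n where "from_nat_into \<Q> n = q" using from_nat_into_surj[OF cQ q] by blast
    then show ?thesis using c[OF q] q by (intro exI[of _ n]) (auto simp: e_def)
  qed
  note te = R.tele_closed[of e, OF eR]
  have tp: "tele R e n \<notin> p" for n
  proof (induct n)
    case (Suc n)
    show ?case
    proof
      assume "tele R e (Suc n) \<in> p"
      then have "tele R e n \<in> p \<or> tele R e n \<otimes>\<^bsub>R\<^esub> e n \<in> p" using p.I_prime te(1) eR by simp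
      then show False using Suc p.I_prime[OF te(1)[of n] eR[of n]] e[of n] by auto
    qed
  qed (use one in simp)
  have sp: "step R e n \<notin> p" for n
    using p.I_prime[OF te(1)[of n] eR[of n]] tp[of n] e[of n] by (auto simp: step_def)
  have "\<exists>m. \<exists>u \<in> carrier R. u \<otimes>\<^bsub>R\<^esub> r \<ominus>\<^bsub>R\<^esub> tele R e m \<in> p" if r: "r \<in> carrier R" "r \<notin> p" for r
  proof (rule ccontr)
    assume no: "\<not> ?thesis"
    have add_gen: "ideal (J <+>\<^bsub>R\<^esub> PIdl\<^bsub>R\<^esub> a) R" "J \<subseteq> J <+>\<^bsub>R\<^esub> PIdl\<^bsub>R\<^esub> a" "a \<in> J <+>\<^bsub>R\<^esub> PIdl\<^bsub>R\<^esub> a"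
      "\<And>x. x \<in> J <+>\<^bsub>R\<^esub> PIdl\<^bsub>R\<^esub> a \<Longrightarrow> \<exists>j \<in> J. \<exists>u \<in> carrier R. x = j \<oplus>\<^bsub>R\<^esub> u \<otimes>\<^bsub>R\<^esub> a"
      if J: "ideal J R" and a: "a \<in> carrier R" for J a
    proof -
      interpret J: ideal J R by (rule J)
      show "ideal (J <+>\<^bsub>R\<^esub> PIdl\<^bsub>R\<^esub> a) R" by (rule R.add_ideals[OF J R.cgenideal_ideal[OF a]])
      have z: "\<zero>\<^bsub>R\<^esub> \<in> PIdl\<^bsub>R\<^esub> a" using a by (auto simp: cgenideal_def intro!: exI[of _ "\<zero>\<^bsub>R\<^esub>"])
      show "J \<subseteq> J <+>\<^bsub>R\<^esub> PIdl\<^bsub>R\<^esub> a"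
      proof
        fix x assume x: "x \<in> J"
        then have "x = x \<oplus>\<^bsub>R\<^esub> \<zero>\<^bsub>R\<^esub>" using J.a_subset by auto
        then show "x \<in> J <+>\<^bsub>R\<^esub> PIdl\<^bsub>R\<^esub> a" using x z unfolding set_add_def' by blast
      qed
      have "a = \<zero>\<^bsub>R\<^esub> \<oplus>\<^bsub>R\<^esub> a" using a by simp
      then show "a \<in> J <+>\<^bsub>R\<^esub> PIdl\<^bsub>R\<^esub> a"
        using J.zero_closed R.cgenideal_self[OF a] unfolding set_add_def' by blast
      show "\<exists>j \<in> J. \<exists>u \<in> carrier R. x = j \<oplus>\<^bsub>R\<^esub> u \<otimes>\<^bsub>R\<^esub> a" if "x \<in> J <+>\<^bsub>R\<^esub> PIdl\<^bsub>R\<^esub> a" for x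
        using that by (auto simp: set_add_def' cgenideal_def)
    qed
    define \<J> where "\<J> = {J. ideal J R \<and> p \<subseteq> J \<and> r \<in> J \<and> (\<forall>m. tele R e m \<notin> J)}"
    have J0: "p <+>\<^bsub>R\<^esub> PIdl\<^bsub>R\<^esub> r \<in> \<J>"
    proof -
      have "tele R e m \<notin> p <+>\<^bsub>R\<^esub> PIdl\<^bsub>R\<^esub> r" for m
      proof
        assume "tele R e m \<in> p <+>\<^bsub>R\<^esub> PIdl\<^bsub>R\<^esub> r"
        then obtain j u where j: "j \<in> p" "u \<in> carrier R" "tele R e m = j \<oplus>\<^bsub>R\<^esub> u \<otimes>\<^bsub>R\<^esub> r"
          using add_gen(4)[OF p.is_ideal r(1)] by blast
        have "u \<otimes>\<^bsub>R\<^esub> r \<ominus>\<^bsub>R\<^esub> (j \<oplus>\<^bsub>R\<^esub> u \<otimes>\<^bsub>R\<^esub> r) = \<ominus>\<^bsub>R\<^esub> j"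
          using p.a_Hcarr[OF j(1)] j(2) r(1) by algebra
        then have "u \<otimes>\<^bsub>R\<^esub> r \<ominus>\<^bsub>R\<^esub> tele R e m \<in> p" unfolding j(3) using p.a_inv_closed[OF j(1)] by simp
        then show False using no j(2) by blast
      qed
      then show ?thesis using add_gen(1-3)[OF p.is_ideal r(1)] by (simp add: \<J>_def)
    qed
    have "ideal J R" if "J \<in> \<J>" for J using that by (simp add: \<J>_def)
    then obtain J where J: "J \<in> \<J>" "\<And>J'. J' \<in> \<J> \<Longrightarrow> J \<subseteq> J' \<Longrightarrow> J' = J"
      using N.maximal_ideal_exists[OF J0] by metis
    then have Jd: "ideal J R" "p \<subseteq> J" "r \<in> J" "\<And>m. tele R e m \<notin> J" by (auto simp: \<J>_def)
    interpret J: ideal J R by (rule Jd)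
    have enlarge: "\<exists>m. \<exists>j \<in> J. \<exists>u \<in> carrier R. tele R e m = j \<oplus>\<^bsub>R\<^esub> u \<otimes>\<^bsub>R\<^esub> a" if a: "a \<in> carrier R" "a \<notin> J" for a
    proof -
      have "J <+>\<^bsub>R\<^esub> PIdl\<^bsub>R\<^esub> a \<notin> \<J>" using J(2) add_gen(2,3)[OF Jd(1) a(1)] a(2) by blast
      then obtain m where "tele R e m \<in> J <+>\<^bsub>R\<^esub> PIdl\<^bsub>R\<^esub> a"
        using add_gen(1,2)[OF Jd(1) a(1)] Jd(2,3) by (auto simp: \<J>_def)
      then show ?thesis using add_gen(4)[OF Jd(1) a(1)] by blast
    qed
    have "primeideal J R"
    proof (rule primeidealI[OF Jd(1) R])
      show "carrier R \<noteq> J" using Jd(4)[of 0] by auto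
      fix a b assume ab: "a \<in> carrier R" "b \<in> carrier R" "a \<otimes>\<^bsub>R\<^esub> b \<in> J"
      show "a \<in> J \<or> b \<in> J"
      proof (rule ccontr)
        assume "\<not> (a \<in> J \<or> b \<in> J)"
        then obtain m j u m' j' u' where
          j: "j \<in> J" "u \<in> carrier R" "tele R e m = j \<oplus>\<^bsub>R\<^esub> u \<otimes>\<^bsub>R\<^esub> a" and
          j': "j' \<in> J" "u' \<in> carrier R" "tele R e m' = j' \<oplus>\<^bsub>R\<^esub> u' \<otimes>\<^bsub>R\<^esub> b"
          using enlarge[OF ab(1)] enlarge[OF ab(2)] by blast
        define n where "n = max m m'"
        obtain v where v: "v \<in> carrier R" "tele R e n = tele R e m \<otimes>\<^bsub>R\<^esub> v" using R.tele_dvd[of e m n] eR by (auto simp: n_def)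
        obtain v' where v': "v' \<in> carrier R" "tele R e n = tele R e m' \<otimes>\<^bsub>R\<^esub> v'" using R.tele_dvd[of e m' n] eR by (auto simp: n_def)
        have "(j \<oplus>\<^bsub>R\<^esub> u \<otimes>\<^bsub>R\<^esub> a) \<otimes>\<^bsub>R\<^esub> (j' \<oplus>\<^bsub>R\<^esub> u' \<otimes>\<^bsub>R\<^esub> b) =
            (j' \<oplus>\<^bsub>R\<^esub> u' \<otimes>\<^bsub>R\<^esub> b) \<otimes>\<^bsub>R\<^esub> j \<oplus>\<^bsub>R\<^esub> ((u \<otimes>\<^bsub>R\<^esub> a) \<otimes>\<^bsub>R\<^esub> j' \<oplus>\<^bsub>R\<^esub> (u \<otimes>\<^bsub>R\<^esub> u') \<otimes>\<^bsub>R\<^esub> (a \<otimes>\<^bsub>R\<^esub> b))"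
          using j(1)[THEN J.a_Hcarr] j(2) j'(1)[THEN J.a_Hcarr] j'(2) ab(1,2) by algebra
        also have "\<dots> \<in> J"
          using j(1)[THEN J.a_Hcarr] j(2) j'(1)[THEN J.a_Hcarr] j'(2) ab
            J.I_l_closed[OF j(1), of "j' \<oplus>\<^bsub>R\<^esub> u' \<otimes>\<^bsub>R\<^esub> b"] J.I_l_closed[OF j'(1), of "u \<otimes>\<^bsub>R\<^esub> a"]
            J.I_l_closed[OF ab(3), of "u \<otimes>\<^bsub>R\<^esub> u'"]
          by (intro J.a_closed) auto
        finally have mm: "tele R e m \<otimes>\<^bsub>R\<^esub> tele R e m' \<in> J" using j(3) j'(3) by simp
        have "(v \<otimes>\<^bsub>R\<^esub> v' \<otimes>\<^bsub>R\<^esub> e n) \<otimes>\<^bsub>R\<^esub> (tele R e m \<otimes>\<^bsub>R\<^esub> tele R e m') \<in> J"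
          by (rule J.I_l_closed[OF mm]) (use v(1) v'(1) eR in auto)
        moreover have "tele R e (Suc n) = (tele R e m \<otimes>\<^bsub>R\<^esub> v) \<otimes>\<^bsub>R\<^esub> ((tele R e m' \<otimes>\<^bsub>R\<^esub> v') \<otimes>\<^bsub>R\<^esub> e n)"
          unfolding v(2)[symmetric] v'(2)[symmetric] by simp
        moreover have "\<dots> = (v \<otimes>\<^bsub>R\<^esub> v' \<otimes>\<^bsub>R\<^esub> e n) \<otimes>\<^bsub>R\<^esub> (tele R e m \<otimes>\<^bsub>R\<^esub> tele R e m')"
          using v(1) v'(1) eR[of n] te(1)[of m] te(1)[of m'] by algebra
        ultimately show False using Jd(4)[of "Suc n"] by metis
      qed
    qed
    then have "J \<in> \<Q>" using Jd(2,3) r(2) by (auto simp: \<Q>_def)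
    then obtain n where "e n \<in> J" using hit by blast
    then have "tele R e (Suc n) \<in> J" using te(1)[of n] by (simp add: J.I_l_closed)
    then show False using Jd(4) by blast
  qed
  then show ?thesis using eR sp by blast
qed

context ambient begin

lemma annihilator_multiples:
  assumes s: "subquotient H Z" and a: "a \<in> carrier R" shows "a \<in> annihilator H (multiples a H Z)"
proof -
  note sD = subquotientD[OF s]
  have "a \<odot>\<^bsub>M\<^esub> h \<in> multiples a H Z" if "h \<in> H" for h
    using cong_mod_refl[OF sD(2), of "a \<odot>\<^bsub>M\<^esub> h"] a sD(4)[OF that] that by (auto simp: multiples_def)
  then show ?thesis using a by (simp add: annihilator_def)
qed

text \<open>Multiplication by \<open>c\<close> is surjective on the first Ext group with values in \<open>D = H/Z\<close>: \<open>D/c D\<close> has a larger annihilator, which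
  reduces the problem to maps into \<open>c D\<close>.\<close>

lemma division_step:
  assumes s: "subquotient H Z" and t: "telescoping R M H Z" and c: "c \<in> carrier R" "c \<notin> annihilator H Z"
    and IH: "\<And>H' Z'. subquotient H' Z' \<Longrightarrow> telescoping R M H' Z' \<Longrightarrow> annihilator H Z \<subset> annihilator H' Z' \<Longrightarrow> extensible H' Z'"
    and f: "quasilinear H Z f"
  shows "\<exists>f' g. quasilinear H Z f' \<and> linear R P M g \<and> (\<forall>y \<in> carrier P. g y \<in> H) \<and>
    (\<forall>k \<in> K. cong_mod M Z (f k) (c \<odot>\<^bsub>M\<^esub> f' k \<oplus>\<^bsub>M\<^esub> g k))"
proof -
  note sD = subquotientD[OF s]
  note s1 = multiples_subquotient[OF s c(1)]
  have "annihilator H Z \<subset> annihilator H (multiples c H Z)"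
  proof -
    have "c \<in> annihilator H (multiples c H Z)" by (rule annihilator_multiples[OF s c(1)])
    then show ?thesis using c(2) subquotientD(3)[OF s1(2)] by (auto simp: annihilator_def)
  qed
  then have "extensible H (multiples c H Z)" using IH[OF s1(1) telescoping_multiples(1)[OF s t c(1)]] by blast
  moreover have "quasilinear H (multiples c H Z) f"
    using f cong_mod_mono[OF _ subquotientD(3)[OF s1(2)]] unfolding quasilinear_def by blast
  ultimately obtain g where g: "linear R P M g" "\<And>y. y \<in> carrier P \<Longrightarrow> g y \<in> H" "\<And>k. k \<in> K \<Longrightarrow> cong_mod M (multiples c H Z) (f k) (g k)"
    unfolding extensible_def by blast
  note q = quasilinear_diff_linear[OF s f g(1,2)]
  have "quasilinear (multiples c H Z) Z (\<lambda>k. f k \<ominus>\<^bsub>M\<^esub> g k)"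
    using q g(3) unfolding quasilinear_def cong_mod_def by blast
  from division_lift[OF s c IH this]
  obtain f' where f': "quasilinear H Z f'" "\<And>k. k \<in> K \<Longrightarrow> cong_mod M Z (f k \<ominus>\<^bsub>M\<^esub> g k) (c \<odot>\<^bsub>M\<^esub> f' k)" by blast
  have "cong_mod M Z (f k) (c \<odot>\<^bsub>M\<^esub> f' k \<oplus>\<^bsub>M\<^esub> g k)" if k: "k \<in> K" for k
  proof -
    have gc: "g k \<in> carrier M" "f k \<in> carrier M"
      using linear_closed[OF g(1) K_mem(1)[OF k]] quasilinearD(1)[OF f k] sD(4) by auto
    have "f k = (f k \<ominus>\<^bsub>M\<^esub> g k) \<oplus>\<^bsub>M\<^esub> g k" using gc by algebra
    then show ?thesis using cong_mod_add[OF sD(2) f'(2)[OF k] cong_mod_refl[OF sD(2) gc(1)]] by simp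
  qed
  then show ?thesis using f'(1) g(1,2) by blast
qed

text \<open>
  A compatible family is a map from \<open>K\<close> into the limit of \<open>H/Z\<close> along the multiplications \<open>s\<^sub>n\<close>, on which all
  elements outside the prime \<open>p\<close> act bijectively. Let \<open>D\<close> be a submodule of \<open>P\<close> that contains \<open>p P\<close> and
  is maximal among those with intersection \<open>p K\<close> with \<open>K\<close>. Then for each \<open>y\<close> in \<open>P\<close> some
  multiple \<open>t\<^sub>m y\<close> lies in \<open>K + D\<close>, so after tensoring with the residue field, \<open>D\<close> becomes a complement of \<open>K\<close>.
  The extension is zero on \<open>D\<close>: if \<open>t\<^sub>m y - k\<close> is in \<open>D\<close>, the value at \<open>y\<close> is \<open>f\<^sub>m k\<close>, which is \<open>f\<^sub>0 k\<close> divided by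
  \<open>t\<^sub>m\<close> in the limit.
\<close>

lemma compatible_family_extends:
  assumes s: "subquotient H Z" and p: "primeideal (annihilator H Z) R" and e: "\<And>n. e n \<in> carrier R"
    and inv: "\<And>r. r \<in> carrier R - annihilator H Z \<Longrightarrow> \<exists>m. \<exists>u \<in> carrier R. u \<otimes>\<^bsub>R\<^esub> r \<ominus>\<^bsub>R\<^esub> tele R e m \<in> annihilator H Z"
    and f: "\<And>n. quasilinear H Z (f n)" and comp: "\<And>n k. k \<in> K \<Longrightarrow> cong_mod M Z (f n k) (step R e n \<odot>\<^bsub>M\<^esub> f (Suc n) k)"
  shows "\<exists>g. linear R P M g \<and> (\<forall>y \<in> carrier P. g y \<in> H) \<and> (\<forall>k \<in> K. cong_mod M Z (f 0 k) (g k))"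
proof -
  note sD = subquotientD[OF s]
  interpret p: primeideal "annihilator H Z" R by (rule p)
  note te = R.tele_closed[of e, OF e]
  define Q where "Q = {y \<in> carrier P. \<forall>b. y b \<in> annihilator H Z}"
  have Q: "submodule Q R P"
    by (rule P.submodule_of_scalar_closed)
       (auto simp: Q_def free_module_sel(2-4) p.a_closed p.I_l_closed intro: P.a_closed[unfolded free_module_sel(3)] P.smult_closed[unfolded free_module_sel(4)] P.zero_closed[unfolded free_module_sel(2)])
  have Qsm: "r \<odot>\<^bsub>P\<^esub> y \<in> Q" if "r \<in> annihilator H Z" "y \<in> carrier P" for r y
  proof -
    have "r \<in> carrier R" using that p.a_Hcarr by blast
    then show ?thesis using that P.smult_closed[of r y] R.free_module_coord(1)[OF that(2)]
      by (auto simp: Q_def free_module_sel(4) p.I_r_closed)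
  qed
  define \<A> where "\<A> = {D. submodule D R P \<and> Q \<subseteq> D \<and> D \<inter> K \<subseteq> Q}"
  have "\<exists>D \<in> \<A>. \<forall>D' \<in> \<A>. D \<subseteq> D' \<longrightarrow> D' = D"
  proof (rule subset_Zorn_nonempty)
    show "\<A> \<noteq> {}" using Q by (auto simp: \<A>_def)
    fix \<C> assume C: "\<C> \<noteq> {}" "subset.chain \<A> \<C>"
    then have CA: "\<C> \<subseteq> \<A>" by (auto simp: pred_on.chain_def)
    have Cs: "submodule D R P" if "D \<in> \<C>" for D using that CA by (auto simp: \<A>_def)
    have "submodule (\<Union>\<C>) R P"
    proof (rule P.submodule_of_scalar_closed)
      show "\<Union>\<C> \<subseteq> carrier P" using P.submodule_mem(1)[OF Cs] by blast
      show "\<zero>\<^bsub>P\<^esub> \<in> \<Union>\<C>" using C(1) P.submodule_mem(2)[OF Cs] by blast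
    next
      fix x y assume "x \<in> \<Union>\<C>" "y \<in> \<Union>\<C>"
      then obtain D D' where D: "x \<in> D" "D \<in> \<C>" "y \<in> D'" "D' \<in> \<C>" by blast
      then have "D \<subseteq> D' \<or> D' \<subseteq> D" using C(2) unfolding pred_on.chain_def by blast
      then show "x \<oplus>\<^bsub>P\<^esub> y \<in> \<Union>\<C>" using D P.submodule_mem(3)[OF Cs] by (metis UnionI subsetD)
    next
      fix a x assume "a \<in> carrier R" "x \<in> \<Union>\<C>"
      then show "a \<odot>\<^bsub>P\<^esub> x \<in> \<Union>\<C>" using P.submodule_mem(6)[OF Cs] by blast
    qed
    then show "\<Union>\<C> \<in> \<A>" using CA C(1) unfolding \<A>_def by blast
  qed
  then obtain D where D: "submodule D R P" "Q \<subseteq> D" "D \<inter> K \<subseteq> Q"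
    and Dmax: "\<And>D'. submodule D' R P \<Longrightarrow> D \<subseteq> D' \<Longrightarrow> D' \<inter> K \<subseteq> Q \<Longrightarrow> D' = D"
    by (auto simp: \<A>_def)
  note Dm = P.submodule_mem[OF D(1)]
  have split: "\<exists>m. \<exists>k \<in> K. tele R e m \<odot>\<^bsub>P\<^esub> y \<ominus>\<^bsub>P\<^esub> k \<in> D" if y: "y \<in> carrier P" for y
  proof (cases "y \<in> D")
    case True
    then have "tele R e 0 \<odot>\<^bsub>P\<^esub> y \<ominus>\<^bsub>P\<^esub> \<zero>\<^bsub>P\<^esub> \<in> D" using Dm(2,5) y by simp
    then show ?thesis using K_mem(2) by blast
  next
    case False
    define D' where "D' = {z \<in> carrier P. \<exists>r \<in> carrier R. z \<ominus>\<^bsub>P\<^esub> r \<odot>\<^bsub>P\<^esub> y \<in> D}"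
    have "submodule D' R P"
    proof (rule P.submodule_of_scalar_closed)
      show "D' \<subseteq> carrier P" by (auto simp: D'_def)
      have "\<zero>\<^bsub>P\<^esub> \<ominus>\<^bsub>P\<^esub> \<zero>\<^bsub>R\<^esub> \<odot>\<^bsub>P\<^esub> y = \<zero>\<^bsub>P\<^esub>" using y by algebra
      then show "\<zero>\<^bsub>P\<^esub> \<in> D'" using Dm(2) by (auto simp: D'_def intro!: bexI[of _ "\<zero>\<^bsub>R\<^esub>"])
    next
      fix z z' assume "z \<in> D'" "z' \<in> D'"
      then obtain r r' where h: "z \<in> carrier P" "z' \<in> carrier P" "r \<in> carrier R" "r' \<in> carrier R"
        "z \<ominus>\<^bsub>P\<^esub> r \<odot>\<^bsub>P\<^esub> y \<in> D" "z' \<ominus>\<^bsub>P\<^esub> r' \<odot>\<^bsub>P\<^esub> y \<in> D" by (auto simp: D'_def)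
      have "(z \<oplus>\<^bsub>P\<^esub> z') \<ominus>\<^bsub>P\<^esub> (r \<oplus>\<^bsub>R\<^esub> r') \<odot>\<^bsub>P\<^esub> y = (z \<ominus>\<^bsub>P\<^esub> r \<odot>\<^bsub>P\<^esub> y) \<oplus>\<^bsub>P\<^esub> (z' \<ominus>\<^bsub>P\<^esub> r' \<odot>\<^bsub>P\<^esub> y)"
        using h(1-4) y by algebra
      then show "z \<oplus>\<^bsub>P\<^esub> z' \<in> D'" using h Dm(3)[OF h(5,6)] by (auto simp: D'_def intro!: bexI[of _ "r \<oplus>\<^bsub>R\<^esub> r'"])
    next
      fix a z assume a: "a \<in> carrier R" and "z \<in> D'"
      then obtain r where h: "z \<in> carrier P" "r \<in> carrier R" "z \<ominus>\<^bsub>P\<^esub> r \<odot>\<^bsub>P\<^esub> y \<in> D" by (auto simp: D'_def)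
      have "a \<odot>\<^bsub>P\<^esub> z \<ominus>\<^bsub>P\<^esub> (a \<otimes>\<^bsub>R\<^esub> r) \<odot>\<^bsub>P\<^esub> y = a \<odot>\<^bsub>P\<^esub> (z \<ominus>\<^bsub>P\<^esub> r \<odot>\<^bsub>P\<^esub> y)"
        using h(1,2) y a by algebra
      then show "a \<odot>\<^bsub>P\<^esub> z \<in> D'" using h a Dm(6)[OF a h(3)] by (auto simp: D'_def intro!: bexI[of _ "a \<otimes>\<^bsub>R\<^esub> r"])
    qed
    moreover have "D \<subseteq> D'"
    proof
      fix z assume z: "z \<in> D"
      then have "z \<ominus>\<^bsub>P\<^esub> \<zero>\<^bsub>R\<^esub> \<odot>\<^bsub>P\<^esub> y = z" using Dm(1)[OF z] y by algebra
      then show "z \<in> D'" using z Dm(1)[OF z] by (auto simp: D'_def intro!: bexI[of _ "\<zero>\<^bsub>R\<^esub>"])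
    qed
    moreover have "y \<in> D'"
    proof -
      have "y \<ominus>\<^bsub>P\<^esub> \<one>\<^bsub>R\<^esub> \<odot>\<^bsub>P\<^esub> y = \<zero>\<^bsub>P\<^esub>" using y by algebra
      then show ?thesis using y Dm(2) by (auto simp: D'_def intro!: bexI[of _ "\<one>\<^bsub>R\<^esub>"])
    qed
    ultimately obtain z where z: "z \<in> D'" "z \<in> K" "z \<notin> Q" using Dmax[of D'] False by blast
    then obtain r where r: "z \<in> carrier P" "r \<in> carrier R" "z \<ominus>\<^bsub>P\<^esub> r \<odot>\<^bsub>P\<^esub> y \<in> D" by (auto simp: D'_def)
    have "r \<notin> annihilator H Z"
    proof
      assume "r \<in> annihilator H Z"
      then have "r \<odot>\<^bsub>P\<^esub> y \<in> D" using Qsm[OF _ y] D(2) by blast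
      then have "(z \<ominus>\<^bsub>P\<^esub> r \<odot>\<^bsub>P\<^esub> y) \<oplus>\<^bsub>P\<^esub> r \<odot>\<^bsub>P\<^esub> y \<in> D" using Dm(3)[OF r(3)] by blast
      moreover have "(z \<ominus>\<^bsub>P\<^esub> r \<odot>\<^bsub>P\<^esub> y) \<oplus>\<^bsub>P\<^esub> r \<odot>\<^bsub>P\<^esub> y = z" using r(1,2) y by algebra
      ultimately show False using z D(3) by auto
    qed
    then obtain m u where u: "u \<in> carrier R" "u \<otimes>\<^bsub>R\<^esub> r \<ominus>\<^bsub>R\<^esub> tele R e m \<in> annihilator H Z" using inv[of r] r(2) by blast
    have "tele R e m \<odot>\<^bsub>P\<^esub> y \<ominus>\<^bsub>P\<^esub> u \<odot>\<^bsub>P\<^esub> z =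
      \<ominus>\<^bsub>P\<^esub> ((u \<otimes>\<^bsub>R\<^esub> r \<ominus>\<^bsub>R\<^esub> tele R e m) \<odot>\<^bsub>P\<^esub> y) \<ominus>\<^bsub>P\<^esub> u \<odot>\<^bsub>P\<^esub> (z \<ominus>\<^bsub>P\<^esub> r \<odot>\<^bsub>P\<^esub> y)"
      using r(1,2) u(1) te(1)[of m] y by algebra
    also have "\<dots> \<in> D"
      using Dm(4)[OF subsetD[OF D(2) Qsm[OF u(2) y]]] Dm(6)[OF u(1) r(3)] by (rule Dm(5))
    finally show ?thesis using K_mem(6)[OF u(1) z(2)] by blast
  qed
  \<comment> \<open>\<open>E y v m\<close> says that \<open>v\<close> is the value at \<open>y\<close>, computed with the denominator \<open>t\<^sub>m\<close>.\<close>
  define E where "E y v m \<longleftrightarrow> (\<exists>k \<in> K. tele R e m \<odot>\<^bsub>P\<^esub> y \<ominus>\<^bsub>P\<^esub> k \<in> D \<and> cong_mod M Z v (f m k))" for y v m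
  have fM: "f n k \<in> carrier M" if "k \<in> K" for n k using quasilinearD(1)[OF f that] sD(4) by blast
  have E_Suc: "E y v (Suc m)" if E: "E y v m" and y: "y \<in> carrier P" for y v m
  proof -
    obtain k where k: "k \<in> K" "tele R e m \<odot>\<^bsub>P\<^esub> y \<ominus>\<^bsub>P\<^esub> k \<in> D" "cong_mod M Z v (f m k)" using E by (auto simp: E_def)
    have "tele R e (Suc m) \<odot>\<^bsub>P\<^esub> y \<ominus>\<^bsub>P\<^esub> step R e m \<odot>\<^bsub>P\<^esub> k = step R e m \<odot>\<^bsub>P\<^esub> (tele R e m \<odot>\<^bsub>P\<^esub> y \<ominus>\<^bsub>P\<^esub> k)"
      unfolding R.tele_Suc using y K_mem(1)[OF k(1)] te(1)[of m] te(2)[of m] by algebra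
    then have "tele R e (Suc m) \<odot>\<^bsub>P\<^esub> y \<ominus>\<^bsub>P\<^esub> step R e m \<odot>\<^bsub>P\<^esub> k \<in> D" using Dm(6)[OF te(2) k(2)] by simp
    moreover have "cong_mod M Z v (f (Suc m) (step R e m \<odot>\<^bsub>P\<^esub> k))"
      using cong_mod_trans[OF sD(2) k(3)] cong_mod_trans[OF sD(2) comp[OF k(1)]] cong_mod_sym[OF sD(2) quasilinearD(3)[OF f te(2) k(1)]] by blast
    ultimately show ?thesis unfolding E_def using K_mem(6)[OF te(2) k(1)] by blast
  qed
  have E_mono: "E y v n" if "E y v m" "y \<in> carrier P" "m \<le> n" for y v m n
    using that(3,1) by (induct n rule: dec_induct) (auto intro: E_Suc[OF _ that(2)])
  have "\<forall>b \<in> B. \<exists>v. v \<in> H \<and> (\<exists>m. E (basis_vector R b) v m)"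
  proof
    fix b assume "b \<in> B"
    then obtain m k where k: "k \<in> K" "tele R e m \<odot>\<^bsub>P\<^esub> basis_vector R b \<ominus>\<^bsub>P\<^esub> k \<in> D" using split[OF R.basis_vector_closed] by blast
    then have "E (basis_vector R b) (f m k) m" using cong_mod_refl[OF sD(2) fM] by (auto simp: E_def)
    then show "\<exists>v. v \<in> H \<and> (\<exists>m. E (basis_vector R b) v m)" using quasilinearD(1)[OF f k(1)] by blast
  qed
  then obtain v where v: "\<And>b. b \<in> B \<Longrightarrow> v b \<in> H" "\<And>b. b \<in> B \<Longrightarrow> \<exists>m. E (basis_vector R b) (v b) m" by metis
  obtain g where g: "linear R P M g" "\<forall>y \<in> carrier P. g y \<in> H" "\<forall>b \<in> B. g (basis_vector R b) = v b"
    using linear_map_from_basis[of v, OF v(1) sD(1)] by blast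
  have "submodule {y \<in> carrier P. \<exists>m. E y (g y) m} R P"
  proof (rule P.submodule_of_scalar_closed)
    have "E \<zero>\<^bsub>P\<^esub> (g \<zero>\<^bsub>P\<^esub>) 0"
      unfolding E_def linear_zero[OF P.module_axioms M_module g(1)]
      using K_mem(2) Dm(2,5) quasilinear_zero[OF s f] cong_mod_sym[OF sD(2)] cong_mod_zero_iff[OF sD(2)]
      by (intro bexI[of _ "\<zero>\<^bsub>P\<^esub>"]) (auto simp: te(1))
    then show "\<zero>\<^bsub>P\<^esub> \<in> {y \<in> carrier P. \<exists>m. E y (g y) m}" by auto
  next
    fix x y assume "x \<in> {y \<in> carrier P. \<exists>m. E y (g y) m}" "y \<in> {y \<in> carrier P. \<exists>m. E y (g y) m}"
    then obtain m n where mn: "x \<in> carrier P" "y \<in> carrier P" "E x (g x) m" "E y (g y) n" by blast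
    define l where "l = max m n"
    have "E x (g x) l" "E y (g y) l" using E_mono[OF mn(3,1), of l] E_mono[OF mn(4,2), of l] by (auto simp: l_def)
    then obtain k k' where k: "k \<in> K" "tele R e l \<odot>\<^bsub>P\<^esub> x \<ominus>\<^bsub>P\<^esub> k \<in> D" "cong_mod M Z (g x) (f l k)"
      and k': "k' \<in> K" "tele R e l \<odot>\<^bsub>P\<^esub> y \<ominus>\<^bsub>P\<^esub> k' \<in> D" "cong_mod M Z (g y) (f l k')" by (auto simp: E_def)
    have "tele R e l \<odot>\<^bsub>P\<^esub> (x \<oplus>\<^bsub>P\<^esub> y) \<ominus>\<^bsub>P\<^esub> (k \<oplus>\<^bsub>P\<^esub> k') = (tele R e l \<odot>\<^bsub>P\<^esub> x \<ominus>\<^bsub>P\<^esub> k) \<oplus>\<^bsub>P\<^esub> (tele R e l \<odot>\<^bsub>P\<^esub> y \<ominus>\<^bsub>P\<^esub> k')"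
      using mn(1,2) K_mem(1)[OF k(1)] K_mem(1)[OF k'(1)] te(1)[of l] by algebra
    then have "tele R e l \<odot>\<^bsub>P\<^esub> (x \<oplus>\<^bsub>P\<^esub> y) \<ominus>\<^bsub>P\<^esub> (k \<oplus>\<^bsub>P\<^esub> k') \<in> D" using Dm(3)[OF k(2) k'(2)] by simp
    moreover have "cong_mod M Z (g (x \<oplus>\<^bsub>P\<^esub> y)) (f l (k \<oplus>\<^bsub>P\<^esub> k'))"
      using cong_mod_trans[OF sD(2) cong_mod_add[OF sD(2) k(3) k'(3)] cong_mod_sym[OF sD(2) quasilinearD(2)[OF f k(1) k'(1)]]]
      by (simp add: linear_add[OF g(1) mn(1,2)])
    ultimately have "E (x \<oplus>\<^bsub>P\<^esub> y) (g (x \<oplus>\<^bsub>P\<^esub> y)) l" unfolding E_def using K_mem(3)[OF k(1) k'(1)] by blast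
    then show "x \<oplus>\<^bsub>P\<^esub> y \<in> {y \<in> carrier P. \<exists>m. E y (g y) m}" using mn by auto
  next
    fix a y assume a: "a \<in> carrier R" and "y \<in> {y \<in> carrier P. \<exists>m. E y (g y) m}"
    then obtain l k where y: "y \<in> carrier P" and k: "k \<in> K" "tele R e l \<odot>\<^bsub>P\<^esub> y \<ominus>\<^bsub>P\<^esub> k \<in> D" "cong_mod M Z (g y) (f l k)"
      by (auto simp: E_def)
    have "tele R e l \<odot>\<^bsub>P\<^esub> (a \<odot>\<^bsub>P\<^esub> y) \<ominus>\<^bsub>P\<^esub> a \<odot>\<^bsub>P\<^esub> k = a \<odot>\<^bsub>P\<^esub> (tele R e l \<odot>\<^bsub>P\<^esub> y \<ominus>\<^bsub>P\<^esub> k)"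
      using y K_mem(1)[OF k(1)] te(1)[of l] a by algebra
    then have "tele R e l \<odot>\<^bsub>P\<^esub> (a \<odot>\<^bsub>P\<^esub> y) \<ominus>\<^bsub>P\<^esub> a \<odot>\<^bsub>P\<^esub> k \<in> D" using Dm(6)[OF a k(2)] by simp
    moreover have "cong_mod M Z (g (a \<odot>\<^bsub>P\<^esub> y)) (f l (a \<odot>\<^bsub>P\<^esub> k))"
      using cong_mod_trans[OF sD(2) cong_mod_smult[OF sD(2) a k(3)] cong_mod_sym[OF sD(2) quasilinearD(3)[OF f a k(1)]]]
      by (simp add: linear_smult[OF g(1) a y])
    ultimately have "E (a \<odot>\<^bsub>P\<^esub> y) (g (a \<odot>\<^bsub>P\<^esub> y)) l" unfolding E_def using K_mem(6)[OF a k(1)] by blast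
    then show "a \<odot>\<^bsub>P\<^esub> y \<in> {y \<in> carrier P. \<exists>m. E y (g y) m}" using y a by auto
  qed auto
  then have "carrier P \<subseteq> {y \<in> carrier P. \<exists>m. E y (g y) m}"
    by (rule R.free_module_subset) (use g(3) v(2) R.basis_vector_closed in auto)
  then have E: "\<exists>m. E y (g y) m" if "y \<in> carrier P" for y using that by blast
  have comp0: "cong_mod M Z (f 0 k) (tele R e m \<odot>\<^bsub>M\<^esub> f m k)" if k: "k \<in> K" for k m
  proof (induct m)
    case 0
    then show ?case using cong_mod_refl[OF sD(2) fM[OF k]] fM[OF k] by simp
  next
    case (Suc m)
    have "tele R e (Suc m) \<odot>\<^bsub>M\<^esub> f (Suc m) k = tele R e m \<odot>\<^bsub>M\<^esub> (step R e m \<odot>\<^bsub>M\<^esub> f (Suc m) k)"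
      unfolding R.tele_Suc using fM[OF k, of "Suc m"] te(1)[of m] te(2)[of m] by (simp add: smult_assoc1)
    then show ?case using cong_mod_trans[OF sD(2) Suc cong_mod_smult[OF sD(2) te(1) comp[OF k]]] by simp
  qed
  have "cong_mod M Z (f 0 k) (g k)" if k: "k \<in> K" for k
  proof -
    note kP = K_mem(1)[OF k]
    obtain m k' where k': "k' \<in> K" "tele R e m \<odot>\<^bsub>P\<^esub> k \<ominus>\<^bsub>P\<^esub> k' \<in> D" "cong_mod M Z (g k) (f m k')" using E[OF kP] by (auto simp: E_def)
    note tk = K_mem(6)[OF te(1) k, of m]
    have "tele R e m \<odot>\<^bsub>P\<^esub> k \<ominus>\<^bsub>P\<^esub> k' \<in> Q" using K_mem(5)[OF tk k'(1)] k'(2) D(3) by blast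
    then have "f m (tele R e m \<odot>\<^bsub>P\<^esub> k \<ominus>\<^bsub>P\<^esub> k') \<in> Z"
      using K_mem(5)[OF tk k'(1)] by (intro quasilinear_coordinates[OF s f]) (auto simp: Q_def)
    from cong_mod_mem[OF sD(2) cong_mod_sym[OF sD(2) quasilinear_diff[OF s f tk k'(1)]] this]
    have "cong_mod M Z (f m (tele R e m \<odot>\<^bsub>P\<^esub> k)) (f m k')" using fM[OF tk] fM[OF k'(1)] by (simp add: cong_mod_def)
    from cong_mod_trans[OF sD(2) cong_mod_sym[OF sD(2) quasilinearD(3)[OF f te(1) k]] this]
    have "cong_mod M Z (tele R e m \<odot>\<^bsub>M\<^esub> f m k) (f m k')" .
    from cong_mod_trans[OF sD(2) cong_mod_trans[OF sD(2) comp0[OF k] this] cong_mod_sym[OF sD(2) k'(3)]]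
    show ?thesis .
  qed
  then show ?thesis using g(1,2) by blast
qed

text \<open>Let \<open>D = H/Z\<close>. Division by \<open>s\<^sub>0\<close>, \<open>s\<^sub>1\<close>, and so on produces maps with \<open>f\<^sub>n = s\<^sub>n f\<^sub>n\<^sub>+\<^sub>1 + g\<^sub>n\<close> on \<open>K\<close>, where \<open>g\<^sub>n\<close> is
  defined on \<open>P\<close>. Because \<open>P\<close> is free and \<open>D\<close> is telescoping, one can solve \<open>h\<^sub>n - s\<^sub>n h\<^sub>n\<^sub>+\<^sub>1 = g\<^sub>n\<close> for
  maps \<open>h\<^sub>n\<close> on \<open>P\<close>, one basis vector at a time. The family of the differences of \<open>f\<^sub>n\<close> and \<open>h\<^sub>n\<close> is compatible.\<close>

lemma extensible_prime:
  assumes s: "subquotient H Z" and t: "telescoping R M H Z" and p: "primeideal (annihilator H Z) R"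
    and N: "noetherian_ring R" and count: "countable (spectrum R)"
    and IH: "\<And>H' Z'. subquotient H' Z' \<Longrightarrow> telescoping R M H' Z' \<Longrightarrow> annihilator H Z \<subset> annihilator H' Z' \<Longrightarrow> extensible H' Z'"
  shows "extensible H Z"
  unfolding extensible_def
proof (intro allI impI)
  fix f0 assume f0: "quasilinear H Z f0"
  note sD = subquotientD[OF s]
  obtain e where e: "\<And>n. e n \<in> carrier R" "\<And>n. step R e n \<notin> annihilator H Z"
    "\<And>r. r \<in> carrier R - annihilator H Z \<Longrightarrow> \<exists>m. \<exists>u \<in> carrier R. u \<otimes>\<^bsub>R\<^esub> r \<ominus>\<^bsub>R\<^esub> tele R e m \<in> annihilator H Z"
    using meeting_sequence[OF R.is_cring N count p] by blast
  note te = R.tele_closed[of e, OF e(1)]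
  define rel where "rel n f f' g \<longleftrightarrow> linear R P M g \<and> (\<forall>y \<in> carrier P. g y \<in> H) \<and>
    (\<forall>k \<in> K. cong_mod M Z (f k) (step R e n \<odot>\<^bsub>M\<^esub> f' k \<oplus>\<^bsub>M\<^esub> g k))" for n f f' g
  have "\<exists>f. \<forall>n. (quasilinear H Z (f n) \<and> (n = 0 \<longrightarrow> f n = f0)) \<and> (\<exists>g. rel n (f n) (f (Suc n)) g)"
  proof (rule dependent_nat_choice)
    show "\<exists>f. quasilinear H Z f \<and> (0 = 0 \<longrightarrow> f = f0)" using f0 by blast
    fix f and n :: nat assume "quasilinear H Z f \<and> (n = 0 \<longrightarrow> f = f0)"
    then show "\<exists>f'. (quasilinear H Z f' \<and> (Suc n = 0 \<longrightarrow> f' = f0)) \<and> (\<exists>g. rel n f f' g)"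
      using division_step[OF s t te(2)[of n] e(2)[of n] IH, of f] unfolding rel_def by blast
  qed
  then obtain f where f: "\<And>n. quasilinear H Z (f n)" "f 0 = f0" "\<And>n. \<exists>g. rel n (f n) (f (Suc n)) g" by auto
  then obtain g where "\<And>n. rel n (f n) (f (Suc n)) (g n)" by metis
  then have g: "\<And>n. linear R P M (g n)" "\<And>n y. y \<in> carrier P \<Longrightarrow> g n y \<in> H"
    "\<And>n k. k \<in> K \<Longrightarrow> cong_mod M Z (f n k) (step R e n \<odot>\<^bsub>M\<^esub> f (Suc n) k \<oplus>\<^bsub>M\<^esub> g n k)" by (auto simp: rel_def)
  have "\<forall>b. \<exists>x. b \<in> B \<longrightarrow> (\<forall>n. x n \<in> H) \<and> (\<forall>n. cong_mod M Z (x n \<ominus>\<^bsub>M\<^esub> step R e n \<odot>\<^bsub>M\<^esub> x (Suc n)) (g n (basis_vector R b)))"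
  proof
    fix b
    show "\<exists>x. b \<in> B \<longrightarrow> (\<forall>n. x n \<in> H) \<and> (\<forall>n. cong_mod M Z (x n \<ominus>\<^bsub>M\<^esub> step R e n \<odot>\<^bsub>M\<^esub> x (Suc n)) (g n (basis_vector R b)))"
      using telescopingD[OF t s, of e "\<lambda>n. g n (basis_vector R b)"] e(1) g(2)[OF R.basis_vector_closed] by blast
  qed
  then obtain x where x: "\<And>b n. b \<in> B \<Longrightarrow> x b n \<in> H"
    "\<And>b n. b \<in> B \<Longrightarrow> cong_mod M Z (x b n \<ominus>\<^bsub>M\<^esub> step R e n \<odot>\<^bsub>M\<^esub> x b (Suc n)) (g n (basis_vector R b))"
    by metis
  have "\<exists>h. linear R P M h \<and> (\<forall>y \<in> carrier P. h y \<in> H) \<and> (\<forall>b \<in> B. h (basis_vector R b) = x b n)" for n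
    by (rule linear_map_from_basis[OF x(1) sD(1)])
  then obtain h where h: "\<And>n. linear R P M (h n)" "\<And>n y. y \<in> carrier P \<Longrightarrow> h n y \<in> H"
    "\<And>n b. b \<in> B \<Longrightarrow> h n (basis_vector R b) = x b n" by metis
  note hc = linear_closed[OF h(1)] and gc = linear_closed[OF g(1)]
  have hg: "cong_mod M Z (h n y \<ominus>\<^bsub>M\<^esub> step R e n \<odot>\<^bsub>M\<^esub> h (Suc n) y) (g n y)" if y: "y \<in> carrier P" for n y
  proof -
    have l: "linear R P M (\<lambda>y. h n y \<ominus>\<^bsub>M\<^esub> step R e n \<odot>\<^bsub>M\<^esub> h (Suc n) y \<ominus>\<^bsub>M\<^esub> g n y)"
      by (rule linear_diff_maps[OF M_module linear_diff_maps[OF M_module h(1)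
            linear_scale[OF M_module h(1) te(2)]] g(1)])
    have "h n y \<ominus>\<^bsub>M\<^esub> step R e n \<odot>\<^bsub>M\<^esub> h (Suc n) y \<ominus>\<^bsub>M\<^esub> g n y \<in> Z"
      by (rule R.linear_into_submodule[OF M_module l sD(2) _ y]) (use x(2) h(3) in \<open>simp add: cong_mod_def\<close>)
    then show ?thesis using hc[OF y] gc[OF y] te(2) by (simp add: cong_mod_def)
  qed
  define f' where "f' n k = f n k \<ominus>\<^bsub>M\<^esub> h n k" for n k
  have f': "quasilinear H Z (f' n)" for n unfolding f'_def by (rule quasilinear_diff_linear[OF s f(1) h(1,2)])
  have "cong_mod M Z (f' n k) (step R e n \<odot>\<^bsub>M\<^esub> f' (Suc n) k)" if k: "k \<in> K" for n k
  proof -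
    note kP = K_mem(1)[OF k]
    have fM: "f n k \<in> carrier M" for n using quasilinearD(1)[OF f(1) k] sD(4) by blast
    define s where "s = step R e n"
    have "cong_mod M Z (f n k \<ominus>\<^bsub>M\<^esub> (h n k \<ominus>\<^bsub>M\<^esub> s \<odot>\<^bsub>M\<^esub> h (Suc n) k)) (s \<odot>\<^bsub>M\<^esub> f (Suc n) k \<oplus>\<^bsub>M\<^esub> g n k \<ominus>\<^bsub>M\<^esub> g n k)"
      unfolding s_def by (rule cong_mod_diff[OF sD(2) g(3)[OF k] hg[OF kP]])
    from cong_mod_diff[OF sD(2) this cong_mod_refl[OF sD(2), of "s \<odot>\<^bsub>M\<^esub> h (Suc n) k"]]
    have "cong_mod M Z (f n k \<ominus>\<^bsub>M\<^esub> (h n k \<ominus>\<^bsub>M\<^esub> s \<odot>\<^bsub>M\<^esub> h (Suc n) k) \<ominus>\<^bsub>M\<^esub> s \<odot>\<^bsub>M\<^esub> h (Suc n) k)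
       (s \<odot>\<^bsub>M\<^esub> f (Suc n) k \<oplus>\<^bsub>M\<^esub> g n k \<ominus>\<^bsub>M\<^esub> g n k \<ominus>\<^bsub>M\<^esub> s \<odot>\<^bsub>M\<^esub> h (Suc n) k)"
      using hc[OF kP] te(2) by (simp add: s_def)
    moreover have "f n k \<ominus>\<^bsub>M\<^esub> (h n k \<ominus>\<^bsub>M\<^esub> s \<odot>\<^bsub>M\<^esub> h (Suc n) k) \<ominus>\<^bsub>M\<^esub> s \<odot>\<^bsub>M\<^esub> h (Suc n) k = f' n k"
      "s \<odot>\<^bsub>M\<^esub> f (Suc n) k \<oplus>\<^bsub>M\<^esub> g n k \<ominus>\<^bsub>M\<^esub> g n k \<ominus>\<^bsub>M\<^esub> s \<odot>\<^bsub>M\<^esub> h (Suc n) k = s \<odot>\<^bsub>M\<^esub> f' (Suc n) k"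
      unfolding f'_def using fM[of n] fM[of "Suc n"] hc[OF kP, of n] hc[OF kP, of "Suc n"] gc[OF kP, of n] te(2)[of n, folded s_def]
      by algebra+
    ultimately show ?thesis by (simp add: s_def)
  qed
  from compatible_family_extends[OF s p e(1,3) f' this]
  obtain w where w: "linear R P M w" "\<And>y. y \<in> carrier P \<Longrightarrow> w y \<in> H" "\<And>k. k \<in> K \<Longrightarrow> cong_mod M Z (f' 0 k) (w k)" by blast
  show "\<exists>g. linear R P M g \<and> (\<forall>y \<in> carrier P. g y \<in> H) \<and> (\<forall>k \<in> K. cong_mod M Z (f0 k) (g k))"
  proof (intro exI conjI ballI)
    show "linear R P M (\<lambda>y. w y \<oplus>\<^bsub>M\<^esub> h 0 y)" by (rule linear_add_maps[OF M_module w(1) h(1)])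
    show "w y \<oplus>\<^bsub>M\<^esub> h 0 y \<in> H" if "y \<in> carrier P" for y
      by (rule submodule_mem(3)[OF sD(1) w(2)[OF that] h(2)[OF that]])
    fix k assume k: "k \<in> K"
    have c: "f0 k \<in> carrier M" "h 0 k \<in> carrier M" using quasilinearD(1)[OF f0 k] sD(4) hc[OF K_mem(1)[OF k]] by auto
    have "f' 0 k \<oplus>\<^bsub>M\<^esub> h 0 k = f0 k" unfolding f'_def f(2) using c by algebra
    then show "cong_mod M Z (f0 k) (w k \<oplus>\<^bsub>M\<^esub> h 0 k)"
      using cong_mod_add[OF sD(2) w(3)[OF k] cong_mod_refl[OF sD(2) c(2)]] by simp
  qed
qed

section \<open>Noetherian induction on the annihilator\<close>

lemma extensible_telescoping:
  assumes N: "noetherian_ring R" and count: "countable (spectrum R)"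
    and "subquotient H Z" and "telescoping R M H Z"
  shows "extensible H Z"
proof (rule ccontr)
  interpret N: noetherian_ring R by (rule N)
  define \<J> where "\<J> = {annihilator H Z | H Z. subquotient H Z \<and> telescoping R M H Z \<and> \<not> extensible H Z}"
  assume "\<not> extensible H Z"
  then have "annihilator H Z \<in> \<J>" using assms(3,4) by (auto simp: \<J>_def)
  moreover have "ideal J R" if "J \<in> \<J>" for J using that annihilator_ideal by (auto simp: \<J>_def)
  ultimately obtain J where J: "J \<in> \<J>" "\<And>J'. J' \<in> \<J> \<Longrightarrow> J \<subseteq> J' \<Longrightarrow> J' = J"
    using N.maximal_ideal_exists[of _ \<J>] by metis
  then obtain H Z where H: "J = annihilator H Z" "subquotient H Z" "telescoping R M H Z" "\<not> extensible H Z" by (auto simp: \<J>_def)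
  note sD = subquotientD[OF H(2)]
  have IH: "extensible H' Z'" if "subquotient H' Z'" "telescoping R M H' Z'" "annihilator H Z \<subset> annihilator H' Z'" for H' Z'
    using that J(2)[of "annihilator H' Z'"] unfolding \<J>_def H(1) by blast
  have "\<not> primeideal (annihilator H Z) R"
    using extensible_prime[OF H(2,3) _ N count IH] H(4) by blast
  then consider "annihilator H Z = carrier R" | a b where "a \<in> carrier R" "b \<in> carrier R" "a \<otimes>\<^bsub>R\<^esub> b \<in> annihilator H Z" "a \<notin> annihilator H Z" "b \<notin> annihilator H Z"
    using primeidealI[OF annihilator_ideal[OF H(2)] R.is_cring] by blast
  then show False
  proof cases
    case 1
    then have "\<one>\<^bsub>R\<^esub> \<in> annihilator H Z" by simp
    then have "H \<subseteq> Z" using sD(4) by (auto simp: annihilator_def)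
    have "extensible H Z"
      unfolding extensible_def
    proof (intro allI impI exI conjI ballI)
      show "linear R P M (\<lambda>_. \<zero>\<^bsub>M\<^esub>)" by (rule linearI) auto
      show "\<zero>\<^bsub>M\<^esub> \<in> H" by (rule submodule_mem(2)[OF sD(1)])
      show "cong_mod M Z (f k) \<zero>\<^bsub>M\<^esub>" if "quasilinear H Z f" "k \<in> K" for f k
        using quasilinearD(1)[OF that] \<open>H \<subseteq> Z\<close> cong_mod_zero_iff[OF sD(2)] by blast
    qed
    then show False using H(4) by blast
  next
    case (2 a b)
    note s1 = multiples_subquotient[OF H(2) 2(1)]
    have "annihilator H Z \<subset> annihilator H (multiples a H Z)"
    proof -
      have "a \<in> annihilator H (multiples a H Z)" by (rule annihilator_multiples[OF H(2) 2(1)])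
      then show ?thesis using 2(4) subquotientD(3)[OF s1(2)] by (auto simp: annihilator_def)
    qed
    then have e1: "extensible H (multiples a H Z)" by (rule IH[OF s1(1) telescoping_multiples(1)[OF H(2,3) 2(1)]])
    have "annihilator H Z \<subset> annihilator (multiples a H Z) Z"
    proof -
      have "b \<odot>\<^bsub>M\<^esub> y \<in> Z" if y: "y \<in> multiples a H Z" for y
      proof -
        obtain h where h: "h \<in> H" "cong_mod M Z y (a \<odot>\<^bsub>M\<^esub> h)" using y by (auto simp: multiples_def)
        have "b \<odot>\<^bsub>M\<^esub> (a \<odot>\<^bsub>M\<^esub> h) = (a \<otimes>\<^bsub>R\<^esub> b) \<odot>\<^bsub>M\<^esub> h" using 2(1,2) sD(4)[OF h(1)] by algebra
        also have "\<dots> \<in> Z" using 2(3) h(1) by (auto simp: annihilator_def)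
        finally show ?thesis by (rule cong_mod_mem[OF sD(2) cong_mod_smult[OF sD(2) 2(2) h(2)]])
      qed
      then have "b \<in> annihilator (multiples a H Z) Z" using 2(2) by (simp add: annihilator_def)
      then show ?thesis using 2(5) subquotientD(3)[OF s1(1)] by (auto simp: annihilator_def)
    qed
    then have "extensible (multiples a H Z) Z" by (rule IH[OF s1(2) telescoping_multiples(2)[OF H(2,3) 2(1)]])
    then show False using extensible_devissage[OF s1 e1] H(4) by blast
  qed
qed

end

section \<open>A universal ambient module\<close>

text \<open>
  The ambient module consists of the functions that assign to each finite sequence of numbers a pair in the
  direct sum of \<open>P\<close> and \<open>C\<close>. The value at the empty sequence has \<open>C\<close> as a quotient. The
  restriction to the sequences that begin with \<open>n\<close>, \<open>0\<close> is another such function, and together with the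
  value at the one-term sequence \<open>n\<close> it forms the \<open>n\<close>-th term of the decoded sequence.
\<close>

lemma flat_extension:
  fixes R :: "('a, 'r) ring_scheme" and F :: "('a, 'f) module" and C :: "('a, 'c) module"
  assumes noeth: "noetherian_ring R" and count: "countable (spectrum R)"
    and C: "module R C" and t: "telescoping R C (carrier C) {\<zero>\<^bsub>C\<^esub>}" and flat: "flat_module R F"
    and f: "linear R ((res0 R F)\<lparr>carrier := syzygy1 R F\<rparr>) C f"
  shows "\<exists>g. linear R (res0 R F) C g \<and> (\<forall>k \<in> syzygy1 R F. g k = f k)"
proof -
  interpret C: module R C by (rule C)
  have F: "module R F" using flat by (simp add: flat_module_def)
  note pres = presentation_props[OF F]
  interpret P: module R "res0 R F" by (rule pres(1))
  define N where "N = pair_module (res0 R F) C"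
  interpret N: module R N unfolding N_def by (rule pair_module_module[OF pres(1) C])
  define T where "T = (function_module N :: ('a, nat list \<Rightarrow> ('f \<Rightarrow> 'a) \<times> 'c) module)"
  have T: "module R T" unfolding T_def by (rule function_module_module[OF N.module_axioms])
  interpret T: module R T by (rule T)
  have free: "res0 R F = free_module R (carrier F)" by (simp add: res0_def)
  define \<delta> where "\<delta> n w = (fst (w [n]), \<lambda>l. w (n # 0 # l))" for n :: nat and w :: "nat list \<Rightarrow> ('f \<Rightarrow> 'a) \<times> 'c"
  define \<gamma> where "\<gamma> w = snd (w [])" for w :: "nat list \<Rightarrow> ('f \<Rightarrow> 'a) \<times> 'c"
  note sel = T_def function_module_def N_def pair_module_sel
  have \<delta>: "linear R T (pair_module (res0 R F) T) (\<delta> n)" for n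
    by (rule linearI) (auto simp: sel \<delta>_def mem_Times_iff)
  have \<gamma>: "linear R T C \<gamma>"
    by (rule linearI) (auto simp: sel \<gamma>_def mem_Times_iff)
  interpret A: ambient R T "carrier F" "syzygy1 R F" \<delta>
  proof (intro ambient.intro ambient_axioms.intro T)
    show "linear R T (pair_module (free_module R (carrier F)) T) (\<delta> n)" for n using \<delta> by (simp add: free)
    show "submodule (syzygy1 R F) R (free_module R (carrier F))" using pres(5) by (simp add: free)
    show "\<exists>\<theta>. retracts R (free_module R (carrier F)) (syzygy1 R F) A \<theta>" if "finite A" "A \<subseteq> syzygy1 R F" for A
      using flat_retracts[OF flat that] by (simp add: free)
    fix q :: "nat \<Rightarrow> ('f \<Rightarrow> 'a) \<times> (nat list \<Rightarrow> ('f \<Rightarrow> 'a) \<times> 'c)"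
    assume "\<And>n. q n \<in> carrier (pair_module (free_module R (carrier F)) T)"
    then have q: "fst (q n) \<in> carrier (res0 R F)" "snd (q n) \<in> carrier T" for n
      by (simp_all add: pair_module_sel free mem_Times_iff)
    define w where "w l = (case l of n # l' \<Rightarrow> (case l' of [] \<Rightarrow> (fst (q n), \<zero>\<^bsub>C\<^esub>)
        | i # l'' \<Rightarrow> if i = 0 then snd (q n) l'' else \<zero>\<^bsub>N\<^esub>) | [] \<Rightarrow> \<zero>\<^bsub>N\<^esub>)" for l
    have "w l \<in> carrier N" for l
      using q N.zero_closed by (auto simp: T_def function_module_def w_def split: list.splits) (auto simp: N_def pair_module_sel)
    then have "w \<in> carrier T" by (simp add: T_def function_module_def)
    moreover have "\<delta> n w = q n" for n by (simp add: \<delta>_def w_def)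
    ultimately show "\<exists>w \<in> carrier T. \<forall>n. \<delta> n w = q n" by blast
  qed
  define \<iota> where "\<iota> c l = (\<zero>\<^bsub>res0 R F\<^esub>, if l = [] then c else \<zero>\<^bsub>C\<^esub>)" for c :: 'c and l :: "nat list"
  have \<iota>: "\<iota> c \<in> carrier T" if "c \<in> carrier C" for c
    using that by (simp add: sel \<iota>_def)
  have \<gamma>\<iota>: "\<gamma> (\<iota> c) = c" for c by (simp add: \<gamma>_def \<iota>_def)
  define Z where "Z = {w \<in> carrier T. \<gamma> w \<in> {\<zero>\<^bsub>C\<^esub>}}"
  have Z: "submodule Z R T" unfolding Z_def by (rule submodule_vimage[OF T C \<gamma> submodule_zero[OF C]])
  have cong_modZ: "cong_mod T Z x y \<longleftrightarrow> x \<in> carrier T \<and> y \<in> carrier T \<and> \<gamma> x = \<gamma> y" for x y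
    using linear_diff[OF T C \<gamma>] linear_closed[OF \<gamma>] by (auto simp: cong_mod_def Z_def C.diff_zero_iff)
  have s: "A.subquotient (carrier T) Z" using Z T.carrier_is_submodule by (auto simp: A.subquotient_def Z_def)
  have "telescoping R T (carrier T) Z"
  proof (rule A.telescopingI)
    fix st e :: "nat \<Rightarrow> 'a" and d :: "nat \<Rightarrow> nat list \<Rightarrow> ('f \<Rightarrow> 'a) \<times> 'c"
    assume e: "\<And>n. e n \<in> carrier R" "\<And>n. st n \<in> carrier R" "st = step R e" and d: "\<And>n. d n \<in> carrier T"
    obtain x where x: "\<And>n. x n \<in> carrier C" "\<And>n. x n \<ominus>\<^bsub>C\<^esub> st n \<odot>\<^bsub>C\<^esub> x (Suc n) \<ominus>\<^bsub>C\<^esub> \<gamma> (d n) = \<zero>\<^bsub>C\<^esub>"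
      using t[unfolded telescoping_def, rule_format, of e "\<lambda>n. \<gamma> (d n)"] e(1,3) linear_closed[OF \<gamma> d] by auto
    have "x n \<ominus>\<^bsub>C\<^esub> st n \<odot>\<^bsub>C\<^esub> x (Suc n) = \<gamma> (d n)" for n
      using x(2)[of n] x(1) e(2) linear_closed[OF \<gamma> d] by (subst (asm) C.diff_zero_iff) auto
    then have "cong_mod T Z (\<iota> (x n) \<ominus>\<^bsub>T\<^esub> st n \<odot>\<^bsub>T\<^esub> \<iota> (x (Suc n))) (d n)" for n
      using \<iota> x(1) e(2) d by (simp add: cong_modZ linear_diff[OF T C \<gamma>] linear_smult[OF \<gamma>] \<gamma>\<iota>)
    then show "\<exists>x. (\<forall>n. x n \<in> carrier T) \<and> (\<forall>n. cong_mod T Z (x n \<ominus>\<^bsub>T\<^esub> st n \<odot>\<^bsub>T\<^esub> x (Suc n)) (d n))"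
      using \<iota>[OF x(1)] by (intro exI[of _ "\<lambda>n. \<iota> (x n)"]) blast
  qed
  from A.extensible_telescoping[OF noeth count s this] have "A.extensible (carrier T) Z" .
  moreover have "A.quasilinear (carrier T) Z (\<lambda>k. \<iota> (f k))"
  proof -
    have fc: "f k \<in> carrier C" if "k \<in> syzygy1 R F" for k using linear_closed[OF f] that by simp
    have "f (k \<oplus>\<^bsub>res0 R F\<^esub> k') = f k \<oplus>\<^bsub>C\<^esub> f k'" if "k \<in> syzygy1 R F" "k' \<in> syzygy1 R F" for k k'
      using linear_add[OF f] that by simp
    moreover have "f (a \<odot>\<^bsub>res0 R F\<^esub> k) = a \<odot>\<^bsub>C\<^esub> f k" if "a \<in> carrier R" "k \<in> syzygy1 R F" for a k
      using linear_smult[OF f] that by simp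
    ultimately show ?thesis
      unfolding A.quasilinear_def cong_modZ free[symmetric] using \<iota> fc P.submodule_mem[OF pres(5)]
      by (auto simp: linear_add[OF \<gamma>] linear_smult[OF \<gamma>] \<gamma>\<iota>)
  qed
  ultimately obtain g where g: "linear R (res0 R F) T g" "\<And>k. k \<in> syzygy1 R F \<Longrightarrow> cong_mod T Z (\<iota> (f k)) (g k)"
    unfolding A.extensible_def free by blast
  have "\<gamma> (g k) = f k" if "k \<in> syzygy1 R F" for k using g(2)[OF that] by (simp add: cong_modZ \<gamma>\<iota>)
  then show ?thesis using linear_comp[OF g(1) \<gamma>] by blast
qed

theorem corollary1p20:
  fixes R :: "('a, 'r) ring_scheme"
    and C :: "('a, 'c) module"
  assumes "cring R" and "noetherian_ring R"
    and "countable (spectrum R)"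
    and "almost_cotorsion R C"
  shows "cotorsion TYPE('f) R C"
proof -
  have C: "module R C" using assms(4) by (simp add: almost_cotorsion_def)
  have "zero_module (Ext1 R F C)" if flat: "flat_module R F" for F :: "('a, 'f) module"
  proof -
    have F: "module R F" using flat by (simp add: flat_module_def)
    show ?thesis
      unfolding Ext1_zero_iff[OF F C]
      using flat_extension[OF assms(2,3) C almost_cotorsion_telescoping[OF assms(4)] flat] by blast
  qed
  then show ?thesis using C by (simp add: cotorsion_def)
qed

end
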